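(* Let $p$ be a prime and let $F$ be a field of characteristic not $p$, with separable closure $F_{sep}/F$. Let $V$ be a two-dimensional Galois representation of $G:=\mathrm{Gal}(F_{sep}/F)$ over $\mathbb F_p$. For each $v\in V$, let $G_v\subset G$ be the stabilizer of $v$, and let $\phi_v$ be the composite $$H^1(G_v,\mathbb F_p)\to H^1(G_v,V)\xrightarrow{\ \mathrm{Cor}_{G_v}^G\ }H^1(G,V),$$ where the first map is induced by the $G_v$-equivariant map $\mathbb F_p\to V$, $1\mapsto v$. Then the map $$\bigoplus_{v\in V}H^1(G_v,\mathbb F_p)\xrightarrow{\ \oplus\phi_v\ }H^1(G,V)$$ is surjective.
   Context: A Galois representation over $\mathbb F_p$ is a finite-dimensional $\mathbb F_p$-vector space with a continuous (i.e. locally constant) linear action of $G$. $\mathbb F_p$ carries the trivial action; cohomology is continuous (profinite group) cohomology and $\mathrm{Cor}$ is the corestriction from an open subgroup. *)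

theory Defs
  imports
    "HOL-Algebra.Group_Action"
    "HOL-Algebra.Left_Coset"
    "HOL-Algebra.Product_Groups"
    "HOL-Analysis.Abstract_Topology"
    "Berlekamp_Zassenhaus.Finite_Field"
begin

section \<open>Separable closures and absolute Galois groups\<close>

definition separable_poly :: "'a::field poly \<Rightarrow> bool" where
  "separable_poly f \<longleftrightarrow> coprime f (pderiv f)"

text \<open>
  The extension is given by the embedding \<open>\<iota>\<close> of the base field into the larger one.
  An irreducible polynomial with root \<open>x\<close> is the minimal polynomial of \<open>x\<close> up to a unit.
\<close>

definition separable_over :: "('f::field \<Rightarrow> 'l::field) \<Rightarrow> 'l \<Rightarrow> bool" where
  "separable_over \<iota> x \<longleftrightarrow>
     (\<exists>f. Factorial_Ring.irreducible f \<and> separable_poly f \<and> poly (map_poly \<iota> f) x = 0)"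

definition separable_closure :: "('f::field \<Rightarrow> 'l::field) \<Rightarrow> bool" where
  "separable_closure \<iota> \<longleftrightarrow>
     field_hom \<iota> \<and>
     (\<forall>x. separable_over \<iota> x) \<and>
     (\<forall>f :: 'l poly. degree f > 0 \<and> separable_poly f \<longrightarrow> (\<exists>x. poly f x = 0))"

definition Gal :: "('f::field \<Rightarrow> 'l::field) \<Rightarrow> ('l \<Rightarrow> 'l) monoid" where
  "Gal \<iota> = \<lparr>carrier = {\<sigma>. field_hom \<sigma> \<and> bij \<sigma> \<and> (\<forall>a. \<sigma> (\<iota> a) = \<iota> a)},
            monoid.mult = (\<circ>), one = id\<rparr>"

text \<open>
  The basic neighbourhoods of \<open>\<sigma>\<close> in the Krull topology are the cosets of the groups of
  automorphisms fixing a finite subextension.  If the extension is algebraic, the latter are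
  generated by finite sets \<open>S\<close>, and \<open>\<tau>\<close> lies in the coset of \<open>\<sigma>\<close> iff it agrees with \<open>\<sigma>\<close> on \<open>S\<close>.
\<close>

definition krull_topology :: "('f::field \<Rightarrow> 'l::field) \<Rightarrow> ('l \<Rightarrow> 'l) topology" where
  "krull_topology \<iota> = topology (\<lambda>U. U \<subseteq> carrier (Gal \<iota>) \<and>
     (\<forall>\<sigma>\<in>U. \<exists>S. finite S \<and> {\<tau> \<in> carrier (Gal \<iota>). \<forall>x\<in>S. \<tau> x = \<sigma> x} \<subseteq> U))"

text \<open>
  The field with \<open>p\<close> elements is \<^typ>\<open>'p::prime_card mod_ring\<close>, where \<open>p = CARD('p)\<close>.
\<close>

definition galois_representation ::
  "('f::field \<Rightarrow> 'l::field) \<Rightarrow> ('p::prime_card mod_ring \<Rightarrow> 'v::ab_group_add \<Rightarrow> 'v)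
     \<Rightarrow> (('l \<Rightarrow> 'l) \<Rightarrow> 'v \<Rightarrow> 'v) \<Rightarrow> bool" where
  "galois_representation \<iota> scale \<rho> \<longleftrightarrow>
     (\<exists>B. finite_dimensional_vector_space scale B) \<and>
     group_action (Gal \<iota>) UNIV \<rho> \<and>
     (\<forall>\<sigma>\<in>carrier (Gal \<iota>). Vector_Spaces.linear scale scale (\<rho> \<sigma>)) \<and>
     continuous_map (krull_topology \<iota>) (discrete_topology UNIV) \<rho>"

section \<open>Continuous cohomology in degree one\<close>

text \<open>
  Below, \<open>T\<close> is a topology on the carrier of the group \<open>G\<close>, and \<open>\<rho>\<close> is an action of \<open>G\<close> by
  automorphisms on the discrete abelian group \<^typ>\<open>'m\<close>.  A cochain is undefined outside the
  carrier, so that it is determined by its values on the group.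
\<close>

definition Z1 :: "('g, 'x) monoid_scheme \<Rightarrow> 'g topology \<Rightarrow> ('g \<Rightarrow> 'm \<Rightarrow> 'm::ab_group_add)
    \<Rightarrow> ('g \<Rightarrow> 'm) monoid" where
  "Z1 G T \<rho> = \<lparr>carrier = {c \<in> extensional (carrier G).
                 continuous_map T (discrete_topology UNIV) c \<and>
                 (\<forall>g\<in>carrier G. \<forall>h\<in>carrier G. c (g \<otimes>\<^bsub>G\<^esub> h) = c g + \<rho> g (c h))},
               monoid.mult = (\<lambda>c d. \<lambda>g\<in>carrier G. c g + d g),
               one = (\<lambda>g\<in>carrier G. 0)\<rparr>"

definition B1 :: "('g, 'x) monoid_scheme \<Rightarrow> ('g \<Rightarrow> 'm \<Rightarrow> 'm::ab_group_add)
    \<Rightarrow> ('g \<Rightarrow> 'm) set" where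
  "B1 G \<rho> = range (\<lambda>m. \<lambda>g\<in>carrier G. \<rho> g m - m)"

definition H1 :: "('g, 'x) monoid_scheme \<Rightarrow> 'g topology \<Rightarrow> ('g \<Rightarrow> 'm \<Rightarrow> 'm::ab_group_add)
    \<Rightarrow> ('g \<Rightarrow> 'm) set monoid" where
  "H1 G T \<rho> = Z1 G T \<rho> Mod B1 G \<rho>"

definition H1_class :: "('g, 'x) monoid_scheme \<Rightarrow> 'g topology \<Rightarrow> ('g \<Rightarrow> 'm \<Rightarrow> 'm::ab_group_add)
    \<Rightarrow> ('g \<Rightarrow> 'm) \<Rightarrow> ('g \<Rightarrow> 'm) set" where
  "H1_class G T \<rho> c = B1 G \<rho> #>\<^bsub>Z1 G T \<rho>\<^esub> c"

text \<open>The map induced by an equivariant homomorphism \<open>f\<close> into the module with action \<open>\<rho>\<close>.\<close>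

definition H1_map :: "('g, 'x) monoid_scheme \<Rightarrow> 'g topology \<Rightarrow> ('g \<Rightarrow> 'n \<Rightarrow> 'n::ab_group_add)
    \<Rightarrow> ('m \<Rightarrow> 'n) \<Rightarrow> ('g \<Rightarrow> 'm) set \<Rightarrow> ('g \<Rightarrow> 'n) set" where
  "H1_map G T \<rho> f X = the_elem ((\<lambda>c. H1_class G T \<rho> (\<lambda>g\<in>carrier G. f (c g))) ` X)"

text \<open>
  Corestriction from an open subgroup \<open>U\<close> of finite index is the transfer: if \<open>r C\<close> represents
  the left coset \<open>C\<close>, then \<open>g \<otimes> r C = r (g <# C) \<otimes> u\<close> with \<open>u \<in> U\<close>, and the value at \<open>g\<close> of
  the corestriction of \<open>c\<close> is the sum over \<open>C\<close> of the \<open>r (g <# C)\<close>-translates of \<open>c u\<close>.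
  The class of the result depends neither on \<open>r\<close> nor on the cocycle representing the given class
  (\<open>corestriction_H1_class\<close> below).  In degree zero this corresponds to the norm map \<open>m \<mapsto> (\<Sum>C. \<rho> (r C) m)\<close>.
\<close>

definition cor_cochain :: "('g, 'x) monoid_scheme \<Rightarrow> 'g set \<Rightarrow> ('g \<Rightarrow> 'm \<Rightarrow> 'm::ab_group_add)
    \<Rightarrow> ('g set \<Rightarrow> 'g) \<Rightarrow> ('g \<Rightarrow> 'm) \<Rightarrow> 'g \<Rightarrow> 'm" where
  "cor_cochain G U \<rho> r c = (\<lambda>g\<in>carrier G. \<Sum>C\<in>lcosets\<^bsub>G\<^esub> U.
     \<rho> (r (g <#\<^bsub>G\<^esub> C)) (c (inv\<^bsub>G\<^esub> (r (g <#\<^bsub>G\<^esub> C)) \<otimes>\<^bsub>G\<^esub> g \<otimes>\<^bsub>G\<^esub> r C)))"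

definition corestriction :: "('g, 'x) monoid_scheme \<Rightarrow> 'g topology \<Rightarrow> 'g set
    \<Rightarrow> ('g \<Rightarrow> 'm \<Rightarrow> 'm::ab_group_add) \<Rightarrow> ('g \<Rightarrow> 'm) set \<Rightarrow> ('g \<Rightarrow> 'm) set" where
  "corestriction G T U \<rho> X =
     the_elem ((\<lambda>c. H1_class G T \<rho> (cor_cochain G U \<rho> (\<lambda>C. SOME t. t \<in> C) c)) ` X)"

section \<open>The maps from the cohomology of the stabilizers\<close>

definition H1_stab :: "('f::field \<Rightarrow> 'l::field) \<Rightarrow> (('l \<Rightarrow> 'l) \<Rightarrow> 'v \<Rightarrow> 'v) \<Rightarrow> 'v
    \<Rightarrow> (('l \<Rightarrow> 'l) \<Rightarrow> 'm \<Rightarrow> 'm::ab_group_add) \<Rightarrow> (('l \<Rightarrow> 'l) \<Rightarrow> 'm) set monoid" where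
  "H1_stab \<iota> \<rho> v =
     H1 (Gal \<iota>\<lparr>carrier := stabilizer (Gal \<iota>) \<rho> v\<rparr>)
        (subtopology (krull_topology \<iota>) (stabilizer (Gal \<iota>) \<rho> v))"

definition phi :: "('f::field \<Rightarrow> 'l::field)
    \<Rightarrow> ('p::prime_card mod_ring \<Rightarrow> 'v::ab_group_add \<Rightarrow> 'v) \<Rightarrow> (('l \<Rightarrow> 'l) \<Rightarrow> 'v \<Rightarrow> 'v) \<Rightarrow> 'v
    \<Rightarrow> (('l \<Rightarrow> 'l) \<Rightarrow> 'p mod_ring) set \<Rightarrow> (('l \<Rightarrow> 'l) \<Rightarrow> 'v) set" where
  "phi \<iota> scale \<rho> v =
     corestriction (Gal \<iota>) (krull_topology \<iota>) (stabilizer (Gal \<iota>) \<rho> v) \<rho> \<circ>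
     H1_map (Gal \<iota>\<lparr>carrier := stabilizer (Gal \<iota>) \<rho> v\<rparr>)
       (subtopology (krull_topology \<iota>) (stabilizer (Gal \<iota>) \<rho> v)) \<rho> (\<lambda>a. scale a v)"

section \<open>Well-definedness\<close>


lemma istopology_krull:
  "istopology (\<lambda>U. U \<subseteq> carrier (Gal \<iota>) \<and>
     (\<forall>\<sigma>\<in>U. \<exists>S. finite S \<and> {\<tau> \<in> carrier (Gal \<iota>). \<forall>x\<in>S. \<tau> x = \<sigma> x} \<subseteq> U))"
  (is "istopology ?P")
  unfolding istopology_def
proof (intro conjI allI impI)
  fix U V assume U: "?P U" and V: "?P V"
  show "U \<inter> V \<subseteq> carrier (Gal \<iota>)" using U by blast
  show "\<forall>\<sigma>\<in>U \<inter> V. \<exists>S. finite S \<and> {\<tau> \<in> carrier (Gal \<iota>). \<forall>x\<in>S. \<tau> x = \<sigma> x} \<subseteq> U \<inter> V"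
  proof
    fix \<sigma> assume "\<sigma> \<in> U \<inter> V"
    then obtain S S' where S: "finite S" "{\<tau> \<in> carrier (Gal \<iota>). \<forall>x\<in>S. \<tau> x = \<sigma> x} \<subseteq> U"
      and S': "finite S'" "{\<tau> \<in> carrier (Gal \<iota>). \<forall>x\<in>S'. \<tau> x = \<sigma> x} \<subseteq> V"
      using U V by (meson IntD1 IntD2)
    show "\<exists>S. finite S \<and> {\<tau> \<in> carrier (Gal \<iota>). \<forall>x\<in>S. \<tau> x = \<sigma> x} \<subseteq> U \<inter> V"
      by (rule exI[of _ "S \<union> S'"]) (use S S' in auto)
  qed
next
  fix K assume K: "\<forall>U\<in>K. ?P U"
  then show "\<Union>K \<subseteq> carrier (Gal \<iota>)" by blast
  show "\<forall>\<sigma>\<in>\<Union>K. \<exists>S. finite S \<and> {\<tau> \<in> carrier (Gal \<iota>). \<forall>x\<in>S. \<tau> x = \<sigma> x} \<subseteq> \<Union>K"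
  proof
    fix \<sigma> assume "\<sigma> \<in> \<Union>K"
    then obtain U where "U \<in> K" "\<sigma> \<in> U" by blast
    with K obtain S where "finite S" "{\<tau> \<in> carrier (Gal \<iota>). \<forall>x\<in>S. \<tau> x = \<sigma> x} \<subseteq> U" by meson
    with \<open>U \<in> K\<close> show "\<exists>S. finite S \<and> {\<tau> \<in> carrier (Gal \<iota>). \<forall>x\<in>S. \<tau> x = \<sigma> x} \<subseteq> \<Union>K" by blast
  qed
qed

lemma openin_krull_topology:
  "openin (krull_topology \<iota>) U \<longleftrightarrow> U \<subseteq> carrier (Gal \<iota>) \<and>
     (\<forall>\<sigma>\<in>U. \<exists>S. finite S \<and> {\<tau> \<in> carrier (Gal \<iota>). \<forall>x\<in>S. \<tau> x = \<sigma> x} \<subseteq> U)"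
  unfolding krull_topology_def topology_inverse'[OF istopology_krull] ..

lemma topspace_krull_topology [simp]: "topspace (krull_topology \<iota>) = carrier (Gal \<iota>)"
proof -
  have "openin (krull_topology \<iota>) (carrier (Gal \<iota>))"
    unfolding openin_krull_topology by blast
  then show ?thesis
    by (meson openin_krull_topology openin_subset openin_topspace subset_antisym)
qed

lemma field_hom_comp: "field_hom (f :: 'b::field \<Rightarrow> 'c::field) \<Longrightarrow> field_hom (g :: 'a::field \<Rightarrow> 'b) \<Longrightarrow> field_hom (f \<circ> g)"
proof -
  assume f: "field_hom f" and g: "field_hom g"
  interpret f: field_hom f by (rule f)
  interpret g: field_hom g by (rule g)
  show ?thesis
    by unfold_locales (simp_all add: f.hom_add g.hom_add f.hom_mult g.hom_mult)
qed

lemma field_hom_inv: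
  assumes "field_hom (f :: 'b::field \<Rightarrow> 'c::field)" "bij f" shows "field_hom (Hilbert_Choice.inv f)"
proof -
  interpret f: field_hom f by (rule assms)
  have e: "Hilbert_Choice.inv f (f x) = x" for x using assms(2) by (simp add: bij_is_inj)
  have e': "f (Hilbert_Choice.inv f x) = x" for x using assms(2) by (simp add: bij_is_surj surj_f_inv_f)
  show ?thesis
    apply unfold_locales
    apply (metis e f.hom_zero) 
    apply (metis e e' f.hom_add) 
    apply (metis e f.hom_one) 
    apply (metis e e' f.hom_mult) 
    done
qed

lemma group_Gal: "group (Gal \<iota>)"
proof (rule groupI)
  show "\<one>\<^bsub>Gal \<iota>\<^esub> \<in> carrier (Gal \<iota>)"
    by (simp add: Gal_def) (unfold_locales, auto)
  fix x assume x: "x \<in> carrier (Gal \<iota>)"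
  show "\<exists>y\<in>carrier (Gal \<iota>). y \<otimes>\<^bsub>Gal \<iota>\<^esub> x = \<one>\<^bsub>Gal \<iota>\<^esub>"
    using x by (intro bexI[of _ "Hilbert_Choice.inv x"])
      (auto simp: Gal_def field_hom_inv bij_imp_bij_inv bij_is_inj inv_f_eq)
qed (auto simp: Gal_def field_hom_comp bij_comp comp_assoc)

lemma continuous_map_discrete_iff:
  "continuous_map T (discrete_topology UNIV) f \<longleftrightarrow>
     (\<forall>x\<in>topspace T. \<exists>V. openin T V \<and> x \<in> V \<and> (\<forall>y\<in>V. f y = f x))"
proof
  assume f: "continuous_map T (discrete_topology UNIV) f"
  show "\<forall>x\<in>topspace T. \<exists>V. openin T V \<and> x \<in> V \<and> (\<forall>y\<in>V. f y = f x)"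
  proof
    fix x assume x: "x \<in> topspace T"
    have "openin T {y \<in> topspace T. f y \<in> {f x}}"
      by (rule openin_continuous_map_preimage[OF f]) auto
    with x show "\<exists>V. openin T V \<and> x \<in> V \<and> (\<forall>y\<in>V. f y = f x)"
      by (intro exI[of _ "{y \<in> topspace T. f y \<in> {f x}}"]) auto
  qed
next
  assume R: "\<forall>x\<in>topspace T. \<exists>V. openin T V \<and> x \<in> V \<and> (\<forall>y\<in>V. f y = f x)"
  show "continuous_map T (discrete_topology UNIV) f"
    unfolding continuous_map_def
  proof (intro conjI allI impI)
    fix U
    show "openin T {x \<in> topspace T. f x \<in> U}"
    proof (subst openin_subopen, intro ballI)
      fix x assume x: "x \<in> {x \<in> topspace T. f x \<in> U}"
      then obtain V where V: "openin T V" "x \<in> V" "\<forall>y\<in>V. f y = f x" using R by blast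
      have "V \<subseteq> {x \<in> topspace T. f x \<in> U}"
      proof
        fix y assume y: "y \<in> V"
        then have "f y = f x" "y \<in> topspace T"
          using V(3) openin_subset[OF V(1)] by blast+
        with x show "y \<in> {x \<in> topspace T. f x \<in> U}" by simp
      qed
      with V show "\<exists>V. openin T V \<and> x \<in> V \<and> V \<subseteq> {x \<in> topspace T. f x \<in> U}"
        by blast
    qed
  qed auto
qed

lemma continuous_map_discrete_combine:
  assumes "continuous_map T (discrete_topology UNIV) f" "continuous_map T (discrete_topology UNIV) g"
    and "\<And>x. x \<in> topspace T \<Longrightarrow> h x = F (f x) (g x)"
  shows "continuous_map T (discrete_topology UNIV) h"
  unfolding continuous_map_discrete_iff
proof
  fix x assume x: "x \<in> topspace T"
  obtain V where V: "openin T V" "x \<in> V" "\<forall>y\<in>V. f y = f x"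
    using assms(1) x unfolding continuous_map_discrete_iff by blast
  obtain W where W: "openin T W" "x \<in> W" "\<forall>y\<in>W. g y = g x"
    using assms(2) x unfolding continuous_map_discrete_iff by blast
  have "h y = h x" if "y \<in> V \<inter> W" for y
  proof -
    have "y \<in> topspace T" using V(1) that openin_subset by blast
    moreover have "f y = f x" "g y = g x" using V(3) W(3) that by blast+
    ultimately show ?thesis using x by (simp add: assms(3))
  qed
  with V W show "\<exists>V. openin T V \<and> x \<in> V \<and> (\<forall>y\<in>V. h y = h x)"
    by (meson IntI openin_Int)
qed

locale discrete_module = group G for G (structure) +
  fixes T :: "'a topology" and \<rho> :: "'a \<Rightarrow> 'm \<Rightarrow> 'm::ab_group_add"
  assumes topspace_eq: "topspace T = carrier G"
    and translation: "a \<in> carrier G \<Longrightarrow> b \<in> carrier G \<Longrightarrow> continuous_map T T (\<lambda>g. a \<otimes> g \<otimes> b)"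
    and act_one: "\<rho> \<one> m = m"
    and act_mult: "g \<in> carrier G \<Longrightarrow> h \<in> carrier G \<Longrightarrow> \<rho> (g \<otimes> h) m = \<rho> g (\<rho> h m)"
    and act_add: "g \<in> carrier G \<Longrightarrow> \<rho> g (m + n) = \<rho> g m + \<rho> g n"
    and act_continuous: "continuous_map T (discrete_topology UNIV) (\<lambda>g. \<rho> g m)"
begin

lemma act_zero: "g \<in> carrier G \<Longrightarrow> \<rho> g 0 = 0"
  using act_add[of g 0 0] by simp

lemma act_uminus: "g \<in> carrier G \<Longrightarrow> \<rho> g (- m) = - \<rho> g m"
  using act_add[of g m "- m"] act_zero[of g] by (simp add: eq_neg_iff_add_eq_0 add.commute)

lemma act_diff: "g \<in> carrier G \<Longrightarrow> \<rho> g (m - n) = \<rho> g m - \<rho> g n"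
  using act_add[of g m "- n"] by (simp add: act_uminus)

lemma act_sum: "g \<in> carrier G \<Longrightarrow> \<rho> g (sum f A) = (\<Sum>a\<in>A. \<rho> g (f a))"
  by (induction A rule: infinite_finite_induct) (simp_all add: act_zero act_add)

lemma Z1_iff: "c \<in> carrier (Z1 G T \<rho>) \<longleftrightarrow> c \<in> extensional (carrier G) \<and>
    continuous_map T (discrete_topology UNIV) c \<and>
    (\<forall>g\<in>carrier G. \<forall>h\<in>carrier G. c (g \<otimes> h) = c g + \<rho> g (c h))"
  by (simp add: Z1_def)

lemma comm_group_Z1: "comm_group (Z1 G T \<rho>)"
proof (rule comm_groupI)
  let ?Z = "Z1 G T \<rho>"
  fix x y z assume xyz: "x \<in> carrier ?Z" "y \<in> carrier ?Z" "z \<in> carrier ?Z"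
  show "x \<otimes>\<^bsub>?Z\<^esub> y \<in> carrier ?Z"
    using xyz continuous_map_discrete_combine[of T x y "\<lambda>g\<in>carrier G. x g + y g" "(+)"]
    by (auto simp: Z1_def topspace_eq act_add)
  show "x \<otimes>\<^bsub>?Z\<^esub> y \<otimes>\<^bsub>?Z\<^esub> z = x \<otimes>\<^bsub>?Z\<^esub> (y \<otimes>\<^bsub>?Z\<^esub> z)"
    by (auto simp: Z1_def restrict_def add.assoc)
  show "x \<otimes>\<^bsub>?Z\<^esub> y = y \<otimes>\<^bsub>?Z\<^esub> x"
    by (auto simp: Z1_def add.commute)
next
  let ?Z = "Z1 G T \<rho>"
  fix x assume x: "x \<in> carrier ?Z"
  show "\<one>\<^bsub>?Z\<^esub> \<otimes>\<^bsub>?Z\<^esub> x = x"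
    using x by (auto simp: Z1_def restrict_def extensional_def)
  have "(\<lambda>g\<in>carrier G. - x g) \<in> carrier ?Z"
    using x continuous_map_discrete_combine[of T x x "\<lambda>g\<in>carrier G. - x g" "\<lambda>a _. - a"]
    by (auto simp: Z1_def topspace_eq act_uminus)
  then show "\<exists>y\<in>carrier ?Z. y \<otimes>\<^bsub>?Z\<^esub> x = \<one>\<^bsub>?Z\<^esub>"
    by (rule bexI[rotated]) (auto simp: Z1_def restrict_def)
next
  show "\<one>\<^bsub>Z1 G T \<rho>\<^esub> \<in> carrier (Z1 G T \<rho>)"
    using continuous_map_discrete_combine[of T "\<lambda>_. 0::'m" "\<lambda>_. 0::'m" "\<lambda>g\<in>carrier G. 0::'m" "(+)"]
    by (auto simp: Z1_def topspace_eq act_zero)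
qed

lemma coboundary_in_Z1: "(\<lambda>g\<in>carrier G. \<rho> g m - m) \<in> carrier (Z1 G T \<rho>)"
  using continuous_map_discrete_combine[OF act_continuous[of m] act_continuous[of m], of "\<lambda>g\<in>carrier G. \<rho> g m - m" "\<lambda>a _. a - m"]
  by (auto simp: Z1_def topspace_eq act_mult act_diff)

lemma inv_Z1: "c \<in> carrier (Z1 G T \<rho>) \<Longrightarrow> inv\<^bsub>Z1 G T \<rho>\<^esub> c = (\<lambda>g\<in>carrier G. - c g)"
proof -
  assume c: "c \<in> carrier (Z1 G T \<rho>)"
  interpret Z: comm_group "Z1 G T \<rho>" by (rule comm_group_Z1)
  have "(\<lambda>g\<in>carrier G. - c g) \<in> carrier (Z1 G T \<rho>)"
    using c continuous_map_discrete_combine[of T c c "\<lambda>g\<in>carrier G. - c g" "\<lambda>a _. - a"]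
    by (auto simp: Z1_def topspace_eq act_uminus)
  then show ?thesis
    using c by (intro Z.inv_equality) (auto simp: Z1_def restrict_def)
qed

lemma subgroup_B1: "subgroup (B1 G \<rho>) (Z1 G T \<rho>)"
proof -
  interpret Z: comm_group "Z1 G T \<rho>" by (rule comm_group_Z1)
  show ?thesis
  proof (rule Z.subgroupI)
    fix a assume "a \<in> B1 G \<rho>"
    then obtain m where a: "a = (\<lambda>g\<in>carrier G. \<rho> g m - m)" by (auto simp: B1_def)
    then have "inv\<^bsub>Z1 G T \<rho>\<^esub> a = (\<lambda>g\<in>carrier G. \<rho> g (- m) - (- m))"
      by (auto simp: inv_Z1 coboundary_in_Z1 act_uminus)
    then show "inv\<^bsub>Z1 G T \<rho>\<^esub> a \<in> B1 G \<rho>" unfolding B1_def by (intro range_eqI) 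
    fix b assume "b \<in> B1 G \<rho>"
    then obtain n where b: "b = (\<lambda>g\<in>carrier G. \<rho> g n - n)" by (auto simp: B1_def)
    have "a \<otimes>\<^bsub>Z1 G T \<rho>\<^esub> b = (\<lambda>g\<in>carrier G. \<rho> g (m + n) - (m + n))"
      by (auto simp: a b Z1_def act_add)
    then show "a \<otimes>\<^bsub>Z1 G T \<rho>\<^esub> b \<in> B1 G \<rho>" unfolding B1_def by (intro range_eqI)
  qed (auto simp: B1_def coboundary_in_Z1)
qed

lemma normal_B1: "B1 G \<rho> \<lhd> Z1 G T \<rho>"
  by (simp add: comm_group.normal_iff_subgroup comm_group_Z1 subgroup_B1)

lemma comm_group_H1: "comm_group (H1 G T \<rho>)"
  unfolding H1_def by (rule comm_group.abelian_FactGroup[OF comm_group_Z1 subgroup_B1])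

lemma H1_class_eq_iff:
  assumes "c \<in> carrier (Z1 G T \<rho>)" "d \<in> carrier (Z1 G T \<rho>)"
  shows "H1_class G T \<rho> c = H1_class G T \<rho> d \<longleftrightarrow> (\<exists>m. \<forall>g\<in>carrier G. c g = d g + (\<rho> g m - m))"
proof -
  interpret Z: comm_group "Z1 G T \<rho>" by (rule comm_group_Z1)
  have "H1_class G T \<rho> c = H1_class G T \<rho> d \<longleftrightarrow> c \<in> H1_class G T \<rho> d"
    unfolding H1_class_def
    using Z.repr_independence[OF _ assms(2) subgroup_B1] Z.rcos_self[OF assms(1) subgroup_B1] by blast
  also have "\<dots> \<longleftrightarrow> (\<exists>m. \<forall>g\<in>carrier G. c g = d g + (\<rho> g m - m))"
  proof
    assume "c \<in> H1_class G T \<rho> d"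
    then show "\<exists>m. \<forall>g\<in>carrier G. c g = d g + (\<rho> g m - m)"
      by (auto simp: H1_class_def r_coset_def B1_def Z1_def algebra_simps)
  next
    assume "\<exists>m. \<forall>g\<in>carrier G. c g = d g + (\<rho> g m - m)"
    then obtain m where "\<forall>g\<in>carrier G. c g = d g + (\<rho> g m - m)" by blast
    then have "c = (\<lambda>g\<in>carrier G. \<rho> g m - m) \<otimes>\<^bsub>Z1 G T \<rho>\<^esub> d"
      using assms by (auto simp: Z1_def extensional_def restrict_def fun_eq_iff algebra_simps)
    then show "c \<in> H1_class G T \<rho> d"
      by (auto simp: H1_class_def r_coset_def B1_def)
  qed
  finally show ?thesis .
qed

lemma carrier_H1: "carrier (H1 G T \<rho>) = H1_class G T \<rho> ` carrier (Z1 G T \<rho>)"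
  by (auto simp: H1_def H1_class_def FactGroup_def RCOSETS_def)

lemma mem_H1_class:
  assumes "c \<in> carrier (Z1 G T \<rho>)" "d \<in> H1_class G T \<rho> c"
  shows "d \<in> carrier (Z1 G T \<rho>) \<and> (\<exists>m. \<forall>g\<in>carrier G. d g = c g + (\<rho> g m - m))"
proof -
  interpret Z: comm_group "Z1 G T \<rho>" by (rule comm_group_Z1)
  have "d \<in> carrier (Z1 G T \<rho>)"
    using assms Z.r_coset_subset_G[OF subgroup.subset[OF subgroup_B1]] unfolding H1_class_def by blast
  moreover have "H1_class G T \<rho> d = H1_class G T \<rho> c"
    using Z.repr_independence[OF _ assms(1) subgroup_B1] assms(2) unfolding H1_class_def by blast
  ultimately show ?thesis using H1_class_eq_iff assms(1) by blast
qed

lemma self_mem_H1_class: "c \<in> carrier (Z1 G T \<rho>) \<Longrightarrow> c \<in> H1_class G T \<rho> c"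
  unfolding H1_class_def
  using group.rcos_self[OF comm_group.axioms(2)[OF comm_group_Z1] _ subgroup_B1] by blast

lemma lcosets_closed:
  assumes "subgroup U G" "g \<in> carrier G" "C \<in> lcosets U"
  shows "g <# C \<in> lcosets U"
proof -
  obtain a where a: "a \<in> carrier G" "C = a <# U" using assms(3) by (auto simp: LCOSETS_def)
  then have "g <# C = (g \<otimes> a) <# U"
    using lcos_m_assoc[OF subgroup.subset[OF assms(1)] assms(2) a(1)] by simp
  then show ?thesis using assms(2) a(1) by (auto simp: LCOSETS_def)
qed

lemma lcosets_subset: "subgroup U G \<Longrightarrow> C \<in> lcosets U \<Longrightarrow> C \<subseteq> carrier G"
  by (rule subgroup.lcosets_carrier[OF _ is_group])

lemma lcosets_mult:
  assumes "subgroup U G" "g \<in> carrier G" "h \<in> carrier G" "C \<in> lcosets U"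
  shows "(g \<otimes> h) <# C = g <# (h <# C)"
  using lcos_m_assoc[OF lcosets_subset[OF assms(1,4)] assms(2,3)] by simp

lemma lcosets_bij:
  assumes "subgroup U G" "g \<in> carrier G"
  shows "bij_betw (\<lambda>C. g <# C) (lcosets U) (lcosets U)"
proof (rule bij_betwI[where g = "\<lambda>C. inv g <# C"])
  show "(\<lambda>C. g <# C) \<in> lcosets U \<rightarrow> lcosets U" "(\<lambda>C. inv g <# C) \<in> lcosets U \<rightarrow> lcosets U"
    using assms by (auto intro: lcosets_closed)
  fix C assume C: "C \<in> lcosets U"
  show "inv g <# (g <# C) = C" "g <# (inv g <# C) = C"
    using lcosets_mult[OF assms(1) _ _ C, of "inv g" g] lcosets_mult[OF assms(1) _ _ C, of g "inv g"]
      assms lcosets_subset[OF assms(1) C] by (simp_all add: lcos_mult_one)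
qed

lemma lcoset_mem_iff:
  assumes "subgroup U G" "C \<in> lcosets U" "x \<in> C" "y \<in> carrier G"
  shows "y \<in> C \<longleftrightarrow> inv x \<otimes> y \<in> U"
proof -
  obtain a where a: "a \<in> carrier G" "C = a <# U" using assms(2) by (auto simp: LCOSETS_def)
  have x: "x \<in> carrier G" using lcosets_subset assms by blast
  have "C = x <# U"
    using l_repr_independence[OF _ a(1) assms(1)] assms(3) a by simp
  then show ?thesis
    using subgroup.lcos_module_imp[OF assms(1) is_group x] subgroup.lcos_module_rev[OF assms(1) is_group x assms(4)]
    by blast
qed

lemma submodule: "subgroup U G \<Longrightarrow> discrete_module (G\<lparr>carrier := U\<rparr>) (subtopology T U) \<rho>"
proof -
  assume U: "subgroup U G"
  interpret H: group "G\<lparr>carrier := U\<rparr>" by (rule subgroup.subgroup_is_group[OF U is_group])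
  note sub = subgroup.subset[OF U] 
  show ?thesis
  proof unfold_locales
    show "topspace (subtopology T U) = carrier (G\<lparr>carrier := U\<rparr>)"
      using sub by (auto simp: topspace_eq)
    fix a b assume ab: "a \<in> carrier (G\<lparr>carrier := U\<rparr>)" "b \<in> carrier (G\<lparr>carrier := U\<rparr>)"
    have "continuous_map T T (\<lambda>g. a \<otimes> g \<otimes> b)"
      using ab sub by (intro translation) auto
    then show "continuous_map (subtopology T U) (subtopology T U)
                (\<lambda>g. a \<otimes>\<^bsub>G\<lparr>carrier := U\<rparr>\<^esub> g \<otimes>\<^bsub>G\<lparr>carrier := U\<rparr>\<^esub> b)"
      using ab subgroup.m_closed[OF U]
      by (auto simp: continuous_map_in_subtopology intro: continuous_map_from_subtopology)
  qed (auto simp: act_one act_mult[OF subsetD[OF sub] subsetD[OF sub]] act_add[OF subsetD[OF sub]] intro: continuous_map_from_subtopology act_continuous)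
qed

context
  fixes U r
  assumes U: "subgroup U G" and openU: "openin T U" and finU: "finite (lcosets U)"
    and rr: "\<forall>C\<in>lcosets U. r C \<in> C"
begin

lemma r: "C \<in> lcosets U \<Longrightarrow> r C \<in> C"
  using rr by blast

lemma r_carrier: "C \<in> lcosets U \<Longrightarrow> r C \<in> carrier G"
  using r lcosets_subset[OF U] by blast

definition "fac g C = inv (r (g <# C)) \<otimes> g \<otimes> r C"

lemma gr_mem: "g \<in> carrier G \<Longrightarrow> C \<in> lcosets U \<Longrightarrow> g \<otimes> r C \<in> g <# C"
  using r by (auto simp: l_coset_def)

lemma fac_mem: 
  assumes g: "g \<in> carrier G" and C: "C \<in> lcosets U" 
  shows "fac g C \<in> U"
proof -
  have "inv (r (g <# C)) \<otimes> (g \<otimes> r C) \<in> U"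
    using gr_mem[OF g C] lcoset_mem_iff[OF U lcosets_closed[OF U g C] r[OF lcosets_closed[OF U g C]], of "g \<otimes> r C"]
      g r_carrier[OF C] by simp
  then show ?thesis
    using g r_carrier[OF C] r_carrier[OF lcosets_closed[OF U g C]] by (simp add: fac_def m_assoc)
qed

lemma r_fac: 
  assumes g: "g \<in> carrier G" and C: "C \<in> lcosets U" 
  shows "r (g <# C) \<otimes> fac g C = g \<otimes> r C"
  using g r_carrier[OF C] r_carrier[OF lcosets_closed[OF U g C]]
  by (simp add: fac_def m_assoc flip: m_assoc[of "r (g <# C)"]) 

lemma fac_mult:
  assumes g: "g \<in> carrier G" and h: "h \<in> carrier G" and C: "C \<in> lcosets U" 
  shows "fac (g \<otimes> h) C = fac g (h <# C) \<otimes> fac h C"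
proof -
  have "r (h <# C) \<in> carrier G" "r (g <# (h <# C)) \<in> carrier G"
    using assms by (auto intro!: r_carrier lcosets_closed[OF U])
  with assms r_carrier[OF C] show ?thesis
    by (simp add: fac_def lcosets_mult[OF U] m_assoc flip: m_assoc[of "r (h <# C)"]) 
qed

lemma act_r_fac: "g \<in> carrier G \<Longrightarrow> C \<in> lcosets U \<Longrightarrow> 
   \<rho> (r (g <# C)) (\<rho> (fac g C) m) = \<rho> g (\<rho> (r C) m)"
  using r_fac[of g C] subgroup.subset[OF U] fac_mem[of g C]
  by (metis act_mult r_carrier lcosets_closed[OF U] subsetD)

lemma cor_eq: "g \<in> carrier G \<Longrightarrow> 
  cor_cochain G U \<rho> r c g = (\<Sum>C\<in>lcosets U. \<rho> (r (g <# C)) (c (fac g C)))"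
  by (simp add: cor_cochain_def fac_def)

lemma locally_same_cosets:
  assumes g: "g \<in> carrier G"
  shows "\<exists>V. openin T V \<and> g \<in> V \<and> (\<forall>h\<in>V. \<forall>C\<in>lcosets U. h <# C = g <# C)"
proof -
  define W where "W C = {h \<in> topspace T. inv (r (g <# C)) \<otimes> h \<otimes> r C \<in> U}" for C
  have op: "openin T (W C)" if "C \<in> lcosets U" for C
    unfolding W_def using that g
    by (intro openin_continuous_map_preimage[OF translation _] openU) 
       (auto intro!: r_carrier inv_closed lcosets_closed[OF U])
  have gW: "g \<in> W C" if "C \<in> lcosets U" for C
    using fac_mem[OF g that] g by (simp add: W_def topspace_eq fac_def)
  have eq: "h <# C = g <# C" if C: "C \<in> lcosets U" and h: "h \<in> W C" for h C
  proof -
    have hc: "h \<in> carrier G" using h by (simp add: W_def topspace_eq)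
    have gC: "g <# C \<in> lcosets U" "h <# C \<in> lcosets U" using lcosets_closed[OF U] g hc C by auto
    have "inv (r (g <# C)) \<otimes> (h \<otimes> r C) \<in> U"
      using h hc r_carrier[OF C] r_carrier[OF gC(1)] by (simp add: W_def m_assoc)
    then have "h \<otimes> r C \<in> g <# C"
      using lcoset_mem_iff[OF U gC(1) r[OF gC(1)], of "h \<otimes> r C"] hc r_carrier[OF C] by simp
    moreover have "h \<otimes> r C \<in> h <# C" using gr_mem hc C by blast
    ultimately show ?thesis
      using gC hc r_carrier[OF C] 
      by (meson is_group U lcosets_subset subset_antisym subset_iff lcoset_mem_iff)
  qed
  show ?thesis
  proof (intro exI[of _ "topspace T \<inter> (\<Inter>C\<in>lcosets U. W C)"] conjI ballI)
    show "openin T (topspace T \<inter> (\<Inter>C\<in>lcosets U. W C))"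
    proof (cases "lcosets U = {}")
      case False
      then have "openin T (\<Inter>C\<in>lcosets U. W C)"
        using finU op by (intro openin_Inter) auto
      then show ?thesis by blast
    qed simp
    show "g \<in> topspace T \<inter> (\<Inter>C\<in>lcosets U. W C)"
      using gW g by (auto simp: topspace_eq)
    fix h C assume "h \<in> topspace T \<inter> (\<Inter>C\<in>lcosets U. W C)" and C: "C \<in> lcosets U"
    then have "h \<in> W C" by blast
    with eq[OF C] show "h <# C = g <# C" by blast
  qed
qed

lemma cor_continuous:
  assumes c: "c \<in> carrier (Z1 (G\<lparr>carrier := U\<rparr>) (subtopology T U) \<rho>)"
  shows "continuous_map T (discrete_topology UNIV) (cor_cochain G U \<rho> r c)"
  unfolding continuous_map_discrete_iff
proof
  fix g assume "g \<in> topspace T"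
  then have g: "g \<in> carrier G" by (simp add: topspace_eq)
  obtain V where V: "openin T V" "g \<in> V" "\<And>h C. h \<in> V \<Longrightarrow> C \<in> lcosets U \<Longrightarrow> h <# C = g <# C"
    using locally_same_cosets[OF g] by blast
  have Vc: "V \<subseteq> carrier G" using openin_subset[OF V(1)] by (simp add: topspace_eq)
  have cc: "continuous_map (subtopology T U) (discrete_topology UNIV) c"
    using c by (simp add: Z1_def)
  have "\<exists>W. openin T W \<and> g \<in> W \<and> (\<forall>h\<in>W \<inter> V. c (fac h C) = c (fac g C))" if C: "C \<in> lcosets U" for C
  proof -
    have gC: "g <# C \<in> lcosets U" using lcosets_closed[OF U g C] .
    have "openin (subtopology T U) {u \<in> topspace (subtopology T U). c u \<in> {c (fac g C)}}"
      by (rule openin_continuous_map_preimage[OF cc]) auto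
    then have op: "openin T {u \<in> topspace (subtopology T U). c u \<in> {c (fac g C)}}"
      using openU openin_trans_full by blast
    have "openin T {h \<in> topspace T. inv (r (g <# C)) \<otimes> h \<otimes> r C \<in> {u \<in> topspace (subtopology T U). c u \<in> {c (fac g C)}}}"
      by (rule openin_continuous_map_preimage[OF translation op]) (auto intro: r_carrier gC C)
    then show ?thesis
    proof (intro exI conjI ballI)
      show "g \<in> {h \<in> topspace T. inv (r (g <# C)) \<otimes> h \<otimes> r C \<in> {u \<in> topspace (subtopology T U). c u \<in> {c (fac g C)}}}"
        using g fac_mem[OF g C] subgroup.subset[OF U] by (auto simp: topspace_eq fac_def)
      fix h assume h: "h \<in> {h \<in> topspace T. inv (r (g <# C)) \<otimes> h \<otimes> r C \<in> {u \<in> topspace (subtopology T U). c u \<in> {c (fac g C)}}} \<inter> V"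
      then have "h <# C = g <# C" using V(3)[OF _ C] by blast
      then have "fac h C = inv (r (g <# C)) \<otimes> h \<otimes> r C" unfolding fac_def by metis
      then show "c (fac h C) = c (fac g C)" using h by simp
    qed
  qed
  then obtain W where W: "\<And>C. C \<in> lcosets U \<Longrightarrow> openin T (W C) \<and> g \<in> W C \<and> (\<forall>h\<in>W C \<inter> V. c (fac h C) = c (fac g C))"
    by metis
  show "\<exists>V. openin T V \<and> g \<in> V \<and> (\<forall>h\<in>V. cor_cochain G U \<rho> r c h = cor_cochain G U \<rho> r c g)"
  proof (intro exI[of _ "V \<inter> (topspace T \<inter> (\<Inter>C\<in>lcosets U. W C))"] conjI ballI)
    have "openin T (topspace T \<inter> (\<Inter>C\<in>lcosets U. W C))"
    proof (cases "lcosets U = {}")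
      case False
      then have "openin T (\<Inter>C\<in>lcosets U. W C)"
        using finU W by (intro openin_Inter) auto
      then show ?thesis by blast
    qed simp
    then show "openin T (V \<inter> (topspace T \<inter> (\<Inter>C\<in>lcosets U. W C)))" using V(1) by blast
    fix h assume h: "h \<in> V \<inter> (topspace T \<inter> (\<Inter>C\<in>lcosets U. W C))"
    then have hc: "h \<in> carrier G" using Vc by blast
    show "cor_cochain G U \<rho> r c h = cor_cochain G U \<rho> r c g"
      unfolding cor_eq[OF hc] cor_eq[OF g]
    proof (rule sum.cong[OF refl])
      fix C assume C: "C \<in> lcosets U"
      have "h \<in> W C \<inter> V" using h C by blast
      then have "c (fac h C) = c (fac g C)" "h <# C = g <# C"
        using W[OF C] V(3)[of h, OF _ C] by blast+
      then show "\<rho> (r (h <# C)) (c (fac h C)) = \<rho> (r (g <# C)) (c (fac g C))" by metis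
    qed
  next
    show "g \<in> V \<inter> (topspace T \<inter> (\<Inter>C\<in>lcosets U. W C))"
      using g V(2) W by (auto simp: topspace_eq)
  qed
qed

lemma cor_Z1:
  assumes c: "c \<in> carrier (Z1 (G\<lparr>carrier := U\<rparr>) (subtopology T U) \<rho>)"
  shows "cor_cochain G U \<rho> r c \<in> carrier (Z1 G T \<rho>)"
  unfolding Z1_iff
proof (intro conjI ballI cor_continuous[OF c])
  show "cor_cochain G U \<rho> r c \<in> extensional (carrier G)" by (simp add: cor_cochain_def)
  fix g h assume g: "g \<in> carrier G" and h: "h \<in> carrier G"
  have cmul: "c (u \<otimes> v) = c u + \<rho> u (c v)" if "u \<in> U" "v \<in> U" for u v
    using c that by (simp add: Z1_def)
  have "cor_cochain G U \<rho> r c (g \<otimes> h) = (\<Sum>C\<in>lcosets U. \<rho> (r (g <# (h <# C))) (c (fac g (h <# C)))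
           + \<rho> g (\<rho> (r (h <# C)) (c (fac h C))))"
    unfolding cor_eq[OF m_closed[OF g h]]
  proof (rule sum.cong[OF refl])
    fix C assume C: "C \<in> lcosets U"
    have hC: "h <# C \<in> lcosets U" using lcosets_closed[OF U h C] .
    show "\<rho> (r ((g \<otimes> h) <# C)) (c (fac (g \<otimes> h) C)) =
       \<rho> (r (g <# (h <# C))) (c (fac g (h <# C))) + \<rho> g (\<rho> (r (h <# C)) (c (fac h C)))"
      using act_r_fac[OF g hC] r_carrier[OF lcosets_closed[OF U g hC]]
      by (simp add: lcosets_mult[OF U g h C] fac_mult[OF g h C] cmul fac_mem[OF g hC] fac_mem[OF h C] act_add)
  qed
  also have "\<dots> = (\<Sum>C\<in>lcosets U. \<rho> (r (g <# (h <# C))) (c (fac g (h <# C))))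
           + \<rho> g (\<Sum>C\<in>lcosets U. \<rho> (r (h <# C)) (c (fac h C)))"
    by (simp add: sum.distrib act_sum g)
  also have "(\<Sum>C\<in>lcosets U. \<rho> (r (g <# (h <# C))) (c (fac g (h <# C)))) = (\<Sum>C\<in>lcosets U. \<rho> (r (g <# C)) (c (fac g C)))"
    by (rule sum.reindex_bij_betw[OF lcosets_bij[OF U h]])
  finally show "cor_cochain G U \<rho> r c (g \<otimes> h) = cor_cochain G U \<rho> r c g + \<rho> g (cor_cochain G U \<rho> r c h)"
    by (simp add: cor_eq g h)
qed

end

lemma cor_class_cong:
  assumes U: "subgroup U G" and openU: "openin T U" and finU: "finite (lcosets U)"
    and r: "\<forall>C\<in>lcosets U. r C \<in> C" and s: "\<forall>C\<in>lcosets U. s C \<in> C"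
    and c: "c \<in> carrier (Z1 (G\<lparr>carrier := U\<rparr>) (subtopology T U) \<rho>)"
    and d: "d \<in> H1_class (G\<lparr>carrier := U\<rparr>) (subtopology T U) \<rho> c"
  shows "H1_class G T \<rho> (cor_cochain G U \<rho> s d) = H1_class G T \<rho> (cor_cochain G U \<rho> r c)"
proof -
  interpret H: discrete_module "G\<lparr>carrier := U\<rparr>" "subtopology T U" \<rho> by (rule submodule[OF U])
  obtain m where dZ: "d \<in> carrier (Z1 (G\<lparr>carrier := U\<rparr>) (subtopology T U) \<rho>)"
    and m: "\<And>u. u \<in> U \<Longrightarrow> d u = c u + (\<rho> u m - m)"
    using H.mem_H1_class[OF c d] by auto
  have cmul: "c (u \<otimes> v) = c u + \<rho> u (c v)" if "u \<in> U" "v \<in> U" for u v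
    using c that by (simp add: Z1_def)
  note Uc = subgroup.subset[OF U, THEN subsetD] 
  note rc = r_carrier[OF U openU finU r]
  note sc = r_carrier[OF U openU finU s]
  note fr = fac_mem[OF U openU finU r]
  note fs = fac_mem[OF U openU finU s]
  define w where "w C = inv (r C) \<otimes> s C" for C
  have wU: "w C \<in> U" if "C \<in> lcosets U" for C
    using lcoset_mem_iff[OF U that bspec[OF r that] sc[OF that]] bspec[OF s that] by (simp add: w_def)
  have rw: "r C \<otimes> w C = s C" if "C \<in> lcosets U" for C
    using rc[OF that] sc[OF that] by (simp add: w_def flip: m_assoc)
  define N where "N C = \<rho> (r C) (c (w C)) + \<rho> (s C) m" for C
  define M where "M = (\<Sum>C\<in>lcosets U. N C)"
  have summand: "\<rho> (s (g <# C)) (d (fac s g C)) = 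
     \<rho> (r (g <# C)) (c (fac r g C)) + (\<rho> g (N C) - N (g <# C))"
    if g: "g \<in> carrier G" and C: "C \<in> lcosets U" for g C
  proof -
    have gC: "g <# C \<in> lcosets U" using lcosets_closed[OF U g C] .
    let ?u = "fac r g C" and ?v = "fac s g C" and ?D = "g <# C"
    have u: "?u \<in> U" and v: "?v \<in> U" using fr fs g C by auto
    have wC: "w C \<in> U" "w ?D \<in> U" using wU C gC by auto
    note Ucs = Uc[OF u] Uc[OF v] Uc[OF wC(1)] Uc[OF wC(2)] rc[OF C] rc[OF gC] sc[OF C] sc[OF gC]
    have "r ?D \<otimes> (w ?D \<otimes> ?v) = g \<otimes> s C"
      using r_fac[OF U openU finU s g C] rw[OF gC] Ucs by (metis m_assoc)
    also have "\<dots> = g \<otimes> r C \<otimes> w C"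
      using rw[OF C] Ucs g by (metis m_assoc)
    also have "\<dots> = r ?D \<otimes> (?u \<otimes> w C)"
      using r_fac[OF U openU finU r g C] Ucs g by (metis m_assoc)
    finally have "w ?D \<otimes> ?v = ?u \<otimes> w C"
      using Ucs by (metis Units_l_cancel Units_eq m_closed)
    then have "c (w ?D) + \<rho> (w ?D) (c ?v) = c ?u + \<rho> ?u (c (w C))"
      using cmul wC u v by metis
    then have "\<rho> (r ?D) (\<rho> (w ?D) (c ?v)) = \<rho> (r ?D) (c ?u) + \<rho> (r ?D) (\<rho> ?u (c (w C))) - \<rho> (r ?D) (c (w ?D))"
      using Ucs act_add act_diff by (metis add_diff_cancel_left')
    then have 1: "\<rho> (s ?D) (c ?v) = \<rho> (r ?D) (c ?u) + \<rho> g (\<rho> (r C) (c (w C))) - \<rho> (r ?D) (c (w ?D))"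
      using act_r_fac[OF U openU finU r g C] rw[OF gC] Ucs act_mult by metis
    have "\<rho> (s ?D) (d ?v) = \<rho> (s ?D) (c ?v) + (\<rho> (s ?D) (\<rho> ?v m) - \<rho> (s ?D) m)"
      using Ucs by (simp add: m[OF v] act_add act_diff)
    also have "\<rho> (s ?D) (\<rho> ?v m) = \<rho> g (\<rho> (s C) m)"
      by (rule act_r_fac[OF U openU finU s g C])
    finally show ?thesis using 1 g by (simp add: N_def act_add)
  qed
  have "\<forall>g\<in>carrier G. cor_cochain G U \<rho> s d g = cor_cochain G U \<rho> r c g + (\<rho> g M - M)"
  proof
    fix g assume g: "g \<in> carrier G"
    have "(\<Sum>C\<in>lcosets U. N (g <# C)) = M"
      unfolding M_def by (rule sum.reindex_bij_betw[OF lcosets_bij[OF U g]])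
    then show "cor_cochain G U \<rho> s d g = cor_cochain G U \<rho> r c g + (\<rho> g M - M)"
      using g by (simp add: cor_eq[OF U openU finU r] cor_eq[OF U openU finU s] summand sum.distrib sum_subtractf)
        (simp add: M_def act_sum)
  qed
  then show ?thesis
    using H1_class_eq_iff[OF cor_Z1[OF U openU finU s dZ] cor_Z1[OF U openU finU r c]] by blast
qed

lemma corestriction_H1_class:
  assumes U: "subgroup U G" and openU: "openin T U" and finU: "finite (lcosets U)"
    and r: "\<forall>C\<in>lcosets U. r C \<in> C"
    and c: "c \<in> carrier (Z1 (G\<lparr>carrier := U\<rparr>) (subtopology T U) \<rho>)"
  shows "corestriction G T U \<rho> (H1_class (G\<lparr>carrier := U\<rparr>) (subtopology T U) \<rho> c) =
           H1_class G T \<rho> (cor_cochain G U \<rho> r c)"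
proof -
  interpret H: discrete_module "G\<lparr>carrier := U\<rparr>" "subtopology T U" \<rho> by (rule submodule[OF U])
  have s: "\<forall>C\<in>lcosets U. (SOME t. t \<in> C) \<in> C"
    using r by (metis someI)
  show ?thesis
    unfolding corestriction_def
    by (rule the_elem_image_unique)
      (use H.self_mem_H1_class[OF c] cor_class_cong[OF U openU finU r s c] in auto)
qed

end

lemma H1_map_H1_class:
  assumes M: "discrete_module G T \<rho>M" and N: "discrete_module G T \<rho>N"
    and add: "\<And>m n. f (m + n) = f m + f n"
    and equiv: "\<And>g m. g \<in> carrier G \<Longrightarrow> f (\<rho>M g m) = \<rho>N g (f m)"
    and c: "c \<in> carrier (Z1 G T \<rho>M)"
  shows "(\<lambda>g\<in>carrier G. f (c g)) \<in> carrier (Z1 G T \<rho>N)"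
    and "H1_map G T \<rho>N f (H1_class G T \<rho>M c) = H1_class G T \<rho>N (\<lambda>g\<in>carrier G. f (c g))"
proof -
  interpret M: discrete_module G T \<rho>M by (rule M)
  interpret N: discrete_module G T \<rho>N by (rule N)
  have Z: "(\<lambda>g\<in>carrier G. f (d g)) \<in> carrier (Z1 G T \<rho>N)" if d: "d \<in> carrier (Z1 G T \<rho>M)" for d
    using d continuous_map_discrete_combine[of T d d "\<lambda>g\<in>carrier G. f (d g)" "\<lambda>a _. f a"]
    by (auto simp: Z1_def M.topspace_eq add equiv)
  show "(\<lambda>g\<in>carrier G. f (c g)) \<in> carrier (Z1 G T \<rho>N)" by (rule Z[OF c])
  have diff: "f (m - n) = f m - f n" for m n
    using add[of "m - n" n] by (simp add: algebra_simps)
  have "H1_class G T \<rho>N (\<lambda>g\<in>carrier G. f (d g)) = H1_class G T \<rho>N (\<lambda>g\<in>carrier G. f (c g))"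
    if dc: "d \<in> H1_class G T \<rho>M c" for d
  proof -
    obtain m where d: "d \<in> carrier (Z1 G T \<rho>M)" and m: "\<forall>g\<in>carrier G. d g = c g + (\<rho>M g m - m)"
      using M.mem_H1_class[OF c dc] by blast
    have "\<forall>g\<in>carrier G. (\<lambda>g\<in>carrier G. f (d g)) g =
        (\<lambda>g\<in>carrier G. f (c g)) g + (\<rho>N g (f m) - f m)"
      using m by (simp add: add diff equiv)
    then show ?thesis using N.H1_class_eq_iff[OF Z[OF d] Z[OF c]] by blast
  qed
  then show "H1_map G T \<rho>N f (H1_class G T \<rho>M c) = H1_class G T \<rho>N (\<lambda>g\<in>carrier G. f (c g))"
    unfolding H1_map_def
    using M.self_mem_H1_class[OF c] by (intro the_elem_image_unique) blast+
qed

lemma krull_translation: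
  assumes "a \<in> carrier (Gal \<iota>)" "b \<in> carrier (Gal \<iota>)"
  shows "continuous_map (krull_topology \<iota>) (krull_topology \<iota>) (\<lambda>g. a \<otimes>\<^bsub>Gal \<iota>\<^esub> g \<otimes>\<^bsub>Gal \<iota>\<^esub> b)"
  unfolding continuous_map_def
proof (intro conjI allI impI)
  interpret group "Gal \<iota>" by (rule group_Gal)
  show "(\<lambda>g. a \<otimes>\<^bsub>Gal \<iota>\<^esub> g \<otimes>\<^bsub>Gal \<iota>\<^esub> b) \<in> topspace (krull_topology \<iota>) \<rightarrow> topspace (krull_topology \<iota>)"
    using assms by auto
  fix U assume U: "openin (krull_topology \<iota>) U"
  let ?f = "\<lambda>g. a \<otimes>\<^bsub>Gal \<iota>\<^esub> g \<otimes>\<^bsub>Gal \<iota>\<^esub> b"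
  have mult: "?f g = a \<circ> g \<circ> b" for g by (simp add: Gal_def)
  show "openin (krull_topology \<iota>) {g \<in> topspace (krull_topology \<iota>). ?f g \<in> U}"
    unfolding openin_krull_topology
  proof (intro conjI ballI)
    fix \<sigma> assume \<sigma>: "\<sigma> \<in> {g \<in> topspace (krull_topology \<iota>). ?f g \<in> U}"
    then obtain S where S: "finite S" "{\<tau> \<in> carrier (Gal \<iota>). \<forall>x\<in>S. \<tau> x = ?f \<sigma> x} \<subseteq> U"
      using U unfolding openin_krull_topology by blast
    have "{\<tau> \<in> carrier (Gal \<iota>). \<forall>x\<in>b ` S. \<tau> x = \<sigma> x} \<subseteq> {g \<in> topspace (krull_topology \<iota>). ?f g \<in> U}"
    proof
      fix \<tau> assume \<tau>: "\<tau> \<in> {\<tau> \<in> carrier (Gal \<iota>). \<forall>x\<in>b ` S. \<tau> x = \<sigma> x}"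
      then have "\<forall>x\<in>S. ?f \<tau> x = ?f \<sigma> x" by (simp add: mult)
      moreover have "?f \<tau> \<in> carrier (Gal \<iota>)" using \<tau> assms by auto
      ultimately show "\<tau> \<in> {g \<in> topspace (krull_topology \<iota>). ?f g \<in> U}"
        using S(2) \<tau> by auto
    qed
    then show "\<exists>S. finite S \<and> {\<tau> \<in> carrier (Gal \<iota>). \<forall>x\<in>S. \<tau> x = \<sigma> x} \<subseteq> {g \<in> topspace (krull_topology \<iota>). ?f g \<in> U}"
      using S(1) by blast
  qed auto
qed

lemma trivial_discrete_module:
  "discrete_module (Gal \<iota>) (krull_topology \<iota>) (\<lambda>\<sigma> a. a)"
proof -
  interpret group "Gal \<iota>" by (rule group_Gal)
  show ?thesis by unfold_locales (auto intro: krull_translation)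
qed

lemma galois_representation_discrete_module:
  assumes "galois_representation \<iota> scale \<rho>"
  shows "discrete_module (Gal \<iota>) (krull_topology \<iota>) \<rho>"
proof -
  interpret group "Gal \<iota>" by (rule group_Gal)
  interpret A: group_action "Gal \<iota>" UNIV \<rho> using assms by (simp add: galois_representation_def)
  have cont: "continuous_map (krull_topology \<iota>) (discrete_topology UNIV) \<rho>"
    and lin: "\<And>\<sigma>. \<sigma> \<in> carrier (Gal \<iota>) \<Longrightarrow> Vector_Spaces.linear scale scale (\<rho> \<sigma>)"
    using assms by (auto simp: galois_representation_def)
  show ?thesis
  proof unfold_locales
    fix m
    show "\<rho> \<one>\<^bsub>Gal \<iota>\<^esub> m = m" using fun_cong[OF A.id_eq_one, of m] by simp
    show "continuous_map (krull_topology \<iota>) (discrete_topology UNIV) (\<lambda>g. \<rho> g m)"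
      by (rule continuous_map_discrete_combine[OF cont cont]) simp
    fix n g assume "g \<in> carrier (Gal \<iota>)"
    then interpret L: Vector_Spaces.linear scale scale "\<rho> g" by (rule lin)
    show "\<rho> g (m + n) = \<rho> g m + \<rho> g n" by (rule L.add)
  qed (auto intro: krull_translation A.composition_rule)
qed

lemma galois_representation_finite_UNIV:
  assumes "galois_representation \<iota> (scale :: 'p::prime_card mod_ring \<Rightarrow> 'v::ab_group_add \<Rightarrow> 'v) \<rho>"
  shows "finite (UNIV :: 'v set)"
proof -
  obtain B where "finite_dimensional_vector_space scale B"
    using assms by (auto simp: galois_representation_def)
  then interpret V: finite_dimensional_vector_space scale B .
  have "UNIV \<subseteq> (\<lambda>f. \<Sum>b\<in>B. scale (f b) b) ` (\<Pi>\<^sub>E b\<in>B. UNIV)"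
  proof
    fix v :: 'v
    have "v \<in> V.span B" using V.span_Basis by simp
    then obtain f where f: "v = (\<Sum>b\<in>B. scale (f b) b)"
      using V.span_finite[OF V.finite_Basis] by auto
    have "v = (\<Sum>b\<in>B. scale (restrict f B b) b)"
      unfolding f by (rule sum.cong) auto
    then show "v \<in> (\<lambda>f. \<Sum>b\<in>B. scale (f b) b) ` (\<Pi>\<^sub>E b\<in>B. UNIV)"
      by (rule image_eqI[where x = "restrict f B"]) simp
  qed
  moreover have "finite (\<Pi>\<^sub>E b\<in>B. (UNIV :: 'p mod_ring set))"
    using V.finite_Basis by (intro finite_PiE) auto
  ultimately show ?thesis using finite_surj by blast
qed

lemma stabilizer_subgroup:
  assumes "galois_representation \<iota> scale \<rho>"
  shows "subgroup (stabilizer (Gal \<iota>) \<rho> v) (Gal \<iota>)"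
proof -
  interpret group_action "Gal \<iota>" UNIV \<rho> using assms by (simp add: galois_representation_def)
  show ?thesis by (rule stabilizer_subgroup) simp
qed

lemma stabilizer_open:
  assumes "galois_representation \<iota> scale \<rho>"
  shows "openin (krull_topology \<iota>) (stabilizer (Gal \<iota>) \<rho> v)"
proof -
  interpret discrete_module "Gal \<iota>" "krull_topology \<iota>" \<rho>
    by (rule galois_representation_discrete_module[OF assms])
  show ?thesis
    using openin_continuous_map_preimage[OF act_continuous[of v], of "{v}"]
    by (simp add: stabilizer_def)
qed

lemma stabilizer_finite_index:
  assumes "galois_representation \<iota> scale \<rho>"
  shows "finite (lcosets\<^bsub>Gal \<iota>\<^esub> stabilizer (Gal \<iota>) \<rho> v)"
proof -
  interpret discrete_module "Gal \<iota>" "krull_topology \<iota>" \<rho>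
    by (rule galois_representation_discrete_module[OF assms])
  let ?U = "stabilizer (Gal \<iota>) \<rho> v"
  note U = stabilizer_subgroup[OF assms, of v]
  have "g <#\<^bsub>Gal \<iota>\<^esub> ?U = {h \<in> carrier (Gal \<iota>). \<rho> h v = \<rho> g v}" if g: "g \<in> carrier (Gal \<iota>)" for g
  proof
    show "g <#\<^bsub>Gal \<iota>\<^esub> ?U \<subseteq> {h \<in> carrier (Gal \<iota>). \<rho> h v = \<rho> g v}"
      using g by (auto simp: l_coset_def stabilizer_def act_mult)
    show "{h \<in> carrier (Gal \<iota>). \<rho> h v = \<rho> g v} \<subseteq> g <#\<^bsub>Gal \<iota>\<^esub> ?U"
    proof
      fix h assume h: "h \<in> {h \<in> carrier (Gal \<iota>). \<rho> h v = \<rho> g v}"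
      have "\<rho> (inv\<^bsub>Gal \<iota>\<^esub> g \<otimes>\<^bsub>Gal \<iota>\<^esub> h) v = \<rho> (inv\<^bsub>Gal \<iota>\<^esub> g \<otimes>\<^bsub>Gal \<iota>\<^esub> g) v"
        using g h by (metis (mono_tags, lifting) act_mult inv_closed mem_Collect_eq)
      also have "\<dots> = v" using g by (simp add: act_one)
      finally have "inv\<^bsub>Gal \<iota>\<^esub> g \<otimes>\<^bsub>Gal \<iota>\<^esub> h \<in> ?U"
        using g h by (simp add: stabilizer_def)
      then show "h \<in> g <#\<^bsub>Gal \<iota>\<^esub> ?U"
        using subgroup.lcos_module_rev[OF U is_group g] h by simp
    qed
  qed
  then have "lcosets\<^bsub>Gal \<iota>\<^esub> ?U \<subseteq> (\<lambda>w. {h \<in> carrier (Gal \<iota>). \<rho> h v = w}) ` UNIV"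
    by (auto simp: LCOSETS_def)
  then show ?thesis
    using galois_representation_finite_UNIV[OF assms] by (meson finite_imageI finite_subset)
qed


end

theory Submission
  imports Defs "HOL-Library.Function_Algebras"
begin

text \<open>
  By Shapiro's lemma, the image consists of the classes that lift to the permutation module
  \<open>F\<^sub>p[V]\<close>. Corestriction from an open subgroup of index prime to \<open>p\<close> is surjective and compatible with
  such lifts, so that \<open>G\<close> may be replaced by a subgroup fixing the \<open>p\<close>-th roots of unity and acting on \<open>V\<close>
  by unipotent matrices with entry \<open>\<chi>\<close>. A class of \<open>H\<^sup>1(G, V)\<close> then maps to a character \<open>\<beta>\<close>
  with \<open>\<chi> \<union> \<beta> = 0\<close>. If \<open>\<chi> \<noteq> 0\<close> and \<open>\<beta>\<close> is the Kummer character of \<open>b\<close>, then \<open>b\<close> is a norm from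
  the field fixed by the kernel \<open>N\<close> of \<open>\<chi>\<close>, hence \<open>\<beta>\<close> is the corestriction of a character \<open>\<phi>\<close> of \<open>N\<close>. As
  \<open>N\<close> fixes the second basis vector \<open>e\<close>, the corestriction of \<open>\<phi> e\<close> differs from the
  given class by one with values in the line fixed by \<open>G\<close>.
\<close>

text \<open>No second cohomology group occurs. In a basis making the action unipotent, the first
  coordinate of a cocycle is itself a cochain \<open>x\<close> whose coboundary is \<chi> \<union>
  \<beta> up to sign, and the norm equation for the Kummer element of \<beta> is solved explicitly
  with a Kummer generator for \<open>x\<close> on \<open>N\<close>. The arithmetic input is thus
  Hilbert 90, used twice; the assumption on the characteristic supplies the roots of unity and p-th
  roots on which it operates. Dimension two enters because a unipotent action then has a single
  entry \<chi>, which is a character. A Sylow pro-p subgroup is in general not open, so a transfer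
  from it is no finite sum; counting points of a finite G-set gives an open subgroup of index prime
  to p instead. Classes with values in a fixed line always lift, since a fixed vector v gives a
  fixed basis element [v] of the permutation module. Hence only \<beta> has to be lifted, and if
  \<chi> = 0 this is immediate, because e itself is then fixed.\<close>

section \<open>Kummer theory in a separable closure\<close>

text \<open>Artin's elimination argument. Multiplicativity and distinctness refer to
  \<open>K\<close>, because the functions will be restrictions of automorphisms to a subfield,
  undefined elsewhere.\<close>

lemma dedekind_independence:
  fixes Q :: "('a::monoid_mult \<Rightarrow> 'b::field) set"
  assumes "finite Q"
    and mult_closed: "\<And>a b. a \<in> K \<Longrightarrow> b \<in> K \<Longrightarrow> a * b \<in> K"
    and "\<And>f a b. f \<in> Q \<Longrightarrow> a \<in> K \<Longrightarrow> b \<in> K \<Longrightarrow> f (a * b) = f a * f b"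
    and "\<And>f. f \<in> Q \<Longrightarrow> \<exists>a\<in>K. f a \<noteq> 0"
    and "\<And>f h. f \<in> Q \<Longrightarrow> h \<in> Q \<Longrightarrow> f \<noteq> h \<Longrightarrow> \<exists>a\<in>K. f a \<noteq> h a"
    and "\<And>a. a \<in> K \<Longrightarrow> (\<Sum>f\<in>Q. c f * f a) = 0"
    and "f \<in> Q"
  shows "c f = 0"
  using assms(1,3-)
proof (induction Q arbitrary: c f rule: finite_induct)
  case (insert h Q)
  have zero: "c f = 0" if f: "f \<in> Q" for f
  proof -
    obtain b where b: "b \<in> K" "f b \<noteq> h b"
      using insert.prems(3)[of f h] insert.hyps(2) f by blast
    \<comment> \<open>Subtracting \<open>h b\<close> times the relation at \<open>a\<close> from the
      relation at \<open>b * a\<close> eliminates \<open>h\<close> and leaves a relation on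
      \<open>Q\<close> with these coefficients.\<close>
    have "c f * (f b - h b) = 0"
    proof (rule insert.IH[where c = "\<lambda>f. c f * (f b - h b)"])
      fix a assume a: "a \<in> K"
      have hom: "(\<Sum>f\<in>insert h Q. c f * f (b * a)) = (\<Sum>f\<in>insert h Q. c f * (f b * f a))"
        using insert.prems(1) a b(1) by (intro sum.cong) auto
      have "(\<Sum>f\<in>Q. c f * (f b - h b) * f a) = (\<Sum>f\<in>insert h Q. c f * (f b - h b) * f a)"
        using insert.hyps by simp
      also have "\<dots> = (\<Sum>f\<in>insert h Q. c f * f (b * a)) - h b * (\<Sum>f\<in>insert h Q. c f * f a)"
        unfolding hom sum_distrib_left sum_subtractf[symmetric] by (simp add: algebra_simps)
      finally have "(\<Sum>f\<in>Q. c f * (f b - h b) * f a) =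
          (\<Sum>f\<in>insert h Q. c f * f (b * a)) - h b * (\<Sum>f\<in>insert h Q. c f * f a)" .
      then show "(\<Sum>f\<in>Q. c f * (f b - h b) * f a) = 0"
        using insert.prems(4) a b(1) mult_closed by simp
    qed (use insert.prems f in auto)
    with b(2) show ?thesis by simp
  qed
  moreover have "c h = 0"
  proof -
    obtain a where a: "a \<in> K" "h a \<noteq> 0" using insert.prems(2) by blast
    have "(\<Sum>f\<in>Q. c f * f a) = 0" by (simp add: zero)
    then show ?thesis using insert.prems(4)[OF a(1)] insert.hyps a(2) by simp
  qed
  ultimately show ?case using insert.prems(5) by blast
qed simp

text \<open>For \<open>\<zeta>\<close> of order p this is the isomorphism from F_p onto the p-th
  roots of unity, which turns Kummer cocycles into characters with values in F_p. The exponent is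
  the representative between 0 and p - 1.\<close>

definition root_pow :: "'a::monoid_mult \<Rightarrow> 'p::prime_card mod_ring \<Rightarrow> 'a" where
  "root_pow \<zeta> a = \<zeta> ^ nat (to_int_mod_ring a)"

lemma power_mod_eq:
  fixes \<zeta> :: "'a::monoid_mult"
  assumes "\<zeta> ^ m = 1"
  shows "\<zeta> ^ (n mod m) = \<zeta> ^ n"
proof -
  have "\<zeta> ^ n = \<zeta> ^ (m * (n div m) + n mod m)" by simp
  also have "\<dots> = \<zeta> ^ (n mod m)" unfolding power_add power_mult assms by simp
  finally show ?thesis ..
qed

lemma root_pow_of_nat:
  assumes "\<zeta> ^ CARD('p::prime_card) = 1"
  shows "root_pow \<zeta> (of_nat n :: 'p mod_ring) = \<zeta> ^ n"
proof -
  have "to_int_mod_ring (of_nat n :: 'p mod_ring) = int (n mod CARD('p))"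
    by (simp add: of_nat_of_int_mod_ring of_int_mod_ring.rep_eq to_int_mod_ring.rep_eq zmod_int)
  then show ?thesis by (simp add: root_pow_def power_mod_eq[OF assms])
qed

lemma root_pow_0 [simp]: "root_pow \<zeta> 0 = 1"
  by (simp add: root_pow_def to_int_mod_ring.rep_eq zero_mod_ring.rep_eq)

lemma root_pow_add:
  fixes a b :: "'p::prime_card mod_ring"
  assumes "\<zeta> ^ CARD('p) = 1"
  shows "root_pow \<zeta> (a + b) = root_pow \<zeta> a * root_pow \<zeta> b"
proof -
  obtain m n where "a = of_nat m" "b = of_nat n" using surj_of_nat_mod_ring by metis
  then show ?thesis
    using root_pow_of_nat[OF assms, of m] root_pow_of_nat[OF assms, of n] root_pow_of_nat[OF assms, of "m + n"]
    by (simp add: power_add)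
qed

lemma root_pow_card:
  fixes a :: "'p::prime_card mod_ring"
  assumes "\<zeta> ^ CARD('p) = 1"
  shows "root_pow \<zeta> a ^ CARD('p) = 1"
  by (metis assms mult.commute power_mult power_one root_pow_def)

lemma root_pow_eq_1_iff:
  fixes a :: "'p::prime_card mod_ring" and \<zeta> :: "'a::monoid_mult"
  assumes \<zeta>: "\<zeta> ^ CARD('p) = 1" "\<zeta> \<noteq> 1"
  shows "root_pow \<zeta> a = 1 \<longleftrightarrow> a = 0"
proof
  assume 1: "root_pow \<zeta> a = 1"
  obtain n where n: "a = of_nat n" using surj_of_nat_mod_ring by metis
  show "a = 0"
  proof (rule ccontr)
    assume "a \<noteq> 0"
    \<comment> \<open>The power \<open>root_pow \<zeta> a ^ m\<close> recovers
      \<open>\<zeta>\<close>, which would therefore be 1.\<close>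
    then obtain m where m: "inverse a = of_nat m" using surj_of_nat_mod_ring by metis
    have "of_nat (n * m) = (of_nat 1 :: 'p mod_ring)"
      using \<open>a \<noteq> 0\<close> unfolding of_nat_mult n[symmetric] m[symmetric] by simp
    then have "\<zeta> = root_pow \<zeta> (of_nat (n * m) :: 'p mod_ring)"
      using root_pow_of_nat[OF \<zeta>(1), of 1] by simp
    also have "\<dots> = root_pow \<zeta> a ^ m"
      by (simp only: root_pow_of_nat[OF \<zeta>(1)] n power_mult)
    finally show False using 1 \<zeta>(2) by simp
  qed
qed simp

lemma root_pow_nonzero:
  fixes a :: "'p::prime_card mod_ring" and \<zeta> :: "'a::field"
  assumes "\<zeta> ^ CARD('p) = 1"
  shows "root_pow \<zeta> a \<noteq> 0"
  using root_pow_card[OF assms, of a] by (metis power_0_left zero_neq_one zero_less_card_finite not_gr0)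

lemma root_pow_inj:
  fixes a b :: "'p::prime_card mod_ring" and \<zeta> :: "'a::field"
  assumes \<zeta>: "\<zeta> ^ CARD('p) = 1" "\<zeta> \<noteq> 1"
  shows "root_pow \<zeta> a = root_pow \<zeta> b \<longleftrightarrow> a = b"
proof
  assume "root_pow \<zeta> a = root_pow \<zeta> b"
  moreover have "root_pow \<zeta> a = root_pow \<zeta> b * root_pow \<zeta> (a - b)"
    using root_pow_add[OF \<zeta>(1), of b "a - b"] by simp
  ultimately have "root_pow \<zeta> (a - b) = 1" using root_pow_nonzero[OF \<zeta>(1), of b] by simp
  then show "a = b" using root_pow_eq_1_iff[OF \<zeta>] by simp
qed simp

lemma root_pow_sum:
  fixes f :: "'i \<Rightarrow> 'p::prime_card mod_ring" and \<zeta> :: "'a::comm_monoid_mult"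
  assumes "\<zeta> ^ CARD('p) = 1"
  shows "root_pow \<zeta> (\<Sum>i\<in>A. f i) = (\<Prod>i\<in>A. root_pow \<zeta> (f i))"
  by (induction A rule: infinite_finite_induct) (auto simp: root_pow_add[OF assms])

lemma finite_roots_of_unity:
  assumes "n > 0" shows "finite {x :: 'a::field. x ^ n = 1}" "card {x :: 'a::field. x ^ n = 1} \<le> n"
proof -
  let ?P = "monom 1 n - 1 :: 'a poly"
  have deg: "degree ?P = n"
    using assms by (subst diff_conv_add_uminus, subst degree_add_eq_left) (auto simp: degree_monom_eq)
  have nz: "?P \<noteq> 0" using deg assms by force
  have eq: "{x. poly ?P x = 0} = {x. x ^ n = 1}" by (auto simp: poly_monom)
  show "finite {x :: 'a. x ^ n = 1}" "card {x :: 'a. x ^ n = 1} \<le> n"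
    using poly_roots_finite[OF nz] card_poly_roots_bound[OF nz] unfolding eq deg by simp_all
qed

text \<open>The powers of \<open>\<zeta>\<close> are p distinct roots of X^p - 1, which has at most
  p of them.\<close>

lemma root_of_unity_root_pow:
  fixes \<zeta> :: "'a::field"
  assumes \<zeta>: "\<zeta> ^ CARD('p::prime_card) = 1" "\<zeta> \<noteq> 1" and x: "x ^ CARD('p::prime_card) = 1"
  obtains a :: "'p::prime_card mod_ring" where "x = root_pow \<zeta> a"
proof -
  let ?R = "{x :: 'a. x ^ CARD('p) = 1}"
  have fin: "finite ?R" and le: "card ?R \<le> CARD('p)" by (rule finite_roots_of_unity, simp)+
  have "inj (root_pow \<zeta> :: 'p mod_ring \<Rightarrow> 'a)" using root_pow_inj[OF \<zeta>] by (auto intro: injI)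
  then have "card (range (root_pow \<zeta> :: 'p mod_ring \<Rightarrow> 'a)) = CARD('p)" by (simp add: card_image)
  moreover have sub: "range (root_pow \<zeta> :: 'p mod_ring \<Rightarrow> 'a) \<subseteq> ?R" using root_pow_card[OF \<zeta>(1)] by auto
  ultimately have "range (root_pow \<zeta> :: 'p mod_ring \<Rightarrow> 'a) = ?R"
    using fin le card_mono[OF fin sub] by (intro card_subset_eq[OF fin sub]) linarith
  with x show ?thesis using that by blast
qed

section \<open>Separable polynomials and roots in a separable closure\<close>

lemma field_of_nat_prime_nonzero:
  assumes "prime p" "CHAR('a::field) \<noteq> p" shows "(of_nat p :: 'a) \<noteq> 0"
proof
  assume "of_nat p = (0 :: 'a)"
  then have "CHAR('a) dvd p" by (simp add: of_nat_eq_0_iff_char_dvd)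
  moreover have "CHAR('a) \<noteq> 1" by simp
  ultimately show False using assms by (auto simp: prime_nat_iff)
qed

lemma separable_poly_dvd:
  assumes "separable_poly (f * g)" shows "separable_poly f"
  unfolding separable_poly_def
proof (rule coprimeI)
  fix d assume d: "d dvd f" "d dvd pderiv f"
  then have "d dvd pderiv (f * g)" "d dvd f * g" by (auto simp: pderiv_mult)
  then show "is_unit d" using assms coprime_common_divisor unfolding separable_poly_def by blast
qed

lemma separable_poly_binomial:
  assumes "(of_nat n :: 'a::field) \<noteq> 0" "y \<noteq> 0"
  shows "separable_poly (monom 1 n - [:y::'a:])"
  unfolding separable_poly_def
proof (rule coprimeI)
  have n: "n \<noteq> 0" using assms(1) by (cases n) auto
  fix d assume d: "d dvd (monom 1 n - [:y:] :: 'a poly)" "d dvd pderiv (monom 1 n - [:y:])"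
  \<comment> \<open>For f = X^n - y the combination (X/n) f' - f is the nonzero constant y.\<close>
  have "d dvd monom (inverse (of_nat n)) 1 * pderiv (monom 1 n - [:y:]) - (monom 1 n - [:y:])"
    by (rule dvd_diff[OF dvd_mult[OF d(2)] d(1)])
  also have "pderiv (monom 1 n - [:y:]) = monom (of_nat n) (n - 1)"
    by (simp add: pderiv_diff pderiv_monom pderiv_pCons)
  also have "monom (inverse (of_nat n)) 1 * monom (of_nat n) (n - 1) - (monom 1 n - [:y:]) = [:y:]"
    using assms(1) n by (simp add: mult_monom)
  finally show "is_unit d" using assms(2) by (meson dvd_trans is_unit_const_poly_iff dvd_field_iff)
qed

lemma degree_monom_minus_const:
  assumes "n > 0"
  shows "degree (monom 1 n - [:y::'a::field:]) = n"
  using assms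
  by (subst diff_conv_add_uminus, subst degree_add_eq_left) (auto simp: degree_monom_eq)

lemma separable_closure_nth_root:
  fixes \<iota> :: "'f::field \<Rightarrow> 'l::field"
  assumes "separable_closure \<iota>" "(of_nat n :: 'l) \<noteq> 0" "(y :: 'l) \<noteq> 0"
  obtains x where "x ^ n = y" "x \<noteq> 0"
proof -
  have n: "n > 0" using assms(2) by (cases n) auto
  have "\<forall>f :: 'l poly. degree f > 0 \<and> separable_poly f \<longrightarrow> (\<exists>x. poly f x = 0)"
    using assms(1) by (simp add: separable_closure_def)
  moreover have "degree (monom 1 n - [:y:]) > 0"
    using n degree_monom_minus_const[OF n, of y] by simp
  ultimately obtain x where "poly (monom 1 n - [:y:]) x = 0"
    using separable_poly_binomial[OF assms(2,3)] by blast
  then have "x ^ n = y" by (simp add: poly_monom)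
  with that assms(3) n show ?thesis by (metis power_0_left not_gr0)
qed

lemma separable_closure_root_of_unity:
  fixes \<iota> :: "'f::field \<Rightarrow> 'l::field"
  assumes "separable_closure \<iota>" "(of_nat p :: 'l) \<noteq> 0" "p > 1"
  obtains \<zeta> :: 'l where "\<zeta> ^ p = 1" "\<zeta> \<noteq> 1"
proof -
  \<comment> \<open>The quotient (X^p - 1)/(X - 1): it is separable as a divisor of X^p - 1, and its
    value p at 1 is nonzero, so none of its roots is 1.\<close>
  define \<Phi> :: "'l poly" where "\<Phi> = (\<Sum>i<p. monom 1 i)"
  have val: "poly \<Phi> x = (\<Sum>i<p. x ^ i)" for x by (simp add: \<Phi>_def poly_sum poly_monom)
  have eq: "\<Phi> * [:-1, 1:] = monom 1 p - [:1:]"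
  proof -
    have "\<Phi> = (\<Sum>i<p. monom 1 1 ^ i)" by (simp add: \<Phi>_def monom_power)
    moreover have "monom 1 p = (monom 1 1 ^ p :: 'l poly)" by (simp add: monom_power)
    moreover have "[:-1, 1:] = monom 1 1 - (1 :: 'l poly)" by (simp add: monom_altdef one_pCons)
    ultimately show ?thesis using power_diff_1_eq[of "monom 1 1 :: 'l poly" p]
      by (simp add: one_pCons mult.commute)
  qed
  have "separable_poly \<Phi>"
  proof (rule separable_poly_dvd)
    show "separable_poly (\<Phi> * [:-1, 1:])"
      unfolding eq by (rule separable_poly_binomial[OF assms(2)]) simp
  qed
  moreover have "degree \<Phi> > 0"
  proof -
    have "\<Phi> \<noteq> 0" using eq degree_monom_minus_const[of p "1::'l"] assms(3) by force
    then have "degree \<Phi> + 1 = p"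
      using eq degree_mult_eq[of \<Phi> "[:-1, 1:]"] degree_monom_minus_const[of p "1::'l"] assms(3) by simp
    then show ?thesis using assms(3) by simp
  qed
  ultimately obtain \<zeta> where \<zeta>: "poly \<Phi> \<zeta> = 0" using assms(1) unfolding separable_closure_def by blast
  have "poly (\<Phi> * [:-1, 1:]) \<zeta> = 0" using \<zeta> by simp
  then have "\<zeta> ^ p = 1" unfolding eq by (simp add: poly_monom)
  moreover have "\<zeta> \<noteq> 1" using \<zeta> assms(2) by (auto simp: val)
  ultimately show ?thesis using that by blast
qed

section \<open>Elements of the Galois group as field automorphisms\<close>

lemma Gal_mult [simp]: "g \<otimes>\<^bsub>Gal \<iota>\<^esub> h = g \<circ> h" and Gal_one [simp]: "\<one>\<^bsub>Gal \<iota>\<^esub> = id"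
  by (simp_all add: Gal_def)

lemma Gal_field_hom: "g \<in> carrier (Gal \<iota>) \<Longrightarrow> field_hom g"
  by (simp add: Gal_def)

lemma Gal_base: "g \<in> carrier (Gal \<iota>) \<Longrightarrow> g (\<iota> a) = \<iota> a"
  by (simp add: Gal_def)

lemma
  assumes "g \<in> carrier (Gal \<iota>)"
  shows Gal_elem_zero: "g 0 = 0" and Gal_elem_one: "g 1 = 1"
    and Gal_elem_times: "g (x * y) = g x * g y"
    and Gal_elem_power: "g (x ^ n) = g x ^ n"
    and Gal_elem_divide: "g (x / y) = g x / g y"
    and Gal_elem_sum: "g (sum u A) = (\<Sum>a\<in>A. g (u a))"
    and Gal_elem_prod: "g (prod u A) = (\<Prod>a\<in>A. g (u a))"
    and Gal_elem_eq_0_iff: "g x = 0 \<longleftrightarrow> x = 0"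
proof -
  interpret field_hom g by (rule Gal_field_hom[OF assms])
  show "g 0 = 0" "g 1 = 1" "g (x * y) = g x * g y" "g (x ^ n) = g x ^ n"
    "g (sum u A) = (\<Sum>a\<in>A. g (u a))" "g x = 0 \<longleftrightarrow> x = 0"
    by (simp_all add: hom_mult hom_power hom_sum)
  show "g (x / y) = g x / g y"
    using hom_mult[of "x / y" y] by (cases "y = 0") (simp_all add: nonzero_eq_divide_eq)
  show "g (prod u A) = (\<Prod>a\<in>A. g (u a))"
    by (induction A rule: infinite_finite_induct) (simp_all add: hom_mult)
qed

lemma Gal_root_pow:
  assumes "g \<in> carrier (Gal \<iota>)" "g \<zeta> = \<zeta>"
  shows "g (root_pow \<zeta> a) = root_pow \<zeta> a"
  by (simp add: root_pow_def Gal_elem_power[OF assms(1)] assms(2))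

text \<open>Conjugates of \<open>x\<close> are roots of one polynomial over the base field. This
  finiteness takes the place of passing to a finite Galois subextension.\<close>

lemma finite_conjugates:
  fixes \<iota> :: "'f::field \<Rightarrow> 'l::field"
  assumes "separable_closure \<iota>"
  shows "finite ((\<lambda>g. g x) ` carrier (Gal \<iota>))"
proof -
  interpret \<iota>: field_hom \<iota> using assms by (simp add: separable_closure_def)
  obtain f where f: "Factorial_Ring.irreducible f" "poly (map_poly \<iota> f) x = 0"
    using assms by (auto simp: separable_closure_def separable_over_def)
  have "map_poly \<iota> f \<noteq> 0"
    using f(1) by (auto simp: poly_eq_iff coeff_map_poly)
  moreover have "(\<lambda>g. g x) ` carrier (Gal \<iota>) \<subseteq> {y. poly (map_poly \<iota> f) y = 0}"
  proof safe
    fix g assume g: "g \<in> carrier (Gal \<iota>)"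
    have "poly (map_poly \<iota> f) (g x) = g (poly (map_poly \<iota> f) x)"
      by (simp add: poly_altdef coeff_map_poly Gal_elem_sum[OF g] Gal_elem_times[OF g]
          Gal_elem_power[OF g] Gal_base[OF g])
    then show "poly (map_poly \<iota> f) (g x) = 0" by (simp add: f(2) Gal_elem_zero[OF g])
  qed
  ultimately show ?thesis using poly_roots_finite finite_subset by blast
qed

lemma Gal_subgroup:
  assumes "subgroup U (Gal \<iota>)"
  shows "g \<in> U \<Longrightarrow> g \<in> carrier (Gal \<iota>)"
    and "id \<in> U"
    and "g \<in> U \<Longrightarrow> h \<in> U \<Longrightarrow> g \<circ> h \<in> U"
    and "g \<in> U \<Longrightarrow> inv\<^bsub>Gal \<iota>\<^esub> g \<in> U"
proof -
  show "g \<in> U \<Longrightarrow> g \<in> carrier (Gal \<iota>)" by (rule subgroup.mem_carrier[OF assms])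
  show "id \<in> U" using subgroup.one_closed[OF assms] by simp
  show "g \<in> U \<Longrightarrow> h \<in> U \<Longrightarrow> g \<circ> h \<in> U" using subgroup.m_closed[OF assms, of g h] by simp
  show "g \<in> U \<Longrightarrow> inv\<^bsub>Gal \<iota>\<^esub> g \<in> U" by (rule subgroup.m_inv_closed[OF assms])
qed

lemma Gal_inv:
  assumes "g \<in> carrier (Gal \<iota>)"
  shows "(inv\<^bsub>Gal \<iota>\<^esub> g) (g x) = x" "g ((inv\<^bsub>Gal \<iota>\<^esub> g) x) = x"
proof -
  interpret group "Gal \<iota>" by (rule group_Gal)
  show "(inv\<^bsub>Gal \<iota>\<^esub> g) (g x) = x" "g ((inv\<^bsub>Gal \<iota>\<^esub> g) x) = x"
    using fun_cong[OF l_inv[OF assms], of x] fun_cong[OF r_inv[OF assms], of x] by simp_all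
qed

text \<open>
  Hilbert 90 for a character, by a Lagrange resolvent over the restrictions of \<open>U\<close> to the
  subfield \<open>K\<close> fixed by the elements of \<open>U\<close> fixing \<open>S\<close>.
\<close>

lemma kummer_generator:
  fixes \<iota> :: "'f::field \<Rightarrow> 'l::field" and f :: "('l \<Rightarrow> 'l) \<Rightarrow> 'p::prime_card mod_ring"
  assumes sc: "separable_closure \<iota>" and U: "subgroup U (Gal \<iota>)"
    and \<zeta>: "\<zeta> ^ CARD('p) = 1" "\<And>g. g \<in> U \<Longrightarrow> g \<zeta> = \<zeta>"
    and f: "\<And>g h. g \<in> U \<Longrightarrow> h \<in> U \<Longrightarrow> f (g \<circ> h) = f g + f h"
    and S: "finite S" "\<And>g. g \<in> U \<Longrightarrow> (\<And>s. s \<in> S \<Longrightarrow> g s = s) \<Longrightarrow> f g = 0"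
  obtains z where "z \<noteq> 0" "\<And>g. g \<in> U \<Longrightarrow> g z = root_pow \<zeta> (f g) * z"
proof -
  note UG = Gal_subgroup[OF U]
  note GE = Gal_elem_one[OF UG(1)] Gal_elem_times[OF UG(1)]
  \<comment> \<open>By \<open>agree\<close> below, the restriction of \<open>g\<close> to
    \<open>S\<close> determines both \<open>f g\<close> and the restriction of \<open>g\<close> to
    \<open>K\<close>.\<close>
  define K where "K = {x. \<forall>g\<in>U. (\<forall>s\<in>S. g s = s) \<longrightarrow> g x = x}"
  have SK: "S \<subseteq> K" by (auto simp: K_def)
  have agree: "f h = f g \<and> (\<forall>x\<in>K. h x = g x)" if g: "g \<in> U" and h: "h \<in> U" and gh: "\<And>s. s \<in> S \<Longrightarrow> g s = h s" for g h
  proof -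
    define k where "k = inv\<^bsub>Gal \<iota>\<^esub> g \<circ> h"
    have k: "k \<in> U" using UG(3)[OF UG(4)[OF g] h] by (simp add: k_def)
    have hk: "h = g \<circ> k" by (simp add: k_def fun_eq_iff Gal_inv[OF UG(1)[OF g]])
    have ks: "k s = s" if "s \<in> S" for s
      using gh[OF that] by (metis Gal_inv(1) UG(1) comp_apply g k_def)
    have "f h = f g" unfolding hk using f[OF g k] S(2)[OF k ks] by simp
    moreover have "k x = x" if "x \<in> K" for x using that k ks by (simp add: K_def)
    then have "\<forall>x\<in>K. h x = g x" by (simp add: hk)
    ultimately show ?thesis by blast
  qed
  \<comment> \<open>As \<open>S\<close> need not be stable under \<open>U\<close>, neither need
    \<open>K\<close> be; so \<open>Q\<close> is a set of embeddings of \<open>K\<close> rather than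
    a group, and \<open>U\<close> acts on it by composition from the left.\<close>
  define Q where "Q = (\<lambda>g. restrict g K) ` U"
  have "finite Q"
  proof (rule finite_imageD)
    show "finite ((\<lambda>q. restrict q S) ` Q)"
    proof (rule finite_subset)
      show "(\<lambda>q. restrict q S) ` Q \<subseteq> (\<Pi>\<^sub>E s\<in>S. (\<lambda>g. g s) ` carrier (Gal \<iota>))"
        using SK UG(1) by (auto simp: Q_def)
      show "finite (\<Pi>\<^sub>E s\<in>S. (\<lambda>g. g s) ` carrier (Gal \<iota>))"
        by (intro finite_PiE S(1) finite_conjugates[OF sc])
    qed
    show "inj_on (\<lambda>q. restrict q S) Q"
    proof (rule inj_onI)
      fix q q' assume "q \<in> Q" "q' \<in> Q" and eq: "restrict q S = restrict q' S"
      then obtain g h where g: "g \<in> U" "q = restrict g K" and h: "h \<in> U" "q' = restrict h K"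
        by (auto simp: Q_def)
      have "g s = h s" if "s \<in> S" for s
        using fun_cong[OF eq, of s] that SK g(2) h(2) by auto
      then show "q = q'" using agree[OF g(1) h(1)] g(2) h(2) by (auto simp: restrict_def)
    qed
  qed
  \<comment> \<open>The coefficients of the Lagrange resolvent. By \<open>agree\<close> they do not
    depend on the chosen extension of \<open>q\<close> to an element of \<open>U\<close>.\<close>
  define c where "c q = root_pow \<zeta> (- f (SOME g. g \<in> U \<and> q = restrict g K))" for q
  have c: "c (restrict g K) = root_pow \<zeta> (- f g)" if g: "g \<in> U" for g
  proof -
    define h where "h = (SOME h. h \<in> U \<and> restrict g K = restrict h K)"
    have h: "h \<in> U" "restrict g K = restrict h K"
      using someI[of "\<lambda>h. h \<in> U \<and> restrict g K = restrict h K" g] g by (auto simp: h_def)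
    have "g s = h s" if "s \<in> S" for s
      using fun_cong[OF h(2), of s] that SK by auto
    then show ?thesis using agree[OF g h(1)] by (simp add: c_def flip: h_def)
  qed
  \<comment> \<open>The resolvent cannot vanish on all of \<open>K\<close>, since its coefficients
    are nonzero and the embeddings are linearly independent.\<close>
  obtain \<theta> where \<theta>: "\<theta> \<in> K" "(\<Sum>q\<in>Q. c q * q \<theta>) \<noteq> 0"
  proof (rule ccontr)
    assume "\<not> thesis"
    then have zero: "\<And>a. a \<in> K \<Longrightarrow> (\<Sum>q\<in>Q. c q * q a) = 0" using that by blast
    have one: "1 \<in> K" by (simp add: K_def GE)
    have "c (restrict id K) = 0"
    proof (rule dedekind_independence[where Q = Q and K = K and c = c])
      show mult: "a * b \<in> K" if "a \<in> K" "b \<in> K" for a b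
        using that by (auto simp: K_def GE)
      show "q (a * b) = q a * q b" if "q \<in> Q" "a \<in> K" "b \<in> K" for q a b
        using that mult[OF that(2,3)] by (auto simp: Q_def GE)
      show "\<exists>a\<in>K. q a \<noteq> 0" if "q \<in> Q" for q
        using that one by (intro bexI[of _ 1]) (auto simp: Q_def GE)
      show "\<exists>a\<in>K. q a \<noteq> q' a" if q: "q \<in> Q" "q' \<in> Q" "q \<noteq> q'" for q q'
      proof -
        obtain a where a: "q a \<noteq> q' a" using q(3) by (auto simp: fun_eq_iff)
        then have "a \<in> K" using q(1,2) by (cases "a \<in> K") (auto simp: Q_def)
        with a show ?thesis by blast
      qed
      show "restrict id K \<in> Q" using UG(2) by (auto simp: Q_def)
    qed (use \<open>finite Q\<close> zero in auto)
    then show False using c[OF UG(2)] root_pow_nonzero[OF \<zeta>(1)] by simp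
  qed
  define z where "z = (\<Sum>q\<in>Q. c q * q \<theta>)"
  have "h z = root_pow \<zeta> (f h) * z" if h: "h \<in> U" for h
  proof -
    \<comment> \<open>Composition with \<open>h\<close> permutes \<open>Q\<close> and multiplies the
      coefficient by \<open>root_pow \<zeta> (- f h)\<close>, so the resolvent is an eigenvector of
      \<open>h\<close> with the inverse eigenvalue.\<close>
    define T where "T k q = restrict (k \<circ> q) K" for k :: "'l \<Rightarrow> 'l" and q :: "'l \<Rightarrow> 'l"
    have TQ: "T k q \<in> Q" if k: "k \<in> U" and q: "q \<in> Q" for k q
    proof -
      obtain g where g: "g \<in> U" "q = restrict g K" using q by (auto simp: Q_def)
      have "T k q = restrict (k \<circ> g) K" by (auto simp: T_def g(2))
      then show ?thesis using UG(3)[OF k g(1)] by (auto simp: Q_def)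
    qed
    have ext: "q \<in> extensional K" if "q \<in> Q" for q using that by (auto simp: Q_def)
    have bij: "bij_betw (T h) Q Q"
    proof (rule bij_betwI[where g = "T (inv\<^bsub>Gal \<iota>\<^esub> h)"])
      show "T h \<in> Q \<rightarrow> Q" "T (inv\<^bsub>Gal \<iota>\<^esub> h) \<in> Q \<rightarrow> Q" using TQ h UG(4)[OF h] by auto
      fix q assume "q \<in> Q"
      then have "q x = undefined" if "x \<notin> K" for x
        using extensional_arb[OF ext] that by blast
      then show "T (inv\<^bsub>Gal \<iota>\<^esub> h) (T h q) = q" "T h (T (inv\<^bsub>Gal \<iota>\<^esub> h) q) = q"
        by (auto simp: T_def fun_eq_iff Gal_inv[OF UG(1)[OF h]])
    qed
    have "h z = (\<Sum>q\<in>Q. root_pow \<zeta> (f h) * (c (T h q) * T h q \<theta>))"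
      unfolding z_def Gal_elem_sum[OF UG(1)[OF h]]
    proof (rule sum.cong[OF refl])
      fix q assume "q \<in> Q"
      then obtain g where g: "g \<in> U" "q = restrict g K" by (auto simp: Q_def)
      have T: "T h q = restrict (h \<circ> g) K" by (auto simp: T_def g(2))
      have "root_pow \<zeta> (- f g) = root_pow \<zeta> (f h) * root_pow \<zeta> (- f (h \<circ> g))"
        by (simp add: f[OF h g(1)] flip: root_pow_add[OF \<zeta>(1)])
      then show "h (c q * q \<theta>) = root_pow \<zeta> (f h) * (c (T h q) * T h q \<theta>)"
        using c[OF g(1)] c[OF UG(3)[OF h g(1)]] \<theta>(1)
        unfolding T by (simp add: GE h g(2) Gal_root_pow[OF UG(1)[OF h] \<zeta>(2)[OF h]])
    qed
    also have "\<dots> = root_pow \<zeta> (f h) * (\<Sum>q\<in>Q. c (T h q) * T h q \<theta>)" by (simp add: sum_distrib_left)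
    also have "(\<Sum>q\<in>Q. c (T h q) * T h q \<theta>) = z"
      unfolding z_def by (rule sum.reindex_bij_betw[OF bij])
    finally show ?thesis .
  qed
  with \<theta>(2) show ?thesis using that unfolding z_def[symmetric] by blast
qed

lemma krull_open_fixing:
  assumes "finite S"
  shows "openin (krull_topology \<iota>) {h \<in> carrier (Gal \<iota>). \<forall>s\<in>S. h s = g s}"
  unfolding openin_krull_topology
proof (intro conjI ballI)
  fix \<sigma> assume "\<sigma> \<in> {h \<in> carrier (Gal \<iota>). \<forall>s\<in>S. h s = g s}"
  then show "\<exists>S'. finite S' \<and> {\<tau> \<in> carrier (Gal \<iota>). \<forall>x\<in>S'. \<tau> x = \<sigma> x} \<subseteq> {h \<in> carrier (Gal \<iota>). \<forall>s\<in>S. h s = g s}"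
    by (intro exI[of _ S]) (use assms in auto)
qed auto

text \<open>Continuity at the identity makes \<open>f\<close> constant on the elements of
  \<open>U\<close> fixing a suitable finite set; the relation at \<open>id \<circ> id\<close> forces
  the constant to be 0.\<close>

lemma krull_continuous_finite_support:
  fixes f :: "('l::field \<Rightarrow> 'l) \<Rightarrow> 'p::group_add"
  assumes U: "subgroup U (Gal \<iota>)"
    and cont: "continuous_map (subtopology (krull_topology \<iota>) U) (discrete_topology UNIV) f"
    and f: "f (id \<circ> id) = f id + f id"
  obtains S where "finite S" "\<And>g. g \<in> U \<Longrightarrow> (\<And>s. s \<in> S \<Longrightarrow> g s = s) \<Longrightarrow> f g = 0"
proof -
  note UG = Gal_subgroup[OF U]
  have "id \<in> topspace (subtopology (krull_topology \<iota>) U)" using UG(1,2) by simp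
  then obtain V where V: "openin (subtopology (krull_topology \<iota>) U) V" "id \<in> V" "\<forall>g\<in>V. f g = f id"
    using cont unfolding continuous_map_discrete_iff by blast
  then obtain W where W: "openin (krull_topology \<iota>) W" "V = W \<inter> U" by (auto simp: openin_subtopology)
  then obtain S where S: "finite S" "{h \<in> carrier (Gal \<iota>). \<forall>s\<in>S. h s = id s} \<subseteq> W"
    using V(2) unfolding openin_krull_topology by blast
  show ?thesis
  proof (rule that[OF S(1)])
    fix g assume g: "g \<in> U" "\<And>s. s \<in> S \<Longrightarrow> g s = s"
    then have "g \<in> V" using S(2) UG(1) W(2) by auto
    then have "f g = f id" using V(3) by blast
    moreover have "f id + f id = f id + 0" using f by simp
    ultimately show "f g = 0" unfolding add_left_cancel by simp
  qed
qed

text \<open>As the p-th power of \<open>s\<close> is fixed, \<open>g s / s\<close> is a p-th root of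
  unity, and \<phi> is its exponent. It depends on \<open>g\<close> only through \<open>g s\<close>,
  hence is locally constant.\<close>

lemma kummer_character:
  fixes \<iota> :: "'f::field \<Rightarrow> 'l::field"
  assumes U: "subgroup U (Gal \<iota>)"
    and \<zeta>: "\<zeta> ^ CARD('p::prime_card) = 1" "\<zeta> \<noteq> 1" "\<And>g. g \<in> U \<Longrightarrow> g \<zeta> = \<zeta>"
    and s: "s \<noteq> 0" "\<And>g. g \<in> U \<Longrightarrow> g (s ^ CARD('p)) = s ^ CARD('p)"
  obtains \<phi> :: "('l \<Rightarrow> 'l) \<Rightarrow> 'p::prime_card mod_ring" where
    "\<And>g. g \<in> U \<Longrightarrow> g s = root_pow \<zeta> (\<phi> g) * s"
    "\<And>g h. g \<in> U \<Longrightarrow> h \<in> U \<Longrightarrow> \<phi> (g \<circ> h) = \<phi> g + \<phi> h"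
    "continuous_map (subtopology (krull_topology \<iota>) U) (discrete_topology UNIV) \<phi>"
proof -
  note UG = Gal_subgroup[OF U]
  have "\<exists>a :: 'p mod_ring. g s = root_pow \<zeta> a * s" if g: "g \<in> U" for g
  proof -
    have "(g s / s) ^ CARD('p) = 1"
      using s(2)[OF g] s(1) by (simp add: power_divide Gal_elem_power[OF UG(1)[OF g]])
    then obtain a :: "'p mod_ring" where "g s / s = root_pow \<zeta> a"
      by (rule root_of_unity_root_pow[OF \<zeta>(1,2)])
    then show ?thesis using s(1) by (auto simp: field_simps)
  qed
  then obtain \<phi> :: "('l \<Rightarrow> 'l) \<Rightarrow> 'p mod_ring" where \<phi>: "\<And>g. g \<in> U \<Longrightarrow> g s = root_pow \<zeta> (\<phi> g) * s"
    by metis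
  show ?thesis
  proof (rule that[of \<phi>])
    fix g h assume g: "g \<in> U" and h: "h \<in> U"
    have "root_pow \<zeta> (\<phi> (g \<circ> h)) * s = g (h s)" using \<phi>[OF UG(3)[OF g h]] by simp
    also have "\<dots> = root_pow \<zeta> (\<phi> g + \<phi> h) * s"
      by (simp add: \<phi>[OF g] \<phi>[OF h] Gal_root_pow[OF UG(1)[OF g] \<zeta>(3)[OF g]]
          Gal_elem_times[OF UG(1)[OF g]] root_pow_add[OF \<zeta>(1)])
    finally show "\<phi> (g \<circ> h) = \<phi> g + \<phi> h" using s(1) root_pow_inj[OF \<zeta>(1,2)] by simp
  next
    show "g s = root_pow \<zeta> (\<phi> g) * s" if "g \<in> U" for g by (rule \<phi>[OF that])
    show "continuous_map (subtopology (krull_topology \<iota>) U) (discrete_topology UNIV) \<phi>"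
      unfolding continuous_map_discrete_iff
    proof
      fix g assume "g \<in> topspace (subtopology (krull_topology \<iota>) U)"
      then have g: "g \<in> U" by simp
      let ?V = "{h \<in> carrier (Gal \<iota>). \<forall>x\<in>{s}. h x = g x} \<inter> U"
      have "\<phi> h = \<phi> g" if "h \<in> ?V" for h
        using that \<phi>[of h] \<phi>[OF g] s(1) root_pow_inj[OF \<zeta>(1,2)] by auto
      moreover have "openin (subtopology (krull_topology \<iota>) U) ?V"
        unfolding openin_subtopology using krull_open_fixing[of "{s}" \<iota> g] by blast
      moreover have "g \<in> ?V" using g UG(1)[OF g] by simp
      ultimately show "\<exists>V. openin (subtopology (krull_topology \<iota>) U) V \<and> g \<in> V \<and> (\<forall>h\<in>V. \<phi> h = \<phi> g)"
        by blast
    qed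
  qed
qed

section \<open>Arithmetic modulo p and locally constant maps\<close>

lemma eq_add_self_imp_zero: "a = a + a \<Longrightarrow> a = (0::'a::group_add)"
  by (metis add_left_cancel add.right_neutral)

lemma twice_sum_lessThan: "2 * (\<Sum>i<n. i) = n * (n - 1)" for n :: nat
  by (induction n) (auto simp: algebra_simps diff_mult_distrib2)

text \<open>The doubled sum is considered because for p = 2 the sum itself is 1 in F_p.\<close>

lemma of_nat_twice_sum_lessThan_card:
  "of_nat (\<Sum>i<CARD('p::prime_card). i) + of_nat (\<Sum>i<CARD('p). i) = (0 :: 'p mod_ring)"
proof -
  have "of_nat (\<Sum>i<CARD('p). i) + of_nat (\<Sum>i<CARD('p). i) = (of_nat (2 * (\<Sum>i<CARD('p). i)) :: 'p mod_ring)"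
    by (simp only: mult_2 of_nat_add)
  also have "\<dots> = 0" by (simp only: twice_sum_lessThan of_nat_mult of_nat_card_eq_0 mult_zero_left)
  finally show ?thesis .
qed

lemma of_nat_mod_ring_inj:
  assumes "i < CARD('p::prime_card)" "j < CARD('p)" "of_nat i = (of_nat j :: 'p mod_ring)"
  shows "i = j"
  using assms
proof (induction i j rule: linorder_wlog)
  case (le i j)
  then have "of_nat (j - i) = (0 :: 'p mod_ring)" by (simp add: of_nat_diff)
  then have "CARD('p) dvd j - i" by (rule of_nat_0_mod_ring_dvd)
  then show ?case using le by (metis diff_is_0_eq dvd_imp_le le_antisym less_imp_diff_less not_gr0 not_le)
qed simp

lemma continuous_map_discrete_comp:
  assumes "continuous_map T (discrete_topology UNIV) f"
  shows "continuous_map T (discrete_topology UNIV) (\<lambda>x. F (f x))"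
  by (rule continuous_map_discrete_combine[OF assms assms, where F = "\<lambda>a _. F a"]) simp

lemma continuous_map_subtopology_mono:
  assumes "continuous_map (subtopology T U) S f" "N \<subseteq> U"
  shows "continuous_map (subtopology T N) S f"
  using continuous_map_from_subtopology[OF assms(1), of N] assms(2)
  by (simp add: subtopology_subtopology Int_absorb1)

lemma kernel_open:
  assumes cont: "continuous_map (subtopology T U) (discrete_topology UNIV) f"
    and U: "U \<subseteq> topspace T"
  shows "openin (subtopology T U) {g \<in> U. f g = a}"
proof -
  have "openin (subtopology T U) {g \<in> topspace (subtopology T U). f g \<in> {a}}"
    by (rule openin_continuous_map_preimage[OF cont]) simp
  moreover have "{g \<in> topspace (subtopology T U). f g \<in> {a}} = {g \<in> U. f g = a}"
    using U by auto
  ultimately show ?thesis by simp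
qed

section \<open>Norm and corestriction from the kernel of a character of order p\<close>

locale kummer_character_kernel =
  fixes \<iota> :: "'f::field \<Rightarrow> 'l::field" and U :: "('l \<Rightarrow> 'l) set" and \<chi> :: "('l \<Rightarrow> 'l) \<Rightarrow> 'p::prime_card mod_ring"
  assumes U: "subgroup U (Gal \<iota>)"
    and \<chi>_cont: "continuous_map (subtopology (krull_topology \<iota>) U) (discrete_topology UNIV) \<chi>"
    and \<chi>: "\<And>g h. g \<in> U \<Longrightarrow> h \<in> U \<Longrightarrow> \<chi> (g \<circ> h) = \<chi> g + \<chi> h"
    and nontrivial: "\<exists>g\<in>U. \<chi> g \<noteq> 0"
begin

lemmas UG = Gal_subgroup[OF U]

abbreviation H where "H \<equiv> Gal \<iota>\<lparr>carrier := U\<rparr>"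

text \<open>A normal subgroup of index p in \<open>U\<close> whose cosets are the fibres of \<chi>;
  it corresponds to the cyclic extension of degree p cut out by \<chi>.\<close>

definition N where "N = {g \<in> U. \<chi> g = 0}"

lemma group_H: "group H"
  by (rule subgroup.subgroup_is_group[OF U group_Gal])

lemma H_inv: "g \<in> U \<Longrightarrow> inv\<^bsub>H\<^esub> g = inv\<^bsub>Gal \<iota>\<^esub> g"
  by (rule group.m_inv_consistent[OF group_Gal U])

lemma \<chi>_id: "\<chi> id = 0"
  using \<chi>[OF UG(2) UG(2)] unfolding comp_id by (rule eq_add_self_imp_zero)

lemma \<chi>_inv: "g \<in> U \<Longrightarrow> \<chi> (inv\<^bsub>Gal \<iota>\<^esub> g) = - \<chi> g"
proof -
  assume g: "g \<in> U"
  have "inv\<^bsub>Gal \<iota>\<^esub> g \<circ> g = id" using Gal_inv[OF UG(1)[OF g]] by (simp add: fun_eq_iff)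
  then have "\<chi> (inv\<^bsub>Gal \<iota>\<^esub> g) + \<chi> g = 0" using \<chi>[OF UG(4)[OF g] g] \<chi>_id by simp
  then show ?thesis by (simp add: eq_neg_iff_add_eq_0)
qed

lemma N_subset: "N \<subseteq> U"
  by (auto simp: N_def)

lemma subgroup_N_H: "subgroup N H"
proof (rule group.subgroupI[OF group_H])
  show "N \<noteq> {}" using UG(2) \<chi>_id by (auto simp: N_def)
  fix a b assume ab: "a \<in> N" "b \<in> N"
  then show "inv\<^bsub>H\<^esub> a \<in> N" using UG(4) \<chi>_inv by (simp add: N_def H_inv)
  show "a \<otimes>\<^bsub>H\<^esub> b \<in> N" using ab UG(3) \<chi> by (simp add: N_def)
qed (use N_subset in simp)

lemma subgroup_N: "subgroup N (Gal \<iota>)"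
  using group.incl_subgroup[OF group_Gal U subgroup_N_H] .

lemma openin_N: "openin (subtopology (krull_topology \<iota>) U) N"
  unfolding N_def by (rule kernel_open[OF \<chi>_cont]) (use UG(1) in auto)

lemma mem_lcoset_iff: "g \<in> U \<Longrightarrow> h \<in> U \<Longrightarrow> h \<in> g <#\<^bsub>H\<^esub> N \<longleftrightarrow> \<chi> h = \<chi> g"
proof
  assume g: "g \<in> U" and h: "h \<in> U"
  show "\<chi> h = \<chi> g" if "h \<in> g <#\<^bsub>H\<^esub> N"
    using that g \<chi> by (auto simp: l_coset_def N_def)
  assume eq: "\<chi> h = \<chi> g"
  have "inv\<^bsub>Gal \<iota>\<^esub> g \<circ> h \<in> N"
    using \<chi>[OF UG(4)[OF g] h] UG(3)[OF UG(4)[OF g] h] by (simp add: N_def \<chi>_inv[OF g] eq)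
  moreover have "h = g \<circ> (inv\<^bsub>Gal \<iota>\<^esub> g \<circ> h)" by (simp add: fun_eq_iff Gal_inv[OF UG(1)[OF g]])
  ultimately show "h \<in> g <#\<^bsub>H\<^esub> N" unfolding l_coset_def by auto
qed

lemma lcoset_eq: "g \<in> U \<Longrightarrow> g <#\<^bsub>H\<^esub> N = {h \<in> U. \<chi> h = \<chi> g}"
proof -
  assume g: "g \<in> U"
  have "g <#\<^bsub>H\<^esub> N \<subseteq> U" using g N_subset UG(3) by (auto simp: l_coset_def)
  then show ?thesis using mem_lcoset_iff[OF g] by blast
qed

lemma \<chi>_funpow: "g \<in> U \<Longrightarrow> g ^^ n \<in> U \<and> \<chi> (g ^^ n) = of_nat n * \<chi> g"
  by (induction n) (auto simp: UG(2,3) \<chi> \<chi>_id algebra_simps simp flip: id_def)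

lemma generator: obtains \<sigma> where "\<sigma> \<in> U" "\<chi> \<sigma> = 1"
proof -
  obtain g where g: "g \<in> U" "\<chi> g \<noteq> 0" using nontrivial by blast
  obtain n where "inverse (\<chi> g) = of_nat n" using surj_of_nat_mod_ring by metis
  then have "\<chi> (g ^^ n) = 1" using \<chi>_funpow[OF g(1), of n] g(2) by (simp flip: \<open>inverse (\<chi> g) = of_nat n\<close>)
  then show ?thesis using that \<chi>_funpow[OF g(1), of n] by blast
qed

lemma lcosets_eq: "lcosets\<^bsub>H\<^esub> N = (\<lambda>i. {h \<in> U. \<chi> h = of_nat i}) ` {..<CARD('p)}"
proof -
  obtain \<sigma> where \<sigma>: "\<sigma> \<in> U" "\<chi> \<sigma> = 1" by (rule generator)
  have "lcosets\<^bsub>H\<^esub> N = (\<lambda>g. {h \<in> U. \<chi> h = \<chi> g}) ` U"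
    using lcoset_eq by (auto simp: LCOSETS_def)
  also have "\<dots> = (\<lambda>i. {h \<in> U. \<chi> h = of_nat i}) ` {..<CARD('p)}"
  proof (intro equalityI subsetI; elim imageE)
    fix X g assume X: "X = {h \<in> U. \<chi> h = \<chi> g}"
    obtain i where "i < CARD('p)" "\<chi> g = of_nat i" using surj_of_nat_mod_ring by blast
    then show "X \<in> (\<lambda>i. {h \<in> U. \<chi> h = of_nat i}) ` {..<CARD('p)}" using X by auto
  next
    fix X i assume X: "X = {h \<in> U. \<chi> h = of_nat i}"
    then show "X \<in> (\<lambda>g. {h \<in> U. \<chi> h = \<chi> g}) ` U"
      using \<chi>_funpow[OF \<sigma>(1), of i] \<sigma>(2) by (intro image_eqI[of _ _ "\<sigma> ^^ i"]) auto
  qed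
  finally show ?thesis .
qed

lemma finite_lcosets: "finite (lcosets\<^bsub>H\<^esub> N)"
  by (simp add: lcosets_eq)

text \<open>Elements of one coset agree on \<open>y\<close>, and the powers \<sigma>^i with i < p
  represent all cosets. The common value is the norm of \<open>y\<close> to the field fixed by
  \<open>U\<close>; the powers of \<sigma> are the representatives for which products
  telescope.\<close>

lemma norm_eq:
  assumes r: "\<forall>C\<in>lcosets\<^bsub>H\<^esub> N. r C \<in> C" and y: "\<forall>g\<in>N. g y = y"
    and \<sigma>: "\<sigma> \<in> U" "\<chi> \<sigma> = 1"
  shows "(\<Prod>C\<in>lcosets\<^bsub>H\<^esub> N. r C y) = (\<Prod>i<CARD('p). (\<sigma> ^^ i) y)"
proof -
  let ?F = "\<lambda>i. {h \<in> U. \<chi> h = of_nat i}"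
  have \<sigma>F: "\<sigma> ^^ i \<in> ?F i" for i using \<chi>_funpow[OF \<sigma>(1), of i] \<sigma>(2) by simp
  have inj: "inj_on ?F {..<CARD('p)}"
  proof (rule inj_onI)
    fix i j assume ij: "i \<in> {..<CARD('p)}" "j \<in> {..<CARD('p)}" "?F i = ?F j"
    have "\<sigma> ^^ i \<in> ?F j" using \<sigma>F[of i] ij(3) by blast
    then have "of_nat i = (of_nat j :: 'p mod_ring)" using \<sigma>F[of i] by simp
    then show "i = j" using of_nat_mod_ring_inj ij(1,2) by blast
  qed
  have "(\<Prod>C\<in>lcosets\<^bsub>H\<^esub> N. r C y) = (\<Prod>i<CARD('p). r (?F i) y)"
    unfolding lcosets_eq by (simp add: prod.reindex[OF inj])
  also have "\<dots> = (\<Prod>i<CARD('p). (\<sigma> ^^ i) y)"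
  proof (rule prod.cong[OF refl])
    fix i assume "i \<in> {..<CARD('p)}"
    then have "?F i \<in> lcosets\<^bsub>H\<^esub> N" unfolding lcosets_eq by (rule imageI)
    then have rF: "r (?F i) \<in> ?F i" by (rule bspec[OF r])
    define g where "g = r (?F i)"
    define h where "h = \<sigma> ^^ i"
    have "g \<in> ?F i" unfolding g_def by (rule rF)
    moreover have "h \<in> ?F i" unfolding h_def by (rule \<sigma>F)
    ultimately have gh: "g \<in> U" "\<chi> g = of_nat i" "h \<in> U" "\<chi> h = of_nat i" by blast+
    then have "h \<in> g <#\<^bsub>H\<^esub> N" using mem_lcoset_iff by simp
    then obtain n where n: "n \<in> N" "h = g \<circ> n" by (auto simp: l_coset_def)
    have "h y = g y" by (simp add: n(2) bspec[OF y n(1)])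
    then show "r (?F i) y = (\<sigma> ^^ i) y" unfolding g_def h_def by (rule sym)
  qed
  finally show ?thesis .
qed

text \<open>
  If \<open>\<beta>\<close> is the Kummer character of \<open>t\<^sup>p\<close>, then vanishing of the cup product
  \<open>\<chi> \<union> \<beta>\<close>, witnessed by \<open>x\<close>, makes \<open>t\<^sup>p\<close> a norm from the field fixed by \<open>N\<close>:
  if \<open>z\<close> generates the Kummer extension belonging to the restriction of \<open>x\<close> to \<open>N\<close>,
  it is the norm of \<open>t * \<sigma> z / z\<close>.  The corestriction of \<open>\<phi>\<close> is the Kummer character of
  the norm of \<open>s\<^sup>p\<close>.
\<close>

lemma kummer_corestriction:
  fixes \<beta> x :: "('l \<Rightarrow> 'l) \<Rightarrow> 'p mod_ring"
  assumes sc: "separable_closure \<iota>" and char: "(of_nat CARD('p) :: 'l) \<noteq> 0"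
    and \<zeta>: "\<zeta> ^ CARD('p) = 1" "\<zeta> \<noteq> 1" "\<And>g. g \<in> U \<Longrightarrow> g \<zeta> = \<zeta>"
    and \<beta>_cont: "continuous_map (subtopology (krull_topology \<iota>) U) (discrete_topology UNIV) \<beta>"
    and x_cont: "continuous_map (subtopology (krull_topology \<iota>) U) (discrete_topology UNIV) x"
    and \<beta>: "\<And>g h. g \<in> U \<Longrightarrow> h \<in> U \<Longrightarrow> \<beta> (g \<circ> h) = \<beta> g + \<beta> h"
    and x: "\<And>g h. g \<in> U \<Longrightarrow> h \<in> U \<Longrightarrow> x (g \<circ> h) = x g + x h + \<chi> g * \<beta> h"
  obtains \<phi> :: "('l \<Rightarrow> 'l) \<Rightarrow> 'p mod_ring" where
    "continuous_map (subtopology (krull_topology \<iota>) N) (discrete_topology UNIV) \<phi>"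
    "\<And>g h. g \<in> N \<Longrightarrow> h \<in> N \<Longrightarrow> \<phi> (g \<circ> h) = \<phi> g + \<phi> h"
    "\<And>r g. \<forall>C\<in>lcosets\<^bsub>H\<^esub> N. r C \<in> C \<Longrightarrow> g \<in> U \<Longrightarrow>
       (\<Sum>C\<in>lcosets\<^bsub>H\<^esub> N. \<phi> (inv\<^bsub>H\<^esub> (r (g <#\<^bsub>H\<^esub> C)) \<otimes>\<^bsub>H\<^esub> g \<otimes>\<^bsub>H\<^esub> r C)) = \<beta> g"
proof -
  have rpU: "g (root_pow \<zeta> a) = root_pow \<zeta> a" if "g \<in> U" for g and a :: "'p mod_ring"
    by (rule Gal_root_pow[OF UG(1)[OF that] \<zeta>(3)[OF that]])
  note GE = Gal_elem_times[OF UG(1)] Gal_elem_divide[OF UG(1)] Gal_elem_power[OF UG(1)] rpU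
  note NU = subsetD[OF N_subset]
  note rp = root_pow_add[OF \<zeta>(1)]
  note rp0 = root_pow_nonzero[OF \<zeta>(1)]
  obtain \<sigma> where \<sigma>: "\<sigma> \<in> U" "\<chi> \<sigma> = 1" by (rule generator)
  have xN: "x (g \<circ> h) = x g + x h" if "g \<in> N" "h \<in> N" for g h
    using x[of g h] that by (simp add: N_def)
  obtain z where z: "z \<noteq> 0" "\<And>g. g \<in> N \<Longrightarrow> g z = root_pow \<zeta> (x g) * z"
  proof -
    have idN: "id \<in> N" using UG(2) \<chi>_id by (simp add: N_def)
    obtain S where S: "finite S" "\<And>g. g \<in> N \<Longrightarrow> (\<And>s. s \<in> S \<Longrightarrow> g s = s) \<Longrightarrow> x g = 0"
      by (rule krull_continuous_finite_support[OF subgroup_N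
            continuous_map_subtopology_mono[OF x_cont N_subset] xN[OF idN idN]]) blast
    show thesis
      proof (rule kummer_generator[where \<iota> = \<iota> and U = N and S = S and \<zeta> = \<zeta> and f = x])
      show "g \<zeta> = \<zeta>" if "g \<in> N" for g using \<zeta>(3) NU that by blast
      show "x (g \<circ> h) = x g + x h" if "g \<in> N" "h \<in> N" for g h by (rule xN[OF that])
      show "x g = 0" if "g \<in> N" "\<And>s. s \<in> S \<Longrightarrow> g s = s" for g using S(2) that by blast
    qed (use sc subgroup_N U \<zeta>(1) S(1) that in blast)+
  qed
  obtain t where t: "t \<noteq> 0" "\<And>g. g \<in> U \<Longrightarrow> g t = root_pow \<zeta> (\<beta> g) * t"
  proof -
    obtain S where S: "finite S" "\<And>g. g \<in> U \<Longrightarrow> (\<And>s. s \<in> S \<Longrightarrow> g s = s) \<Longrightarrow> \<beta> g = 0"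
      by (rule krull_continuous_finite_support[OF U \<beta>_cont \<beta>[OF UG(2) UG(2)]]) blast
    show thesis
      proof (rule kummer_generator[where \<iota> = \<iota> and U = U and S = S and \<zeta> = \<zeta> and f = \<beta>])
      show "g \<zeta> = \<zeta>" if "g \<in> U" for g using \<zeta>(3) that by blast
      show "\<beta> (g \<circ> h) = \<beta> g + \<beta> h" if "g \<in> U" "h \<in> U" for g h by (rule \<beta>[OF that])
      show "\<beta> g = 0" if "g \<in> U" "\<And>s. s \<in> S \<Longrightarrow> g s = s" for g using S(2) that by blast
    qed (use sc subgroup_N U \<zeta>(1) S(1) that in blast)+
  qed
  have \<sigma>z: "\<sigma> z \<noteq> 0" using z(1) Gal_elem_eq_0_iff[OF UG(1)[OF \<sigma>(1)]] by simp
  define y where "y = t * \<sigma> z / z"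
  have y0: "y \<noteq> 0" using t(1) z(1) \<sigma>z by (simp add: y_def)
  have y: "g y = y" if g: "g \<in> N" for g
  proof -
    \<comment> \<open>Evaluating \<chi>, \<beta> and \<open>x\<close> on
      \<open>\<sigma> \<circ> h = g \<circ> \<sigma>\<close> shows that \<open>h\<close> lies in
      \<open>N\<close>, that \<open>\<beta> h = \<beta> g\<close>, and that
      \<open>x g = x h + \<beta> g\<close>. So the factors by which \<open>g\<close> moves
      \<open>t\<close> and \<open>\<sigma> z\<close> cancel against the one by which it moves
      \<open>z\<close>.\<close>
    define h where "h = inv\<^bsub>Gal \<iota>\<^esub> \<sigma> \<circ> (g \<circ> \<sigma>)"
    have gU: "g \<in> U" using NU[OF g] .
    have hU: "h \<in> U" unfolding h_def using UG(3,4) gU \<sigma>(1) by simp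
    have h: "\<sigma> \<circ> h = g \<circ> \<sigma>" by (simp add: h_def fun_eq_iff Gal_inv[OF UG(1)[OF \<sigma>(1)]])
    have "\<chi> \<sigma> + \<chi> h = \<chi> g + \<chi> \<sigma>" using \<chi>[OF \<sigma>(1) hU] \<chi>[OF gU \<sigma>(1)] h by simp
    then have hN: "h \<in> N" using hU g by (simp add: N_def)
    have "\<beta> \<sigma> + \<beta> h = \<beta> g + \<beta> \<sigma>" using \<beta>[OF \<sigma>(1) hU] \<beta>[OF gU \<sigma>(1)] h by simp
    moreover have "x \<sigma> + x h + \<beta> h = x g + x \<sigma>" using x[OF \<sigma>(1) hU] x[OF gU \<sigma>(1)] h \<sigma>(2) g by (simp add: N_def)
    ultimately have xg: "x g = x h + \<beta> g" by (simp add: algebra_simps)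
    have "g (\<sigma> z) = \<sigma> (h z)" using fun_cong[OF h, of z] by simp
    also have "\<dots> = root_pow \<zeta> (x h) * \<sigma> z" by (simp add: z(2)[OF hN] GE[OF \<sigma>(1)])
    finally have "g (\<sigma> z) = root_pow \<zeta> (x h) * \<sigma> z" .
    then have "g y = (root_pow \<zeta> (\<beta> g) * t) * (root_pow \<zeta> (x h) * \<sigma> z) / (root_pow \<zeta> (x h + \<beta> g) * z)"
      by (simp add: y_def GE[OF gU] t(2)[OF gU] z(2)[OF g] xg)
    then show ?thesis using rp0 by (simp add: y_def rp)
  qed
  then have yN: "\<forall>g\<in>N. g y = y" by blast
  obtain s where s: "s ^ CARD('p) = y" "s \<noteq> 0"
    by (rule separable_closure_nth_root[OF sc char y0])
  obtain \<phi> :: "('l \<Rightarrow> 'l) \<Rightarrow> 'p mod_ring" where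
    \<phi>: "\<And>g. g \<in> N \<Longrightarrow> g s = root_pow \<zeta> (\<phi> g) * s"
      "\<And>g h. g \<in> N \<Longrightarrow> h \<in> N \<Longrightarrow> \<phi> (g \<circ> h) = \<phi> g + \<phi> h"
      "continuous_map (subtopology (krull_topology \<iota>) N) (discrete_topology UNIV) \<phi>"
  proof (rule kummer_character[where \<iota> = \<iota> and U = N and s = s and \<zeta> = \<zeta>])
    show "g \<zeta> = \<zeta>" if "g \<in> N" for g using \<zeta>(3) NU that by blast
    show "g (s ^ CARD('p)) = s ^ CARD('p)" if "g \<in> N" for g unfolding s(1) by (rule y[OF that])
  qed (use subgroup_N \<zeta>(1,2) s(2) that in blast)+
  note \<sigma>n = \<chi>_funpow[OF \<sigma>(1), THEN conjunct1]
  have \<beta>_id: "\<beta> id = 0" using \<beta>[OF UG(2) UG(2)] unfolding comp_id by (rule eq_add_self_imp_zero)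
  have x_id: "x id = 0"
    using x[OF UG(2) UG(2)] unfolding comp_id \<chi>_id mult_zero_left add_0_right by (rule eq_add_self_imp_zero)
  have \<beta>n: "\<beta> (\<sigma> ^^ n) = of_nat n * \<beta> \<sigma>" for n
  proof (induction n)
    case (Suc n)
    show ?case unfolding funpow.simps(2) \<beta>[OF \<sigma>(1) \<sigma>n] Suc by (simp add: algebra_simps)
  next
    case 0
    show ?case unfolding funpow.simps(1) \<beta>_id by simp
  qed
  have xn: "x (\<sigma> ^^ n) = of_nat n * x \<sigma> + of_nat (\<Sum>i<n. i) * \<beta> \<sigma>" for n
  proof (induction n)
    case (Suc n)
    show ?case unfolding funpow.simps(2) x[OF \<sigma>(1) \<sigma>n] Suc \<beta>n \<sigma>(2) by (simp add: algebra_simps)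
  next
    case 0
    show ?case unfolding funpow.simps(1) x_id by simp
  qed
  \<comment> \<open>The quotients of conjugates of \<open>z\<close> telescope, while
    \<open>(\<sigma> ^^ i) t\<close> is \<open>t\<close> times
    \<open>root_pow \<zeta> (of_nat i * \<beta> \<sigma>)\<close>.\<close>
  have prod_y: "(\<Prod>i<n. (\<sigma> ^^ i) y) = root_pow \<zeta> (of_nat (\<Sum>i<n. i) * \<beta> \<sigma>) * t ^ n * (\<sigma> ^^ n) z / z" for n
  proof (induction n)
    case (Suc n)
    have zn: "(\<sigma> ^^ n) z \<noteq> 0" using z(1) Gal_elem_eq_0_iff[OF UG(1)[OF \<sigma>n]] by simp
    have "(\<sigma> ^^ n) y = root_pow \<zeta> (of_nat n * \<beta> \<sigma>) * t * (\<sigma> ^^ Suc n) z / (\<sigma> ^^ n) z"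
      by (simp add: y_def GE[OF \<sigma>n] t(2)[OF \<sigma>n] \<beta>n funpow_swap1)
    then show ?case using zn by (simp add: Suc rp algebra_simps)
  qed (use z(1) in simp)
  have norm_y: "(\<Prod>i<CARD('p). (\<sigma> ^^ i) y) = t ^ CARD('p)"
  proof -
    let ?e = "of_nat (\<Sum>i<CARD('p). i) * \<beta> \<sigma>"
    \<comment> \<open>In \<open>xn\<close> the multiple of \<open>x \<sigma>\<close> vanishes modulo
      p, so the remaining quotient of conjugates of \<open>z\<close> is again
      \<open>root_pow \<zeta> ?e\<close>. The two copies multiply to 1, also for p = 2.\<close>
    have "\<sigma> ^^ CARD('p) \<in> N" using \<chi>_funpow[OF \<sigma>(1), of "CARD('p)"] by (simp add: N_def)
    then have "(\<sigma> ^^ CARD('p)) z = root_pow \<zeta> ?e * z" by (simp add: z(2) xn)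
    moreover have "root_pow \<zeta> ?e * root_pow \<zeta> ?e = 1"
      by (simp only: rp[symmetric] distrib_right[symmetric] of_nat_twice_sum_lessThan_card mult_zero_left root_pow_0)
    ultimately show ?thesis using z(1) unfolding prod_y by (simp add: algebra_simps)
  qed
  interpret M: discrete_module H "subtopology (krull_topology \<iota>) U" "\<lambda>\<sigma> a :: 'p mod_ring. a"
    by (rule discrete_module.submodule[OF trivial_discrete_module U])
  have "(\<Sum>C\<in>lcosets\<^bsub>H\<^esub> N. \<phi> (inv\<^bsub>H\<^esub> (r (g <#\<^bsub>H\<^esub> C)) \<otimes>\<^bsub>H\<^esub> g \<otimes>\<^bsub>H\<^esub> r C)) = \<beta> g"
    if r: "\<forall>C\<in>lcosets\<^bsub>H\<^esub> N. r C \<in> C" and g: "g \<in> U" for r g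
  proof -
    note Nr = subgroup_N_H openin_N finite_lcosets r
    have gH: "g \<in> carrier H" using g by simp
    have rU: "r C \<in> U" if "C \<in> lcosets\<^bsub>H\<^esub> N" for C using M.r_carrier[OF Nr that] by simp
    define u where "u C = inv\<^bsub>H\<^esub> (r (g <#\<^bsub>H\<^esub> C)) \<otimes>\<^bsub>H\<^esub> g \<otimes>\<^bsub>H\<^esub> r C" for C
    have u: "u C \<in> N" "r (g <#\<^bsub>H\<^esub> C) \<circ> u C = g \<circ> r C" if C: "C \<in> lcosets\<^bsub>H\<^esub> N" for C
      using M.fac_mem[OF Nr gH C] M.r_fac[OF Nr gH C] unfolding u_def M.fac_def[OF Nr] by simp_all
    \<comment> \<open>The norm of \<open>s\<close>. Its p-th power is the norm of \<open>y\<close>,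
      that is \<open>t ^ CARD('p)\<close>; so \<open>P\<close> and \<open>t\<close> differ by a p-th
      root of unity fixed by \<open>U\<close> and have the same Kummer character \<beta>.\<close>
    define P where "P = (\<Prod>C\<in>lcosets\<^bsub>H\<^esub> N. r C s)"
    have P0: "P \<noteq> 0"
      using finite_lcosets s(2) by (simp add: P_def Gal_elem_eq_0_iff[OF UG(1)[OF rU]])
    have "P ^ CARD('p) = (\<Prod>C\<in>lcosets\<^bsub>H\<^esub> N. r C y)"
      unfolding P_def prod_power_distrib by (intro prod.cong refl) (simp add: GE[OF rU] flip: s(1))
    then have "P ^ CARD('p) = t ^ CARD('p)" using norm_eq[OF r yN \<sigma>] norm_y by simp
    then have "(P / t) ^ CARD('p) = 1" using t(1) by (simp add: power_divide)
    then obtain k :: "'p mod_ring" where "P / t = root_pow \<zeta> k"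
      by (rule root_of_unity_root_pow[OF \<zeta>(1,2)])
    then have P: "P = root_pow \<zeta> k * t" using t(1) by (simp add: field_simps)
    \<comment> \<open>\<open>g\<close> carries the factor of a coset to the factor of its translate,
      up to the element \<open>u C\<close> of \<open>N\<close>, which acts on \<open>s\<close>
      through \<phi>. The exponents add up to the transfer of \<phi>.\<close>
    have "g P = (\<Prod>C\<in>lcosets\<^bsub>H\<^esub> N. g (r C s))"
      by (simp add: P_def Gal_elem_prod[OF UG(1)[OF g]])
    also have "\<dots> = (\<Prod>C\<in>lcosets\<^bsub>H\<^esub> N. root_pow \<zeta> (\<phi> (u C)) * r (g <#\<^bsub>H\<^esub> C) s)"
    proof (rule prod.cong[OF refl])
      fix C assume C: "C \<in> lcosets\<^bsub>H\<^esub> N"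
      have gC: "r (g <#\<^bsub>H\<^esub> C) \<in> U" using rU M.lcosets_closed[OF subgroup_N_H gH C] by blast
      have "g (r C s) = r (g <#\<^bsub>H\<^esub> C) (u C s)" using fun_cong[OF u(2)[OF C], of s] by simp
      then show "g (r C s) = root_pow \<zeta> (\<phi> (u C)) * r (g <#\<^bsub>H\<^esub> C) s"
        by (simp only: \<phi>(1)[OF u(1)[OF C]] GE[OF gC])
    qed
    also have "\<dots> = root_pow \<zeta> (\<Sum>C\<in>lcosets\<^bsub>H\<^esub> N. \<phi> (u C)) * (\<Prod>C\<in>lcosets\<^bsub>H\<^esub> N. r (g <#\<^bsub>H\<^esub> C) s)"
      by (simp add: prod.distrib root_pow_sum[OF \<zeta>(1)])
    also have "(\<Prod>C\<in>lcosets\<^bsub>H\<^esub> N. r (g <#\<^bsub>H\<^esub> C) s) = P"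
      unfolding P_def by (rule prod.reindex_bij_betw[OF M.lcosets_bij[OF subgroup_N_H gH]])
    finally have "g P = root_pow \<zeta> (\<Sum>C\<in>lcosets\<^bsub>H\<^esub> N. \<phi> (u C)) * P" .
    moreover have "g P = root_pow \<zeta> (\<beta> g) * P" by (simp add: P GE[OF g] t(2)[OF g])
    ultimately show ?thesis using P0 root_pow_inj[OF \<zeta>(1,2)] by (simp add: u_def)
  qed
  with \<phi>(2,3) show ?thesis using that by blast
qed

end

section \<open>Orbits, cosets and corestriction\<close>

lemma (in group) stabilizer_subgroupI:
  assumes one: "\<phi> \<one> x = x"
    and mult: "\<And>g h. g \<in> carrier G \<Longrightarrow> h \<in> carrier G \<Longrightarrow> \<phi> (g \<otimes> h) x = \<phi> g (\<phi> h x)"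
  shows "subgroup (stabilizer G \<phi> x) G"
proof (rule subgroupI)
  show "stabilizer G \<phi> x \<noteq> {}" using one by (auto simp: stabilizer_def)
  fix g assume g: "g \<in> stabilizer G \<phi> x"
  then have "\<phi> (inv g) x = \<phi> (inv g) (\<phi> g x)" by (simp add: stabilizer_def)
  also have "\<dots> = x" using g mult[of "inv g" g] one by (simp add: stabilizer_def)
  finally show "inv g \<in> stabilizer G \<phi> x" using g by (simp add: stabilizer_def)
qed (auto simp: stabilizer_def mult)

lemma (in group) lcosets_some_mem:
  assumes "subgroup U G"
  shows "\<forall>C\<in>lcosets U. (SOME t. t \<in> C) \<in> C"
proof
  fix C assume "C \<in> lcosets U"
  then obtain a where a: "a \<in> carrier G" "C = a <# U" by (auto simp: LCOSETS_def)
  have "a \<in> C" unfolding a(2) by (rule lcos_self[OF a(1) assms])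
  then show "(SOME t. t \<in> C) \<in> C" by (rule someI[of "\<lambda>t. t \<in> C"])
qed

text \<open>A coset of the stabilizer is a fibre of the orbit map. This turns the sum over cosets in
  a corestriction into a sum over an orbit, and the index of a stabilizer into the size of an
  orbit.\<close>

lemma (in group) lcosets_orbit_bij:
  assumes one: "\<phi> \<one> x = x"
    and mult: "\<And>g h. g \<in> carrier G \<Longrightarrow> h \<in> carrier G \<Longrightarrow> \<phi> (g \<otimes> h) x = \<phi> g (\<phi> h x)"
    and r: "\<forall>C\<in>lcosets (stabilizer G \<phi> x). r C \<in> C"
  shows "bij_betw (\<lambda>C. \<phi> (r C) x) (lcosets (stabilizer G \<phi> x)) (orbit G \<phi> x)"
proof -
  let ?S = "stabilizer G \<phi> x"
  have S: "subgroup ?S G" by (rule stabilizer_subgroupI[OF one mult])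
  have lcos: "a <# ?S = {g \<in> carrier G. \<phi> g x = \<phi> a x}" if a: "a \<in> carrier G" for a
  proof
    show "a <# ?S \<subseteq> {g \<in> carrier G. \<phi> g x = \<phi> a x}"
      using a by (auto simp: l_coset_def stabilizer_def mult)
    show "{g \<in> carrier G. \<phi> g x = \<phi> a x} \<subseteq> a <# ?S"
    proof
      fix g assume g: "g \<in> {g \<in> carrier G. \<phi> g x = \<phi> a x}"
      have "\<phi> (inv a \<otimes> g) x = \<phi> (inv a \<otimes> a) x" using a g mult[of "inv a" g] mult[of "inv a" a] by simp
      then have "inv a \<otimes> g \<in> ?S" using a g one by (simp add: stabilizer_def)
      then show "g \<in> a <# ?S" using subgroup.lcos_module_rev[OF S is_group a] g by simp
    qed
  qed
  have C: "C = {g \<in> carrier G. \<phi> g x = \<phi> (r C) x}" if "C \<in> lcosets ?S" for C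
  proof -
    obtain a where a: "a \<in> carrier G" "C = a <# ?S" using \<open>C \<in> lcosets ?S\<close> by (auto simp: LCOSETS_def)
    have "r C \<in> C" using r that by blast
    then show ?thesis using lcos[OF a(1)] a(2) by auto
  qed
  show ?thesis
  proof (rule bij_betw_imageI)
    show "inj_on (\<lambda>C. \<phi> (r C) x) (lcosets ?S)" using C by (intro inj_onI) metis
    show "(\<lambda>C. \<phi> (r C) x) ` (lcosets ?S) = orbit G \<phi> x"
    proof
      show "(\<lambda>C. \<phi> (r C) x) ` (lcosets ?S) \<subseteq> orbit G \<phi> x"
        using C r by (fastforce simp: orbit_def)
      show "orbit G \<phi> x \<subseteq> (\<lambda>C. \<phi> (r C) x) ` (lcosets ?S)"
      proof
        fix y assume "y \<in> orbit G \<phi> x"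
        then obtain g where g: "g \<in> carrier G" "y = \<phi> g x" by (auto simp: orbit_def)
        have gS: "g <# ?S \<in> lcosets ?S" using g(1) by (auto simp: LCOSETS_def)
        then have "r (g <# ?S) \<in> g <# ?S" using r by blast
        then have "y = \<phi> (r (g <# ?S)) x" using lcos[OF g(1)] g(2) by simp
        with gS show "y \<in> (\<lambda>C. \<phi> (r C) x) ` (lcosets ?S)" by blast
      qed
    qed
  qed
qed

lemma (in group) orbit_eq:
  assumes mult: "\<And>g h. g \<in> carrier G \<Longrightarrow> h \<in> carrier G \<Longrightarrow> \<phi> (g \<otimes> h) x = \<phi> g (\<phi> h x)"
    and y: "y \<in> orbit G \<phi> x"
  shows "orbit G \<phi> y = orbit G \<phi> x"
proof -
  obtain h where h: "h \<in> carrier G" "y = \<phi> h x" using y by (auto simp: orbit_def)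
  have "orbit G \<phi> y \<subseteq> orbit G \<phi> x"
  proof
    fix z assume "z \<in> orbit G \<phi> y"
    then obtain g where "g \<in> carrier G" "z = \<phi> g y" by (auto simp: orbit_def)
    then have "g \<otimes> h \<in> carrier G" "z = \<phi> (g \<otimes> h) x" using h mult by auto
    then show "z \<in> orbit G \<phi> x" by (auto simp: orbit_def)
  qed
  moreover have "orbit G \<phi> x \<subseteq> orbit G \<phi> y"
  proof
    fix z assume "z \<in> orbit G \<phi> x"
    then obtain g where g: "g \<in> carrier G" "z = \<phi> g x" by (auto simp: orbit_def)
    have "\<phi> (g \<otimes> inv h \<otimes> h) x = \<phi> (g \<otimes> inv h) y" using g h mult by simp
    then have "g \<otimes> inv h \<in> carrier G" "z = \<phi> (g \<otimes> inv h) y" using g h by (simp_all add: m_assoc)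
    then show "z \<in> orbit G \<phi> y" by (auto simp: orbit_def)
  qed
  ultimately show ?thesis by blast
qed

text \<open>The orbits partition \<open>X\<close>. The stabilizer of the point found has index not
  divisible by \<open>p\<close>.\<close>

lemma (in group) orbit_not_dvd:
  assumes fin: "finite X" and closed: "\<And>g x. g \<in> carrier G \<Longrightarrow> x \<in> X \<Longrightarrow> \<phi> g x \<in> X"
    and one: "\<And>x. x \<in> X \<Longrightarrow> \<phi> \<one> x = x"
    and mult: "\<And>g h x. g \<in> carrier G \<Longrightarrow> h \<in> carrier G \<Longrightarrow> x \<in> X \<Longrightarrow> \<phi> (g \<otimes> h) x = \<phi> g (\<phi> h x)"
    and "\<not> p dvd card X"
  obtains x where "x \<in> X" "\<not> p dvd card (orbit G \<phi> x)"
proof (rule ccontr)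
  assume "\<not> thesis"
  then have dvd: "p dvd card (orbit G \<phi> x)" if "x \<in> X" for x using that \<open>\<And>x. x \<in> X \<Longrightarrow> \<not> p dvd card (orbit G \<phi> x) \<Longrightarrow> thesis\<close> by blast
  have sub: "orbit G \<phi> x \<subseteq> X" if "x \<in> X" for x using closed that by (auto simp: orbit_def)
  have self: "x \<in> orbit G \<phi> x" if "x \<in> X" for x using one[OF that] by (force simp: orbit_def)
  have tr: "orbit G \<phi> y = orbit G \<phi> x" if x: "x \<in> X" and y: "y \<in> orbit G \<phi> x" for x y
    by (rule orbit_eq[OF mult[OF _ _ x] y])
  have U: "\<Union>(orbit G \<phi> ` X) = X" using sub self by blast
  have "p dvd card (\<Union>(orbit G \<phi> ` X))"
  proof (rule dvd_partition)
    show "\<forall>c1\<in>orbit G \<phi> ` X. \<forall>c2\<in>orbit G \<phi> ` X. c1 \<noteq> c2 \<longrightarrow> c1 \<inter> c2 = {}" using tr by blast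
  qed (use fin dvd U in auto)
  then show False using U assms(5) by simp
qed

context discrete_module
begin

lemma Z1_mult: "c \<in> carrier (Z1 G T \<rho>) \<Longrightarrow> g \<in> carrier G \<Longrightarrow> h \<in> carrier G \<Longrightarrow> c (g \<otimes> h) = c g + \<rho> g (c h)"
  by (simp add: Z1_def)

lemma Z1_continuous: "c \<in> carrier (Z1 G T \<rho>) \<Longrightarrow> continuous_map T (discrete_topology UNIV) c"
  by (simp add: Z1_def)

lemma Z1_restrictI:
  assumes "continuous_map T (discrete_topology UNIV) c"
    and "\<And>g h. g \<in> carrier G \<Longrightarrow> h \<in> carrier G \<Longrightarrow> c (g \<otimes> h) = c g + \<rho> g (c h)"
  shows "restrict c (carrier G) \<in> carrier (Z1 G T \<rho>)"
  unfolding Z1_iff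
  using assms continuous_map_discrete_combine[OF assms(1,1), of "restrict c (carrier G)" "\<lambda>a _. a"]
  by (simp add: topspace_eq)

text \<open>Corestriction after restriction is multiplication by the index, here on cochains and
  with its explicit coboundary: \<open>M\<close> is the sum of \<open>c\<close> over the
  representatives.\<close>

lemma cor_restriction:
  assumes U: "subgroup U G" and openU: "openin T U" and finU: "finite (lcosets U)"
    and r: "\<forall>C\<in>lcosets U. r C \<in> C"
    and c: "c \<in> carrier (Z1 G T \<rho>)" and d: "\<And>u. u \<in> U \<Longrightarrow> d u = c u" and g: "g \<in> carrier G"
  defines "M \<equiv> (\<Sum>C\<in>lcosets U. c (r C))"
  shows "cor_cochain G U \<rho> r d g = (\<Sum>C\<in>lcosets U. c g) + (\<rho> g M - M)"
proof -
  note Ur = U openU finU r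
  have "cor_cochain G U \<rho> r d g = (\<Sum>C\<in>lcosets U. c g + \<rho> g (c (r C)) - c (r (g <# C)))"
    unfolding cor_eq[OF Ur g]
  proof (rule sum.cong[OF refl])
    fix C assume C: "C \<in> lcosets U"
    have gC: "g <# C \<in> lcosets U" by (rule lcosets_closed[OF U g C])
    have car: "r C \<in> carrier G" "r (g <# C) \<in> carrier G" "fac r g C \<in> carrier G"
      using r_carrier[OF Ur C] r_carrier[OF Ur gC] subgroup.mem_carrier[OF U fac_mem[OF Ur g C]] .
    \<comment> \<open>The value of \<open>c\<close> at
      \<open>r (g <# C) \<otimes> fac r g C = g \<otimes> r C\<close>, expanded in two ways by the
      cocycle identity.\<close>
    have "c (r (g <# C)) + \<rho> (r (g <# C)) (c (fac r g C)) = c g + \<rho> g (c (r C))"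
      using Z1_mult[OF c car(2,3)] Z1_mult[OF c g car(1)] r_fac[OF Ur g C] by simp
    then show "\<rho> (r (g <# C)) (d (fac r g C)) = c g + \<rho> g (c (r C)) - c (r (g <# C))"
      by (simp add: d[OF fac_mem[OF Ur g C]] algebra_simps)
  qed
  also have "\<dots> = (\<Sum>C\<in>lcosets U. c g) + \<rho> g M - (\<Sum>C\<in>lcosets U. c (r (g <# C)))"
    by (simp add: sum.distrib sum_subtractf M_def act_sum[OF g])
  also have "(\<Sum>C\<in>lcosets U. c (r (g <# C))) = M"
    unfolding M_def by (rule sum.reindex_bij_betw[OF lcosets_bij[OF U g]])
  finally show ?thesis by simp
qed

lemma H1_class_mult:
  assumes "c \<in> carrier (Z1 G T \<rho>)" "d \<in> carrier (Z1 G T \<rho>)"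
  shows "H1_class G T \<rho> c \<otimes>\<^bsub>H1 G T \<rho>\<^esub> H1_class G T \<rho> d = H1_class G T \<rho> (\<lambda>g\<in>carrier G. c g + d g)"
    and "(\<lambda>g\<in>carrier G. c g + d g) \<in> carrier (Z1 G T \<rho>)"
proof -
  interpret Z: comm_group "Z1 G T \<rho>" by (rule comm_group_Z1)
  have m: "c \<otimes>\<^bsub>Z1 G T \<rho>\<^esub> d = (\<lambda>g\<in>carrier G. c g + d g)" by (simp add: Z1_def)
  show "H1_class G T \<rho> c \<otimes>\<^bsub>H1 G T \<rho>\<^esub> H1_class G T \<rho> d = H1_class G T \<rho> (\<lambda>g\<in>carrier G. c g + d g)"
    using normal.rcos_sum[OF normal_B1 assms] by (simp add: H1_def FactGroup_def H1_class_def m)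
  show "(\<lambda>g\<in>carrier G. c g + d g) \<in> carrier (Z1 G T \<rho>)"
    using Z.m_closed[OF assms] by (simp only: m)
qed

lemma H1_class_finprod:
  assumes "finite A" "\<And>i. i \<in> A \<Longrightarrow> c i \<in> carrier (Z1 G T \<rho>)"
  shows "finprod (H1 G T \<rho>) (\<lambda>i. H1_class G T \<rho> (c i)) A = H1_class G T \<rho> (\<lambda>g\<in>carrier G. \<Sum>i\<in>A. c i g)
    \<and> (\<lambda>g\<in>carrier G. \<Sum>i\<in>A. c i g) \<in> carrier (Z1 G T \<rho>)"
  using assms
proof (induction A rule: finite_induct)
  case empty
  interpret Z: comm_group "Z1 G T \<rho>" by (rule comm_group_Z1)
  interpret H: comm_group "H1 G T \<rho>" by (rule comm_group_H1)
  have one: "(\<lambda>g\<in>carrier G. \<Sum>i\<in>{}. c i g) = \<one>\<^bsub>Z1 G T \<rho>\<^esub>" by (simp add: Z1_def)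
  have "H1_class G T \<rho> \<one>\<^bsub>Z1 G T \<rho>\<^esub> = B1 G \<rho>"
    unfolding H1_class_def by (rule Z.coset_mult_one[OF subgroup.subset[OF subgroup_B1]])
  moreover have "\<one>\<^bsub>H1 G T \<rho>\<^esub> = B1 G \<rho>" by (simp add: H1_def FactGroup_def)
  ultimately show ?case unfolding one H.finprod_empty using Z.one_closed by blast
next
  case (insert i A)
  interpret H: comm_group "H1 G T \<rho>" by (rule comm_group_H1)
  have cl: "H1_class G T \<rho> (c j) \<in> carrier (H1 G T \<rho>)" if "j \<in> insert i A" for j
    using insert.prems[OF that] by (simp add: carrier_H1)
  have ci: "c i \<in> carrier (Z1 G T \<rho>)" using insert.prems by blast
  have "finprod (H1 G T \<rho>) (\<lambda>i. H1_class G T \<rho> (c i)) A = H1_class G T \<rho> (\<lambda>g\<in>carrier G. \<Sum>i\<in>A. c i g)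
    \<and> (\<lambda>g\<in>carrier G. \<Sum>i\<in>A. c i g) \<in> carrier (Z1 G T \<rho>)"
    by (rule insert.IH) (use insert.prems in blast)
  note IH = this[THEN conjunct1] this[THEN conjunct2]
  have eq: "(\<lambda>g\<in>carrier G. c i g + (\<lambda>g\<in>carrier G. \<Sum>i\<in>A. c i g) g) = (\<lambda>g\<in>carrier G. \<Sum>i\<in>insert i A. c i g)"
    using insert.hyps by (intro restrict_ext) simp
  have "finprod (H1 G T \<rho>) (\<lambda>i. H1_class G T \<rho> (c i)) (insert i A)
      = H1_class G T \<rho> (c i) \<otimes>\<^bsub>H1 G T \<rho>\<^esub> finprod (H1 G T \<rho>) (\<lambda>i. H1_class G T \<rho> (c i)) A"
    using cl insert.hyps by (intro H.finprod_insert) auto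
  then show ?case using H1_class_mult[OF ci IH(2)] unfolding IH(1) eq by (simp only: simp_thms)
qed

end

section \<open>Lifting to the permutation module\<close>

locale mod_p_representation =
  fixes \<iota> :: "'f::field \<Rightarrow> 'l::field"
    and scale :: "'p::prime_card mod_ring \<Rightarrow> 'v::ab_group_add \<Rightarrow> 'v"
    and \<rho> :: "('l \<Rightarrow> 'l) \<Rightarrow> 'v \<Rightarrow> 'v"
  assumes rep: "galois_representation \<iota> scale \<rho>"
begin

sublocale V: discrete_module "Gal \<iota>" "krull_topology \<iota>" \<rho>
  by (rule galois_representation_discrete_module[OF rep])

sublocale vector_space scale
  using rep unfolding galois_representation_def finite_dimensional_vector_space_def by blast

lemma finite_V: "finite (A :: 'v set)"
  by (rule finite_subset[OF subset_UNIV galois_representation_finite_UNIV[OF rep]])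

lemma act_scale: "g \<in> carrier (Gal \<iota>) \<Longrightarrow> \<rho> g (scale a v) = scale a (\<rho> g v)"
proof -
  assume "g \<in> carrier (Gal \<iota>)"
  then interpret L: Vector_Spaces.linear scale scale "\<rho> g"
    using rep by (simp add: galois_representation_def)
  show ?thesis by (rule L.scale)
qed

lemma act_inv:
  assumes "g \<in> carrier (Gal \<iota>)"
  shows "\<rho> (inv\<^bsub>Gal \<iota>\<^esub> g) (\<rho> g v) = v" "\<rho> g (\<rho> (inv\<^bsub>Gal \<iota>\<^esub> g) v) = v"
proof -
  have "\<rho> (inv\<^bsub>Gal \<iota>\<^esub> g \<otimes>\<^bsub>Gal \<iota>\<^esub> g) v = v" "\<rho> (g \<otimes>\<^bsub>Gal \<iota>\<^esub> inv\<^bsub>Gal \<iota>\<^esub> g) v = v"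
    unfolding V.l_inv[OF assms] V.r_inv[OF assms] by (rule V.act_one)+
  then show "\<rho> (inv\<^bsub>Gal \<iota>\<^esub> g) (\<rho> g v) = v" "\<rho> g (\<rho> (inv\<^bsub>Gal \<iota>\<^esub> g) v) = v"
    by (simp_all only: V.act_mult V.inv_closed assms)
qed

lemma act_bij: "g \<in> carrier (Gal \<iota>) \<Longrightarrow> bij (\<rho> g)"
  by (rule o_bij[where g = "\<rho> (inv\<^bsub>Gal \<iota>\<^esub> g)"]) (simp_all add: fun_eq_iff act_inv)

text \<open>The functions \<open>'v \<Rightarrow> 'p mod_ring\<close> represent the permutation module on the set \<^typ>\<open>'v\<close>.\<close>

definition perm :: "('l \<Rightarrow> 'l) \<Rightarrow> ('v \<Rightarrow> 'p mod_ring) \<Rightarrow> 'v \<Rightarrow> 'p mod_ring" where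
  "perm g A = (\<lambda>v. A (\<rho> (inv\<^bsub>Gal \<iota>\<^esub> g) v))"

text \<open>A function \<open>A\<close> stands for the formal sum of the basis elements [v] with
  coefficients \<open>A v\<close>. Then \<open>realize\<close> is the equivariant surjection from
  F_p[V] to V sending [v] to v, and \<open>delta v a\<close> is a times [v].\<close>

definition realize :: "('v \<Rightarrow> 'p mod_ring) \<Rightarrow> 'v" where
  "realize A = (\<Sum>v\<in>UNIV. scale (A v) v)"

definition delta :: "'v \<Rightarrow> 'p mod_ring \<Rightarrow> 'v \<Rightarrow> 'p mod_ring" where
  "delta v a = (\<lambda>w. if w = v then a else 0)"

sublocale P: discrete_module "Gal \<iota>" "krull_topology \<iota>" perm
proof unfold_locales
  show "topspace (krull_topology \<iota>) = carrier (Gal \<iota>)" by simp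
  show "continuous_map (krull_topology \<iota>) (krull_topology \<iota>) (\<lambda>g. a \<otimes>\<^bsub>Gal \<iota>\<^esub> g \<otimes>\<^bsub>Gal \<iota>\<^esub> b)"
    if "a \<in> carrier (Gal \<iota>)" "b \<in> carrier (Gal \<iota>)" for a b by (rule krull_translation[OF that])
  show "perm \<one>\<^bsub>Gal \<iota>\<^esub> A = A" for A unfolding perm_def V.inv_one V.act_one ..
  show "perm (g \<otimes>\<^bsub>Gal \<iota>\<^esub> h) A = perm g (perm h A)" if "g \<in> carrier (Gal \<iota>)" "h \<in> carrier (Gal \<iota>)" for g h A
    unfolding perm_def V.inv_mult_group[OF that] using that by (simp only: V.act_mult V.inv_closed)
  show "perm g (A + B) = perm g A + perm g B" for g A B by (simp add: perm_def fun_eq_iff)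
  have cont: "continuous_map (krull_topology \<iota>) (discrete_topology UNIV) \<rho>"
    using rep by (simp add: galois_representation_def)
  show "continuous_map (krull_topology \<iota>) (discrete_topology UNIV) (\<lambda>g. perm g A)" for A
  \<comment> \<open>\<open>perm g\<close> depends on \<open>g\<close> only through the map
    \<open>\<rho> g\<close>, which is locally constant in \<open>g\<close>; to show this, the action
    of the inverse of \<open>g\<close> is written as the inverse function of
    \<open>\<rho> g\<close>.\<close>
  proof (rule continuous_map_discrete_combine[OF cont cont, where F = "\<lambda>f _ v. A (Hilbert_Choice.inv f v)"])
    fix g assume "g \<in> topspace (krull_topology \<iota>)"
    then have g: "g \<in> carrier (Gal \<iota>)" by simp
    have "Hilbert_Choice.inv (\<rho> g) v = \<rho> (inv\<^bsub>Gal \<iota>\<^esub> g) v" for v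
      by (rule inv_f_eq[OF bij_is_inj[OF act_bij[OF g]] act_inv(2)[OF g]])
    then show "perm g A = (\<lambda>v. A (Hilbert_Choice.inv (\<rho> g) v))" by (simp add: perm_def)
  qed
qed

lemma perm_act: "g \<in> carrier (Gal \<iota>) \<Longrightarrow> perm g A (\<rho> g v) = A v"
  by (simp add: perm_def act_inv)

lemma realize_add: "realize (A + B) = realize A + realize B"
  by (simp add: realize_def scale_left_distrib sum.distrib)

lemma realize_sum: "realize (sum f I) = (\<Sum>i\<in>I. realize (f i))"
proof -
  have "realize 0 = 0" by (simp add: realize_def)
  then show ?thesis by (induction I rule: infinite_finite_induct) (simp_all add: realize_add)
qed

lemma realize_scale: "realize (\<lambda>v. a * A v) = scale a (realize A)"
  by (simp add: realize_def scale_sum_right)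

lemma realize_delta: "realize (delta v a) = scale a v"
proof -
  have "realize (delta v a) = (\<Sum>w\<in>UNIV. if w = v then scale a v else 0)"
    unfolding realize_def delta_def by (intro sum.cong) auto
  then show ?thesis using finite_V by (simp add: sum.delta)
qed

lemma realize_perm:
  assumes g: "g \<in> carrier (Gal \<iota>)"
  shows "realize (perm g A) = \<rho> g (realize A)"
proof -
  have "realize (perm g A) = (\<Sum>v\<in>UNIV. scale (perm g A (\<rho> g v)) (\<rho> g v))"
    unfolding realize_def by (rule sum.reindex_bij_betw[OF act_bij[OF g], symmetric])
  also have "\<dots> = \<rho> g (realize A)"
    by (simp add: realize_def perm_act[OF g] V.act_sum[OF g] act_scale[OF g])
  finally show ?thesis .
qed

lemma delta_add: "delta v (a + b) = delta v a + delta v b"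
  by (simp add: delta_def fun_eq_iff)

lemma perm_delta:
  assumes g: "g \<in> carrier (Gal \<iota>)" "\<rho> g v = v"
  shows "perm g (delta v a) = delta v a"
proof
  fix w
  have "\<rho> (inv\<^bsub>Gal \<iota>\<^esub> g) w = v \<longleftrightarrow> w = v" using act_inv[OF g(1)] g(2) by metis
  then show "perm g (delta v a) w = delta v a w" by (simp add: perm_def delta_def)
qed

text \<open>Shapiro's lemma made explicit: on the stabilizer of \<open>w\<close> the component of
  \<open>a\<close> at \<open>w\<close> is a character, and its corestriction recovers, up to a
  coboundary, the part of \<open>realize (a g)\<close> supported on the orbit of
  \<open>w\<close>.\<close>

lemma cor_orbit:
  assumes a: "a \<in> carrier (Z1 (Gal \<iota>) (krull_topology \<iota>) perm)"
    and r: "\<forall>C\<in>lcosets\<^bsub>Gal \<iota>\<^esub> (stabilizer (Gal \<iota>) \<rho> w). r C \<in> C"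
    and d: "\<And>u. u \<in> stabilizer (Gal \<iota>) \<rho> w \<Longrightarrow> d u = scale (a u w) w"
  obtains M where "\<And>g. g \<in> carrier (Gal \<iota>) \<Longrightarrow>
    cor_cochain (Gal \<iota>) (stabilizer (Gal \<iota>) \<rho> w) \<rho> r d g =
      (\<Sum>v\<in>orbit (Gal \<iota>) \<rho> w. scale (a g v) v) + (\<rho> g M - M)"
proof
  let ?S = "stabilizer (Gal \<iota>) \<rho> w" and ?G = "Gal \<iota>"
  note S = stabilizer_subgroup[OF rep, of w] stabilizer_open[OF rep, of w] stabilizer_finite_index[OF rep, of w] r
  \<comment> \<open>The part of \<open>realize (a (r C))\<close> at the orbit point
    \<open>\<rho> (r C) w\<close>; summed over all cosets it yields the coboundary.\<close>
  define m where "m C = scale (a (r C) (\<rho> (r C) w)) (\<rho> (r C) w)" for C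
  let ?M = "\<Sum>C\<in>lcosets\<^bsub>?G\<^esub> ?S. m C"
  fix g assume g: "g \<in> carrier ?G"
  have "cor_cochain ?G ?S \<rho> r d g = (\<Sum>C\<in>lcosets\<^bsub>?G\<^esub> ?S.
      scale (a g (\<rho> (r (g <#\<^bsub>?G\<^esub> C)) w)) (\<rho> (r (g <#\<^bsub>?G\<^esub> C)) w) + \<rho> g (m C) - m (g <#\<^bsub>?G\<^esub> C))"
    unfolding V.cor_eq[OF S g]
  proof (rule sum.cong[OF refl])
    fix C assume C: "C \<in> lcosets\<^bsub>?G\<^esub> ?S"
    define s where "s = r C"
    define t where "t = r (g <#\<^bsub>?G\<^esub> C)"
    define u where "u = V.fac r g C"
    have u: "u \<in> ?S" unfolding u_def by (rule V.fac_mem[OF S g C])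
    have s: "s \<in> carrier ?G" and t: "t \<in> carrier ?G" and uG: "u \<in> carrier ?G"
      unfolding s_def t_def using V.r_carrier[OF S] C V.lcosets_closed[OF S(1) g C] u
      by (auto simp: stabilizer_def)
    have tu: "t \<otimes>\<^bsub>?G\<^esub> u = g \<otimes>\<^bsub>?G\<^esub> s" unfolding s_def t_def u_def by (rule V.r_fac[OF S g C])
    have uw: "\<rho> u w = w" using u by (simp add: stabilizer_def)
    have tw: "\<rho> t w = \<rho> g (\<rho> s w)"
      using V.act_mult[OF t uG, of w] V.act_mult[OF g s, of w] unfolding tu uw by simp
    \<comment> \<open>The cocycle identity for the two factorizations in \<open>tu\<close>, read off
      in the component at \<open>\<rho> t w\<close>, where the translated terms become the
      components of \<open>a u\<close> at \<open>w\<close> and of \<open>a s\<close> at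
      \<open>\<rho> s w\<close>.\<close>
    have "a t (\<rho> t w) + perm t (a u) (\<rho> t w) = a g (\<rho> t w) + perm g (a s) (\<rho> t w)"
      using P.Z1_mult[OF a t uG] P.Z1_mult[OF a g s] unfolding tu by (metis plus_fun_apply)
    then have "a t (\<rho> t w) + a u w = a g (\<rho> t w) + a s (\<rho> s w)"
      by (simp only: perm_act[OF t]) (simp only: tw perm_act[OF g])
    then have au: "a u w = a g (\<rho> t w) + a s (\<rho> s w) - a t (\<rho> t w)" by (simp add: algebra_simps)
    have "\<rho> t (d u) = scale (a u w) (\<rho> t w)" by (simp add: d[OF u] act_scale[OF t])
    also have "\<dots> = scale (a g (\<rho> t w)) (\<rho> t w) + scale (a s (\<rho> s w)) (\<rho> t w) - scale (a t (\<rho> t w)) (\<rho> t w)"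
      by (simp only: au scale_left_diff_distrib scale_left_distrib)
    also have "scale (a s (\<rho> s w)) (\<rho> t w) = \<rho> g (m C)"
      by (simp add: m_def act_scale[OF g] tw flip: s_def)
    finally show "\<rho> t (d u) = scale (a g (\<rho> t w)) (\<rho> t w) + \<rho> g (m C) - m (g <#\<^bsub>?G\<^esub> C)"
      by (simp add: m_def flip: t_def)
  qed
  also have "\<dots> = (\<Sum>C\<in>lcosets\<^bsub>?G\<^esub> ?S. scale (a g (\<rho> (r (g <#\<^bsub>?G\<^esub> C)) w)) (\<rho> (r (g <#\<^bsub>?G\<^esub> C)) w))
      + \<rho> g ?M - (\<Sum>C\<in>lcosets\<^bsub>?G\<^esub> ?S. m (g <#\<^bsub>?G\<^esub> C))"
    by (simp only: sum.distrib sum_subtractf V.act_sum[OF g])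
  also have "(\<Sum>C\<in>lcosets\<^bsub>?G\<^esub> ?S. m (g <#\<^bsub>?G\<^esub> C)) = ?M"
    by (rule sum.reindex_bij_betw[OF V.lcosets_bij[OF S(1) g]])
  also have "(\<Sum>C\<in>lcosets\<^bsub>?G\<^esub> ?S. scale (a g (\<rho> (r (g <#\<^bsub>?G\<^esub> C)) w)) (\<rho> (r (g <#\<^bsub>?G\<^esub> C)) w))
      = (\<Sum>C\<in>lcosets\<^bsub>?G\<^esub> ?S. scale (a g (\<rho> (r C) w)) (\<rho> (r C) w))"
    by (rule sum.reindex_bij_betw[OF V.lcosets_bij[OF S(1) g]])
  also have "\<dots> = (\<Sum>v\<in>orbit ?G \<rho> w. scale (a g v) v)"
    by (rule sum.reindex_bij_betw[OF V.lcosets_orbit_bij[OF V.act_one V.act_mult r]])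
  finally show "cor_cochain ?G ?S \<rho> r d g = (\<Sum>v\<in>orbit ?G \<rho> w. scale (a g v) v) + (\<rho> g ?M - ?M)"
    by (simp only: add_diff_eq)
qed

section \<open>The sum of the maps \<open>phi\<close> as a homomorphism\<close>

abbreviation "stab v \<equiv> stabilizer (Gal \<iota>) \<rho> v"
abbreviation "stab_group v \<equiv> Gal \<iota>\<lparr>carrier := stab v\<rparr>"
abbreviation "stab_topology v \<equiv> subtopology (krull_topology \<iota>) (stab v)"
abbreviation "triv \<equiv> (\<lambda>(\<sigma> :: 'l \<Rightarrow> 'l) (a :: 'p mod_ring). a)"

lemmas stab = stabilizer_subgroup[OF rep] stabilizer_open[OF rep] stabilizer_finite_index[OF rep]

lemma stab_trivial_module: "discrete_module (stab_group v) (stab_topology v) triv"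
  by (rule discrete_module.submodule[OF trivial_discrete_module stab(1)])

text \<open>Resolves both occurrences of \<open>the_elem\<close> behind \<open>phi\<close>, so that
  the later arguments can work with cochains.\<close>

lemma phi_H1_class:
  assumes f: "f \<in> carrier (Z1 (stab_group v) (stab_topology v) triv)"
    and r: "\<forall>C\<in>lcosets\<^bsub>Gal \<iota>\<^esub> stab v. r C \<in> C"
  shows "phi \<iota> scale \<rho> v (H1_class (stab_group v) (stab_topology v) triv f) =
      H1_class (Gal \<iota>) (krull_topology \<iota>) \<rho> (cor_cochain (Gal \<iota>) (stab v) \<rho> r (\<lambda>u\<in>stab v. scale (f u) v))"
    and "cor_cochain (Gal \<iota>) (stab v) \<rho> r (\<lambda>u\<in>stab v. scale (f u) v) \<in> carrier (Z1 (Gal \<iota>) (krull_topology \<iota>) \<rho>)"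
proof -
  have equiv: "scale m v = \<rho> g (scale m v)" if "g \<in> carrier (stab_group v)" for g m
    using that by (simp add: stabilizer_def act_scale)
  let ?d = "\<lambda>u\<in>stab v. scale (f u) v"
  note args = stab_trivial_module V.submodule[OF stab(1)] scale_left_distrib equiv f
  have res: "(\<lambda>g\<in>carrier (stab_group v). scale (f g) v) = ?d" by simp
  have Z: "?d \<in> carrier (Z1 (stab_group v) (stab_topology v) \<rho>)"
    by (rule H1_map_H1_class(1)[where f = "\<lambda>a. scale a v" and G = "stab_group v" and \<rho>N = \<rho> and \<rho>M = triv,
          OF args, unfolded res])
  have "H1_map (stab_group v) (stab_topology v) \<rho> (\<lambda>a. scale a v) (H1_class (stab_group v) (stab_topology v) triv f) =
      H1_class (stab_group v) (stab_topology v) \<rho> ?d"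
    by (rule H1_map_H1_class(2)[where f = "\<lambda>a. scale a v" and G = "stab_group v" and \<rho>N = \<rho> and \<rho>M = triv,
          OF args, unfolded res])
  then show "phi \<iota> scale \<rho> v (H1_class (stab_group v) (stab_topology v) triv f) =
      H1_class (Gal \<iota>) (krull_topology \<iota>) \<rho> (cor_cochain (Gal \<iota>) (stab v) \<rho> r ?d)"
    unfolding phi_def comp_apply by (simp only: V.corestriction_H1_class[OF stab r Z])
  show "cor_cochain (Gal \<iota>) (stab v) \<rho> r ?d \<in> carrier (Z1 (Gal \<iota>) (krull_topology \<iota>) \<rho>)"
    by (rule V.cor_Z1[OF stab r Z])
qed

lemma phi_hom: "phi \<iota> scale \<rho> v \<in> hom (H1_stab \<iota> \<rho> v triv) (H1 (Gal \<iota>) (krull_topology \<iota>) \<rho>)"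
proof -
  interpret S: discrete_module "stab_group v" "stab_topology v" triv by (rule stab_trivial_module)
  let ?r = "\<lambda>C. SOME t. t \<in> C"
  have r: "\<forall>C\<in>lcosets\<^bsub>Gal \<iota>\<^esub> stab v. ?r C \<in> C" by (rule V.lcosets_some_mem[OF stab(1)])
  show ?thesis unfolding H1_stab_def
  proof (rule homI)
    fix X assume "X \<in> carrier (H1 (stab_group v) (stab_topology v) triv)"
    then obtain f where f: "f \<in> carrier (Z1 (stab_group v) (stab_topology v) triv)"
      "X = H1_class (stab_group v) (stab_topology v) triv f"
      unfolding S.carrier_H1 by blast
    show "phi \<iota> scale \<rho> v X \<in> carrier (H1 (Gal \<iota>) (krull_topology \<iota>) \<rho>)"
      unfolding f(2) phi_H1_class(1)[OF f(1) r] V.carrier_H1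
      by (rule imageI[OF phi_H1_class(2)[OF f(1) r]])
  next
    fix X Y assume "X \<in> carrier (H1 (stab_group v) (stab_topology v) triv)"
      "Y \<in> carrier (H1 (stab_group v) (stab_topology v) triv)"
    then obtain f h where f: "f \<in> carrier (Z1 (stab_group v) (stab_topology v) triv)"
      "X = H1_class (stab_group v) (stab_topology v) triv f"
      and h: "h \<in> carrier (Z1 (stab_group v) (stab_topology v) triv)"
      "Y = H1_class (stab_group v) (stab_topology v) triv h"
      unfolding S.carrier_H1 by blast
    note fh = S.H1_class_mult[OF f(1) h(1)]
    let ?c = "\<lambda>f. cor_cochain (Gal \<iota>) (stab v) \<rho> ?r (\<lambda>u\<in>stab v. scale (f u) v)"
    have eq: "?c (\<lambda>g\<in>carrier (stab_group v). f g + h g) = (\<lambda>g\<in>carrier (Gal \<iota>). ?c f g + ?c h g)"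
    proof
      fix g
      show "?c (\<lambda>g\<in>carrier (stab_group v). f g + h g) g = (\<lambda>g\<in>carrier (Gal \<iota>). ?c f g + ?c h g) g"
      proof (cases "g \<in> carrier (Gal \<iota>)")
        case g: True
        show ?thesis unfolding restrict_apply'[OF g] V.cor_eq[OF stab r g] sum.distrib[symmetric]
        proof (rule sum.cong[OF refl])
          fix C assume C: "C \<in> lcosets\<^bsub>Gal \<iota>\<^esub> stab v"
          have "V.fac ?r g C \<in> stab v" by (rule V.fac_mem[OF stab r g C])
          moreover have "?r (g <#\<^bsub>Gal \<iota>\<^esub> C) \<in> carrier (Gal \<iota>)"
            by (rule V.r_carrier[OF stab r V.lcosets_closed[OF stab(1) g C]])
          ultimately show "\<rho> (?r (g <#\<^bsub>Gal \<iota>\<^esub> C)) ((\<lambda>u\<in>stab v. scale ((\<lambda>g\<in>carrier (stab_group v). f g + h g) u) v) (V.fac ?r g C)) =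
            \<rho> (?r (g <#\<^bsub>Gal \<iota>\<^esub> C)) ((\<lambda>u\<in>stab v. scale (f u) v) (V.fac ?r g C)) +
            \<rho> (?r (g <#\<^bsub>Gal \<iota>\<^esub> C)) ((\<lambda>u\<in>stab v. scale (h u) v) (V.fac ?r g C))"
            by (simp add: scale_left_distrib V.act_add)
        qed
      qed (simp add: cor_cochain_def)
    qed
    show "phi \<iota> scale \<rho> v (X \<otimes>\<^bsub>H1 (stab_group v) (stab_topology v) triv\<^esub> Y) =
      phi \<iota> scale \<rho> v X \<otimes>\<^bsub>H1 (Gal \<iota>) (krull_topology \<iota>) \<rho>\<^esub> phi \<iota> scale \<rho> v Y"
      unfolding f(2) h(2) fh(1) phi_H1_class(1)[OF fh(2) r] phi_H1_class(1)[OF f(1) r] phi_H1_class(1)[OF h(1) r] eq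
      by (rule V.H1_class_mult(1)[OF phi_H1_class(2)[OF f(1) r] phi_H1_class(2)[OF h(1) r], symmetric])
  qed
qed

lemma group_H1_stab: "group (H1_stab \<iota> \<rho> v triv)"
  unfolding H1_stab_def by (rule comm_group.axioms(2)[OF discrete_module.comm_group_H1[OF stab_trivial_module]])

definition sum_phi where
  "sum_phi x = (\<Otimes>\<^bsub>H1 (Gal \<iota>) (krull_topology \<iota>) \<rho>\<^esub>v\<in>UNIV. phi \<iota> scale \<rho> v (x v))"

text \<open>V is finite, so the direct sum agrees with the full product.\<close>

lemma carrier_sum_H1_stab:
  "carrier (sum_group UNIV (\<lambda>v. H1_stab \<iota> \<rho> v triv)) = {x. \<forall>v. x v \<in> carrier (H1_stab \<iota> \<rho> v triv)}"
proof -
  have "finite {v. P v}" for P :: "'v \<Rightarrow> bool" by (rule finite_V)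
  then show ?thesis by (simp add: carrier_sum_group[OF group_H1_stab] PiE_UNIV_domain Pi_def)
qed

lemma sum_phi_hom:
  "sum_phi \<in> hom (sum_group UNIV (\<lambda>v. H1_stab \<iota> \<rho> v triv)) (H1 (Gal \<iota>) (krull_topology \<iota>) \<rho>)"
proof -
  interpret H: comm_group "H1 (Gal \<iota>) (krull_topology \<iota>) \<rho>" by (rule V.comm_group_H1)
  have cl: "(\<lambda>v. phi \<iota> scale \<rho> v (x v)) \<in> UNIV \<rightarrow> carrier (H1 (Gal \<iota>) (krull_topology \<iota>) \<rho>)"
    if "x \<in> carrier (sum_group UNIV (\<lambda>v. H1_stab \<iota> \<rho> v triv))" for x
    using that hom_in_carrier[OF phi_hom] unfolding carrier_sum_H1_stab by blast
  show ?thesis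
  proof (rule homI)
    fix x assume "x \<in> carrier (sum_group UNIV (\<lambda>v. H1_stab \<iota> \<rho> v triv))"
    then show "sum_phi x \<in> carrier (H1 (Gal \<iota>) (krull_topology \<iota>) \<rho>)"
      unfolding sum_phi_def by (intro H.finprod_closed cl)
  next
    fix x y assume x: "x \<in> carrier (sum_group UNIV (\<lambda>v. H1_stab \<iota> \<rho> v triv))"
      and y: "y \<in> carrier (sum_group UNIV (\<lambda>v. H1_stab \<iota> \<rho> v triv))"
    have "phi \<iota> scale \<rho> v (x v \<otimes>\<^bsub>H1_stab \<iota> \<rho> v triv\<^esub> y v) =
        phi \<iota> scale \<rho> v (x v) \<otimes>\<^bsub>H1 (Gal \<iota>) (krull_topology \<iota>) \<rho>\<^esub> phi \<iota> scale \<rho> v (y v)" for v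
      using x y unfolding carrier_sum_H1_stab by (intro hom_mult[OF phi_hom]) auto
    then show "sum_phi (x \<otimes>\<^bsub>sum_group UNIV (\<lambda>v. H1_stab \<iota> \<rho> v triv)\<^esub> y) =
        sum_phi x \<otimes>\<^bsub>H1 (Gal \<iota>) (krull_topology \<iota>) \<rho>\<^esub> sum_phi y"
      unfolding sum_phi_def using H.finprod_multf[OF cl[OF x] cl[OF y]] by simp
  qed
qed

text \<open>
  By Shapiro's lemma the lift is given by characters of the stabilizers of representatives
  of the orbits.
\<close>

lemma sum_phi_hits_liftable:
  assumes a: "a \<in> carrier (Z1 (Gal \<iota>) (krull_topology \<iota>) perm)"
    and c: "c \<in> carrier (Z1 (Gal \<iota>) (krull_topology \<iota>) \<rho>)"
    and lift: "\<And>g. g \<in> carrier (Gal \<iota>) \<Longrightarrow> c g = realize (a g) + (\<rho> g m - m)"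
  shows "H1_class (Gal \<iota>) (krull_topology \<iota>) \<rho> c
    \<in> sum_phi ` carrier (sum_group UNIV (\<lambda>v. H1_stab \<iota> \<rho> v triv))"
proof -
  let ?G = "Gal \<iota>" and ?T = "krull_topology \<iota>"
  \<comment> \<open>\<open>SOME\<close> is applied to the orbit as a set, so all points of an orbit
    share one representative; hence distinct elements of \<open>R\<close> have disjoint
    orbits.\<close>
  define rep where "rep v = (SOME w. w \<in> orbit ?G \<rho> v)" for v
  have self: "v \<in> orbit ?G \<rho> v" for v
    using V.act_one[of v] V.one_closed unfolding orbit_def by force
  have orb: "orbit ?G \<rho> w = orbit ?G \<rho> v" if "w \<in> orbit ?G \<rho> v" for v w
    by (rule V.orbit_eq[OF V.act_mult that])
  have rep: "rep v \<in> orbit ?G \<rho> v" for v unfolding rep_def using someI[of "\<lambda>w. w \<in> orbit ?G \<rho> v", OF self] .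
  define R where "R = range rep"
  have disj: "orbit ?G \<rho> u \<inter> orbit ?G \<rho> w = {}" if uw: "u \<in> R" "w \<in> R" "u \<noteq> w" for u w
  proof (rule ccontr)
    assume "orbit ?G \<rho> u \<inter> orbit ?G \<rho> w \<noteq> {}"
    then have eq: "orbit ?G \<rho> u = orbit ?G \<rho> w" using orb by blast
    obtain x y where xy: "u = rep x" "w = rep y" using uw(1,2) by (auto simp: R_def)
    have "orbit ?G \<rho> x = orbit ?G \<rho> y" using eq orb[OF rep, of x] orb[OF rep, of y] xy by simp
    then have "u = w" unfolding xy rep_def by simp
    with uw(3) show False ..
  qed
  have cover: "(\<Union>v\<in>R. orbit ?G \<rho> v) = UNIV"
    using orb[OF rep] self by (auto simp: R_def)
  \<comment> \<open>The component of \<open>a\<close> at \<open>v\<close> for a chosen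
    representative, and 0 at all other points, so that each orbit contributes exactly once.\<close>
  define f where "f v = (\<lambda>u\<in>stab v. if v \<in> R then a u v else 0)" for v
  have f: "f v \<in> carrier (Z1 (stab_group v) (stab_topology v) triv)" for v
  proof -
    interpret S: discrete_module "stab_group v" "stab_topology v" triv by (rule stab_trivial_module)
    have cont: "continuous_map (stab_topology v) (discrete_topology UNIV) a"
      by (rule continuous_map_from_subtopology[OF P.Z1_continuous[OF a]])
    have "restrict (\<lambda>u. if v \<in> R then a u v else 0) (carrier (stab_group v)) \<in> carrier (Z1 (stab_group v) (stab_topology v) triv)"
    proof (rule S.Z1_restrictI)
      show "continuous_map (stab_topology v) (discrete_topology UNIV) (\<lambda>u. if v \<in> R then a u v else 0)"
        by (rule continuous_map_discrete_combine[OF cont cont, where F = "\<lambda>A _. if v \<in> R then A v else 0"]) simp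
      fix g h assume "g \<in> carrier (stab_group v)" "h \<in> carrier (stab_group v)"
      then have g: "g \<in> carrier ?G" "\<rho> g v = v" and h: "h \<in> carrier ?G" by (simp_all add: stabilizer_def)
      have "a (g \<otimes>\<^bsub>?G\<^esub> h) v = a g v + perm g (a h) v" using P.Z1_mult[OF a g(1) h] by (metis plus_fun_apply)
      also have "perm g (a h) v = a h v" using perm_act[OF g(1), of "a h" v] by (simp only: g(2))
      finally show "(if v \<in> R then a (g \<otimes>\<^bsub>stab_group v\<^esub> h) v else 0) =
          (if v \<in> R then a g v else 0) + (if v \<in> R then a h v else 0)" by (simp del: Gal_mult)
    qed
    then show ?thesis by (simp add: f_def)
  qed
  let ?r = "\<lambda>C. SOME t. t \<in> C"
  have r: "\<forall>C\<in>lcosets\<^bsub>?G\<^esub> stab v. ?r C \<in> C" for v by (rule V.lcosets_some_mem[OF stab(1)])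
  define k where "k v = cor_cochain ?G (stab v) \<rho> ?r (\<lambda>u\<in>stab v. scale (f v u) v)" for v
  have k: "k v \<in> carrier (Z1 ?G ?T \<rho>)" for v unfolding k_def by (rule phi_H1_class(2)[OF f r])
  have ex: "\<exists>M. \<forall>g\<in>carrier ?G. k v g = (\<Sum>w\<in>orbit ?G \<rho> v. scale (a g w) w) + (\<rho> g M - M)" if vR: "v \<in> R" for v
  proof -
    have d: "(\<lambda>u\<in>stab v. scale (f v u) v) u = scale (a u v) v" if "u \<in> stab v" for u
      using vR that by (simp add: f_def)
    obtain M where "\<And>g. g \<in> carrier ?G \<Longrightarrow> k v g = (\<Sum>w\<in>orbit ?G \<rho> v. scale (a g w) w) + (\<rho> g M - M)"
      unfolding k_def by (rule cor_orbit[OF a r d]) blast+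
    then show ?thesis by blast
  qed
  have "\<forall>v\<in>R. \<exists>M. \<forall>g\<in>carrier ?G. k v g = (\<Sum>w\<in>orbit ?G \<rho> v. scale (a g w) w) + (\<rho> g M - M)"
    by (intro ballI ex)
  from bchoice[OF this] obtain M where "\<forall>v\<in>R. \<forall>g\<in>carrier ?G.
      k v g = (\<Sum>w\<in>orbit ?G \<rho> v. scale (a g w) w) + (\<rho> g (M v) - M v)" ..
  then have M: "k v g = (\<Sum>w\<in>orbit ?G \<rho> v. scale (a g w) w) + (\<rho> g (M v) - M v)"
    if "v \<in> R" "g \<in> carrier ?G" for v g using that by blast
  have k0: "k v g = 0" if "v \<notin> R" "g \<in> carrier ?G" for v g
    unfolding k_def V.cor_eq[OF stab r that(2)]
  proof (rule sum.neutral, rule ballI)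
    fix C assume C: "C \<in> lcosets\<^bsub>?G\<^esub> stab v"
    have "V.fac ?r g C \<in> stab v" by (rule V.fac_mem[OF stab r that(2) C])
    moreover have "?r (g <#\<^bsub>?G\<^esub> C) \<in> carrier ?G"
      by (rule V.r_carrier[OF stab r V.lcosets_closed[OF stab(1) that(2) C]])
    ultimately show "\<rho> (?r (g <#\<^bsub>?G\<^esub> C)) ((\<lambda>u\<in>stab v. scale (f v u) v) (V.fac ?r g C)) = 0"
      using that(1) by (simp add: f_def V.act_zero)
  qed
  define M' where "M' = (\<Sum>v\<in>R. M v)"
  have sum_k: "(\<Sum>v\<in>UNIV. k v g) = realize (a g) + (\<rho> g M' - M')" if g: "g \<in> carrier ?G" for g
  proof -
    have "(\<Sum>v\<in>UNIV. k v g) = (\<Sum>v\<in>R. k v g)"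
      using k0 g by (intro sum.mono_neutral_right finite_V) auto
    also have "\<dots> = (\<Sum>v\<in>R. \<Sum>w\<in>orbit ?G \<rho> v. scale (a g w) w) + (\<rho> g M' - M')"
      using g by (simp add: M M'_def sum.distrib sum_subtractf V.act_sum)
    also have "(\<Sum>v\<in>R. \<Sum>w\<in>orbit ?G \<rho> v. scale (a g w) w) = (\<Sum>w\<in>(\<Union>v\<in>R. orbit ?G \<rho> v). scale (a g w) w)"
      using disj by (intro sum.UNION_disjoint[symmetric] ballI impI finite_V)
    finally show ?thesis by (simp add: cover realize_def)
  qed
  let ?x = "\<lambda>v. H1_class (stab_group v) (stab_topology v) triv (f v)"
  have x: "?x \<in> carrier (sum_group UNIV (\<lambda>v. H1_stab \<iota> \<rho> v triv))"
    unfolding carrier_sum_H1_stab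
    unfolding H1_stab_def discrete_module.carrier_H1[OF stab_trivial_module] by (intro CollectI allI imageI f)
  have "sum_phi ?x = (\<Otimes>\<^bsub>H1 ?G ?T \<rho>\<^esub>v\<in>UNIV. H1_class ?G ?T \<rho> (k v))"
    unfolding sum_phi_def k_def phi_H1_class(1)[OF f r] ..
  also have "\<dots> = H1_class ?G ?T \<rho> (\<lambda>g\<in>carrier ?G. \<Sum>v\<in>UNIV. k v g)"
    by (rule V.H1_class_finprod[where A = UNIV and c = k, OF finite_V k, THEN conjunct1])
  also have "\<dots> = H1_class ?G ?T \<rho> c"
  proof -
    have Z: "(\<lambda>g\<in>carrier ?G. \<Sum>v\<in>UNIV. k v g) \<in> carrier (Z1 ?G ?T \<rho>)"
      by (rule V.H1_class_finprod[where A = UNIV and c = k, OF finite_V k, THEN conjunct2])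
    have "\<forall>g\<in>carrier ?G. (\<lambda>g\<in>carrier ?G. \<Sum>v\<in>UNIV. k v g) g = c g + (\<rho> g (M' - m) - (M' - m))"
      by (simp add: sum_k lift V.act_diff)
    then show ?thesis by (intro V.H1_class_eq_iff[OF Z c, THEN iffD2] exI)
  qed
  finally show ?thesis by (rule image_eqI[OF sym x])
qed

text \<open>A vector \<open>v\<close> fixed by \<open>U\<close> gives a fixed basis element [v] of
  the permutation module, so a character times [v] is a cocycle. This lifts the corresponding
  cocycle with values in the line of \<open>v\<close>.\<close>

lemma delta_Z1:
  assumes U: "subgroup U (Gal \<iota>)"
    and f: "continuous_map (subtopology (krull_topology \<iota>) U) (discrete_topology UNIV) f"
      "\<And>g h. g \<in> U \<Longrightarrow> h \<in> U \<Longrightarrow> f (g \<circ> h) = f g + f h"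
    and v: "\<And>g. g \<in> U \<Longrightarrow> \<rho> g v = v"
  shows "(\<lambda>g\<in>U. delta v (f g)) \<in> carrier (Z1 (Gal \<iota>\<lparr>carrier := U\<rparr>) (subtopology (krull_topology \<iota>) U) perm)"
proof -
  interpret M: discrete_module "Gal \<iota>\<lparr>carrier := U\<rparr>" "subtopology (krull_topology \<iota>) U" perm
    by (rule P.submodule[OF U])
  have "restrict (\<lambda>g. delta v (f g)) (carrier (Gal \<iota>\<lparr>carrier := U\<rparr>))
      \<in> carrier (Z1 (Gal \<iota>\<lparr>carrier := U\<rparr>) (subtopology (krull_topology \<iota>) U) perm)"
  proof (rule M.Z1_restrictI)
    show "continuous_map (subtopology (krull_topology \<iota>) U) (discrete_topology UNIV) (\<lambda>g. delta v (f g))"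
      by (rule continuous_map_discrete_comp[OF f(1)])
    fix g h assume "g \<in> carrier (Gal \<iota>\<lparr>carrier := U\<rparr>)" "h \<in> carrier (Gal \<iota>\<lparr>carrier := U\<rparr>)"
    then have g: "g \<in> U" and h: "h \<in> U" by simp_all
    have "delta v (f (g \<circ> h)) = delta v (f g) + perm g (delta v (f h))"
      unfolding f(2)[OF g h] delta_add perm_delta[OF Gal_subgroup(1)[OF U g] v[OF g]] ..
    then show "delta v (f (g \<otimes>\<^bsub>Gal \<iota>\<lparr>carrier := U\<rparr>\<^esub> h)) = delta v (f g) + perm g (delta v (f h))" by (simp add: Gal_def)
  qed
  then show ?thesis by simp
qed

text \<open>
  In the basis \<open>e1, e2\<close> with coordinates \<open>X\<close> and \<open>L\<close> the group \<open>U\<close> acts by unipotent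
  matrices. If \<open>\<chi>\<close> is the matrix entry off the diagonal, then a cocycle with coordinates
  \<open>x\<close> and \<open>\<beta>\<close> is a witness for the vanishing of \<open>\<chi> \<union> \<beta>\<close>.
\<close>

lemma unipotent_lift:
  assumes sc: "separable_closure \<iota>" and char: "(of_nat CARD('p) :: 'l) \<noteq> 0"
    and U: "subgroup U (Gal \<iota>)"
    and \<zeta>: "\<zeta> ^ CARD('p) = 1" "\<zeta> \<noteq> 1" "\<And>g. g \<in> U \<Longrightarrow> g \<zeta> = \<zeta>"
    and decomp: "\<And>w. w = scale (X w) e1 + scale (L w) e2"
    and X_add: "\<And>v w. X (v + w) = X v + X w" and L_add: "\<And>v w. L (v + w) = L v + L w"
    and X_scale: "\<And>a v. X (scale a v) = a * X v" and L_scale: "\<And>a v. L (scale a v) = a * L v"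
    and basis: "X e1 = 1" "X e2 = 0" "L e1 = 0" "L e2 = 1"
    and e1: "\<And>g. g \<in> U \<Longrightarrow> \<rho> g e1 = e1" and L: "\<And>g w. g \<in> U \<Longrightarrow> L (\<rho> g w) = L w"
    and c: "c \<in> carrier (Z1 (Gal \<iota>\<lparr>carrier := U\<rparr>) (subtopology (krull_topology \<iota>) U) \<rho>)"
  obtains a where "a \<in> carrier (Z1 (Gal \<iota>\<lparr>carrier := U\<rparr>) (subtopology (krull_topology \<iota>) U) perm)"
    "\<And>g. g \<in> U \<Longrightarrow> realize (a g) = c g"
proof -
  let ?T = "subtopology (krull_topology \<iota>) U" and ?H = "Gal \<iota>\<lparr>carrier := U\<rparr>"
  note UG = Gal_subgroup[OF U]
  interpret M: discrete_module ?H ?T \<rho> by (rule V.submodule[OF U])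
  interpret Q: discrete_module ?H ?T perm by (rule P.submodule[OF U])
  have c_mult: "c (g \<circ> h) = c g + \<rho> g (c h)" if "g \<in> U" "h \<in> U" for g h
  proof -
    have "c (g \<otimes>\<^bsub>?H\<^esub> h) = c g + \<rho> g (c h)" by (rule M.Z1_mult[OF c]) (use that in simp_all)
    then show ?thesis by (simp add: Gal_def)
  qed
  have act_mult: "\<rho> (g \<circ> h) v = \<rho> g (\<rho> h v)" if "g \<in> U" "h \<in> U" for g h v
    using V.act_mult[OF UG(1)[OF that(1)] UG(1)[OF that(2)], of v] by (simp only: Gal_mult)
  define \<chi> where "\<chi> g = X (\<rho> g e2)" for g
  define \<beta> where "\<beta> g = L (c g)" for g
  define x where "x g = X (c g)" for g
  have X_act: "X (\<rho> g w) = X w + \<chi> g * L w" if g: "g \<in> U" for g w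
  proof -
    have "\<rho> g w = \<rho> g (scale (X w) e1 + scale (L w) e2)" using decomp[of w] by simp
    also have "\<dots> = scale (X w) e1 + scale (L w) (\<rho> g e2)"
      by (simp only: V.act_add[OF UG(1)[OF g]] act_scale[OF UG(1)[OF g]] e1[OF g])
    finally show ?thesis by (simp add: X_add X_scale basis \<chi>_def mult.commute)
  qed
  have e2: "\<rho> g e2 = scale (\<chi> g) e1 + e2" if g: "g \<in> U" for g
    using decomp[of "\<rho> g e2"] by (simp add: L[OF g] basis \<chi>_def)
  have \<beta>: "\<beta> (g \<circ> h) = \<beta> g + \<beta> h" if "g \<in> U" "h \<in> U" for g h
    using that by (simp only: \<beta>_def c_mult L_add L)
  have x: "x (g \<circ> h) = x g + x h + \<chi> g * \<beta> h" if "g \<in> U" "h \<in> U" for g h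
    using that by (simp only: x_def \<beta>_def c_mult X_add X_act add.assoc)
  have \<chi>: "\<chi> (g \<circ> h) = \<chi> g + \<chi> h" if g: "g \<in> U" and h: "h \<in> U" for g h
    using X_act[OF g, of "\<rho> h e2"] by (simp only: act_mult[OF g h] L[OF h] basis mult_1_right add.commute \<chi>_def)
  have \<chi>_cont: "continuous_map ?T (discrete_topology UNIV) \<chi>"
    unfolding \<chi>_def by (rule continuous_map_discrete_comp[OF M.act_continuous])
  note c_cont = M.Z1_continuous[OF c]
  have \<beta>_cont: "continuous_map ?T (discrete_topology UNIV) \<beta>"
    unfolding \<beta>_def by (rule continuous_map_discrete_comp[OF c_cont])
  have x_cont: "continuous_map ?T (discrete_topology UNIV) x"
    unfolding x_def by (rule continuous_map_discrete_comp[OF c_cont])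
  \<comment> \<open>The decisive step is to lift the cocycle modulo the line of \<open>e1\<close>,
    where it becomes \<beta>.\<close>
  obtain a2 where a2: "a2 \<in> carrier (Z1 ?H ?T perm)" "\<And>g. g \<in> U \<Longrightarrow> L (realize (a2 g)) = \<beta> g"
  proof (cases "\<forall>g\<in>U. \<chi> g = 0")
    case True
    have "(\<lambda>g\<in>U. delta e2 (\<beta> g)) \<in> carrier (Z1 ?H ?T perm)"
      by (rule delta_Z1[OF U \<beta>_cont \<beta>]) (use e2 True in simp_all)
    then show thesis by (rule that) (simp add: realize_delta L_scale basis)
  next
    case False
    interpret K: kummer_character_kernel \<iota> U \<chi>
    proof (rule kummer_character_kernel.intro)
      show "\<exists>g\<in>U. \<chi> g \<noteq> 0" using False by blast
    qed (fact U \<chi>_cont \<chi>)+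
    obtain \<phi> :: "('l \<Rightarrow> 'l) \<Rightarrow> 'p mod_ring" where
      \<phi>: "continuous_map (subtopology (krull_topology \<iota>) K.N) (discrete_topology UNIV) \<phi>"
        "\<And>g h. g \<in> K.N \<Longrightarrow> h \<in> K.N \<Longrightarrow> \<phi> (g \<circ> h) = \<phi> g + \<phi> h"
        "\<And>r g. \<forall>C\<in>lcosets\<^bsub>?H\<^esub> K.N. r C \<in> C \<Longrightarrow> g \<in> U \<Longrightarrow>
           (\<Sum>C\<in>lcosets\<^bsub>?H\<^esub> K.N. \<phi> (inv\<^bsub>?H\<^esub> (r (g <#\<^bsub>?H\<^esub> C)) \<otimes>\<^bsub>?H\<^esub> g \<otimes>\<^bsub>?H\<^esub> r C)) = \<beta> g"
    proof -
      show thesis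
        by (rule K.kummer_corestriction[where \<zeta> = \<zeta> and \<beta> = \<beta> and x = x])
          (fact sc char \<zeta> \<beta>_cont x_cont \<beta> x that)+
    qed
    have "\<rho> g e2 = e2" if "g \<in> K.N" for g using e2[of g] that by (simp add: K.N_def)
    \<comment> \<open>On \<open>N\<close> the vector \<open>e2\<close> is fixed, so \<phi> times
      [e2] is a cocycle there; its corestriction to \<open>U\<close> serves as
      \<open>a2\<close>.\<close>
    note \<delta> = delta_Z1[OF K.subgroup_N \<phi>(1,2) this]
    have sub: "subtopology ?T K.N = subtopology (krull_topology \<iota>) K.N"
      unfolding subtopology_subtopology Int_absorb1[OF K.N_subset] ..
    have grp: "?H\<lparr>carrier := K.N\<rparr> = Gal \<iota>\<lparr>carrier := K.N\<rparr>" by simp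
    have \<psi>: "(\<lambda>g\<in>K.N. delta e2 (\<phi> g)) \<in> carrier (Z1 (?H\<lparr>carrier := K.N\<rparr>) (subtopology ?T K.N) perm)"
      unfolding sub grp by (rule \<delta>)
    let ?r = "\<lambda>C. SOME t. t \<in> C"
    have r: "\<forall>C\<in>lcosets\<^bsub>?H\<^esub> K.N. ?r C \<in> C"
      by (rule M.lcosets_some_mem[OF K.subgroup_N_H])
    note Nr = K.subgroup_N_H K.openin_N K.finite_lcosets r
    show thesis
    proof (rule that[OF Q.cor_Z1[OF Nr \<psi>]])
      fix g assume g: "g \<in> U"
      then have gH: "g \<in> carrier ?H" by simp
      have L_sum: "L (\<Sum>i\<in>I. f i) = (\<Sum>i\<in>I. L (f i))" for f :: "('l \<Rightarrow> 'l) set \<Rightarrow> 'v" and I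
        using L_scale[of 0 0] by (induction I rule: infinite_finite_induct) (simp_all add: L_add)
      \<comment> \<open>\<open>L\<close> is invariant under \<open>U\<close>; applied to the
        corestriction it removes the translations by the representatives and leaves the transfer of
        \<phi>.\<close>
      have "L (realize (cor_cochain ?H K.N perm ?r (\<lambda>g\<in>K.N. delta e2 (\<phi> g)) g)) =
          (\<Sum>C\<in>lcosets\<^bsub>?H\<^esub> K.N. \<phi> (inv\<^bsub>?H\<^esub> (?r (g <#\<^bsub>?H\<^esub> C)) \<otimes>\<^bsub>?H\<^esub> g \<otimes>\<^bsub>?H\<^esub> ?r C))"
        unfolding Q.cor_eq[OF Nr gH] realize_sum L_sum
      proof (rule sum.cong[OF refl])
        fix C assume C: "C \<in> lcosets\<^bsub>?H\<^esub> K.N"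
        have "?r (g <#\<^bsub>?H\<^esub> C) \<in> carrier ?H"
          by (rule M.r_carrier[OF Nr M.lcosets_closed[OF K.subgroup_N_H gH C]])
        then have rU: "?r (g <#\<^bsub>?H\<^esub> C) \<in> U" by simp
        have u: "Q.fac ?r g C \<in> K.N" by (rule Q.fac_mem[OF Nr gH C])
        show "L (realize (perm (?r (g <#\<^bsub>?H\<^esub> C)) ((\<lambda>g\<in>K.N. delta e2 (\<phi> g)) (Q.fac ?r g C)))) =
            \<phi> (inv\<^bsub>?H\<^esub> (?r (g <#\<^bsub>?H\<^esub> C)) \<otimes>\<^bsub>?H\<^esub> g \<otimes>\<^bsub>?H\<^esub> ?r C)"
          unfolding restrict_apply'[OF u] realize_perm[OF UG(1)[OF rU]] realize_delta L[OF rU] L_scale basis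
          by (simp only: mult_1_right Q.fac_def[OF Nr])
      qed
      also have "\<dots> = \<beta> g" by (rule \<phi>(3)[OF r g])
      finally show "L (realize (cor_cochain ?H K.N perm ?r (\<lambda>g\<in>K.N. delta e2 (\<phi> g)) g)) = \<beta> g" .
    qed
  qed
  \<comment> \<open>The error takes values in the line of \<open>e1\<close>, which \<open>U\<close>
    fixes, so it is a character times \<open>e1\<close> and lifts by
    \<open>delta_Z1\<close>.\<close>
  define d where "d g = c g - realize (a2 g)" for g
  have L_diff: "L (v - w) = L v - L w" for v w using L_add[of "v - w" w] by (simp add: algebra_simps)
  have d: "d g = scale (X (d g)) e1" if g: "g \<in> U" for g
    using decomp[of "d g"] a2(2)[OF g] by (simp add: d_def L_diff \<beta>_def)
  have d_mult: "d (g \<circ> h) = d g + d h" if g: "g \<in> U" and h: "h \<in> U" for g h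
  proof -
    have "a2 (g \<otimes>\<^bsub>?H\<^esub> h) = a2 g + perm g (a2 h)" by (rule Q.Z1_mult[OF a2(1)]) (use g h in simp_all)
    then have a2m: "a2 (g \<circ> h) = a2 g + perm g (a2 h)" by (simp add: Gal_def)
    have "d (g \<circ> h) = d g + \<rho> g (d h)"
      unfolding d_def c_mult[OF g h] a2m realize_add realize_perm[OF UG(1)[OF g]] V.act_diff[OF UG(1)[OF g]]
      by (simp only: algebra_simps)
    also have "\<rho> g (d h) = d h"
    proof -
      obtain a where a: "d h = scale a e1" using d[OF h] by blast
      show ?thesis unfolding a act_scale[OF UG(1)[OF g]] e1[OF g] ..
    qed
    finally show ?thesis .
  qed
  have d_cont: "continuous_map ?T (discrete_topology UNIV) d"
    by (rule continuous_map_discrete_combine[OF c_cont Q.Z1_continuous[OF a2(1)], where F = "\<lambda>v A. v - realize A"])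
      (simp add: d_def)
  have a1: "(\<lambda>g\<in>U. delta e1 (X (d g))) \<in> carrier (Z1 ?H ?T perm)"
    by (rule delta_Z1[OF U continuous_map_discrete_comp[OF d_cont]]) (simp_all only: d_mult X_add e1)
  show thesis
  proof (rule that[OF Q.H1_class_mult(2)[OF a1 a2(1)]])
    fix g assume g: "g \<in> U"
    have "realize ((\<lambda>g\<in>carrier ?H. (\<lambda>g\<in>U. delta e1 (X (d g))) g + a2 g) g) = scale (X (d g)) e1 + realize (a2 g)"
      using g by (simp add: realize_add realize_delta)
    also have "\<dots> = c g" by (simp add: d[OF g, symmetric]) (simp add: d_def)
    finally show "realize ((\<lambda>g\<in>carrier ?H. (\<lambda>g\<in>U. delta e1 (X (d g))) g + a2 g) g) = c g" .
  qed
qed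

text \<open>As \<open>realize\<close> is equivariant, the corestriction of \<open>b\<close> lifts
  the corestriction of the restriction of \<open>c\<close>, which is the index times
  \<open>c\<close> up to a coboundary; the index is then divided out in F_p.\<close>

lemma lift_from_subgroup:
  assumes U: "subgroup U (Gal \<iota>)" and openU: "openin (krull_topology \<iota>) U"
    and finU: "finite (lcosets\<^bsub>Gal \<iota>\<^esub> U)"
    and index: "of_nat (card (lcosets\<^bsub>Gal \<iota>\<^esub> U)) \<noteq> (0 :: 'p mod_ring)"
    and c: "c \<in> carrier (Z1 (Gal \<iota>) (krull_topology \<iota>) \<rho>)"
    and b: "b \<in> carrier (Z1 (Gal \<iota>\<lparr>carrier := U\<rparr>) (subtopology (krull_topology \<iota>) U) perm)"
      "\<And>g. g \<in> U \<Longrightarrow> realize (b g) = c g"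
  obtains a m where "a \<in> carrier (Z1 (Gal \<iota>) (krull_topology \<iota>) perm)"
    "\<And>g. g \<in> carrier (Gal \<iota>) \<Longrightarrow> c g = realize (a g) + (\<rho> g m - m)"
proof -
  let ?G = "Gal \<iota>" and ?T = "krull_topology \<iota>"
  let ?r = "\<lambda>C. SOME t. t \<in> C"
  have r: "\<forall>C\<in>lcosets\<^bsub>?G\<^esub> U. ?r C \<in> C"
    by (rule V.lcosets_some_mem[OF U])
  note Ur = U openU finU r
  define a0 where "a0 = cor_cochain ?G U perm ?r b"
  have a0: "a0 \<in> carrier (Z1 ?G ?T perm)" unfolding a0_def by (rule P.cor_Z1[OF Ur b(1)])
  define M where "M = (\<Sum>C\<in>lcosets\<^bsub>?G\<^esub> U. c (?r C))"
  let ?n = "of_nat (card (lcosets\<^bsub>?G\<^esub> U)) :: 'p mod_ring"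
  have real_a0: "realize (a0 g) = scale ?n (c g) + (\<rho> g M - M)" if g: "g \<in> carrier ?G" for g
  proof -
    have "realize (a0 g) = cor_cochain ?G U \<rho> ?r c g"
      unfolding a0_def P.cor_eq[OF Ur g] V.cor_eq[OF Ur g] realize_sum
    proof (rule sum.cong[OF refl])
      fix C assume C: "C \<in> lcosets\<^bsub>?G\<^esub> U"
      have rG: "?r (g <#\<^bsub>?G\<^esub> C) \<in> carrier ?G" by (rule V.r_carrier[OF Ur V.lcosets_closed[OF U g C]])
      have u: "P.fac ?r g C \<in> U" by (rule P.fac_mem[OF Ur g C])
      show "realize (perm (?r (g <#\<^bsub>?G\<^esub> C)) (b (P.fac ?r g C))) = \<rho> (?r (g <#\<^bsub>?G\<^esub> C)) (c (V.fac ?r g C))"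
        unfolding realize_perm[OF rG] b(2)[OF u] ..
    qed
    also have "\<dots> = scale ?n (c g) + (\<rho> g M - M)"
      unfolding V.cor_restriction[OF Ur c refl g] sum_constant_scale M_def ..
    finally show ?thesis .
  qed
  let ?k = "inverse ?n"
  have "restrict (\<lambda>g v. ?k * a0 g v) (carrier ?G) \<in> carrier (Z1 ?G ?T perm)"
  proof (rule P.Z1_restrictI)
    show "continuous_map ?T (discrete_topology UNIV) (\<lambda>g v. ?k * a0 g v)"
      by (rule continuous_map_discrete_comp[OF P.Z1_continuous[OF a0], where F = "\<lambda>A v. ?k * A v"])
    fix g h assume g: "g \<in> carrier ?G" and h: "h \<in> carrier ?G"
    show "(\<lambda>v. ?k * a0 (g \<otimes>\<^bsub>?G\<^esub> h) v) = (\<lambda>v. ?k * a0 g v) + perm g (\<lambda>v. ?k * a0 h v)"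
      unfolding P.Z1_mult[OF a0 g h] by (simp add: fun_eq_iff perm_def distrib_left)
  qed
  then show thesis
  \<comment> \<open>The coboundary of \<open>M\<close>, divided by the index, changes sides and
    hence sign.\<close>
  proof (rule that[where m = "- scale ?k M"])
    fix g assume g: "g \<in> carrier ?G"
    have "realize (restrict (\<lambda>g v. ?k * a0 g v) (carrier ?G) g) = scale ?k (scale ?n (c g) + (\<rho> g M - M))"
      using g by (simp add: realize_scale real_a0)
    also have "\<dots> = c g + (\<rho> g (scale ?k M) - scale ?k M)"
      using index g by (simp add: scale_right_distrib scale_right_diff_distrib act_scale)
    finally show "c g = realize (restrict (\<lambda>g v. ?k * a0 g v) (carrier ?G) g) + (\<rho> g (- scale ?k M) - - scale ?k M)"
      using g by (simp add: V.act_uminus)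
  qed
qed

end

section \<open>Representations of dimension two\<close>

locale mod_p_plane = mod_p_representation \<iota> scale \<rho>
  for \<iota> :: "'f::field \<Rightarrow> 'l::field"
    and scale :: "'p::prime_card mod_ring \<Rightarrow> 'v::ab_group_add \<Rightarrow> 'v"
    and \<rho> :: "('l \<Rightarrow> 'l) \<Rightarrow> 'v \<Rightarrow> 'v" +
  fixes b1 b2 :: 'v and X1 X2 :: "'v \<Rightarrow> 'p mod_ring"
  assumes decomp: "v = scale (X1 v) b1 + scale (X2 v) b2"
    and X_add: "X1 (v + w) = X1 v + X1 w" "X2 (v + w) = X2 v + X2 w"
    and X_scale: "X1 (scale a v) = a * X1 v" "X2 (scale a v) = a * X2 v"
    and X_basis: "X1 b1 = 1" "X1 b2 = 0" "X2 b1 = 0" "X2 b2 = 1"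
begin

lemma eq_coordinates_iff: "v = w \<longleftrightarrow> X1 v = X1 w \<and> X2 v = X2 w"
  by (metis decomp)

text \<open>The volume form of the basis \<open>b1\<close>, \<open>b2\<close>. For a vector e the
  linear form \<open>D e\<close> vanishes on the line of e and will be the coordinate modulo that
  line.\<close>

definition D where "D v w = X1 v * X2 w - X2 v * X1 w"

definition determinant where "determinant g = D (\<rho> g b1) (\<rho> g b2)"

lemma D_add: "D v (w + u) = D v w + D v u" "D (v + w) u = D v u + D w u"
  by (simp_all add: D_def X_add algebra_simps)

lemma D_scale: "D v (scale a w) = a * D v w" "D (scale a v) w = a * D v w"
  by (simp_all add: D_def X_scale algebra_simps)

lemma D_self: "D v v = 0"
  by (simp add: D_def)

text \<open>Cramer's rule: if \<open>D u v = 1\<close>, the values of \<open>D\<close> are the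
  coordinates of \<open>w\<close> in the basis \<open>u\<close>, \<open>v\<close>.\<close>

lemma plucker: "scale (D u v) w = scale (D w v) u + scale (D u w) v"
proof (rule eq_coordinates_iff[THEN iffD2], rule conjI)
  show "X1 (scale (D u v) w) = X1 (scale (D w v) u + scale (D u w) v)"
    "X2 (scale (D u v) w) = X2 (scale (D w v) u + scale (D u w) v)"
    unfolding X_add X_scale D_def by (simp_all add: algebra_simps)
qed

lemma D_act:
  assumes g: "g \<in> carrier (Gal \<iota>)"
  shows "D (\<rho> g v) (\<rho> g w) = determinant g * D v w"
proof -
  have act: "\<rho> g u = scale (X1 u) (\<rho> g b1) + scale (X2 u) (\<rho> g b2)" for u
  proof -
    have "\<rho> g u = \<rho> g (scale (X1 u) b1 + scale (X2 u) b2)" using decomp[of u] by simp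
    then show ?thesis by (simp only: V.act_add[OF g] act_scale[OF g])
  qed
  have X_act: "X1 (\<rho> g u) = X1 u * X1 (\<rho> g b1) + X2 u * X1 (\<rho> g b2)"
    "X2 (\<rho> g u) = X1 u * X2 (\<rho> g b1) + X2 u * X2 (\<rho> g b2)" for u
    by (subst act, simp add: X_add X_scale)+
  show ?thesis
    unfolding determinant_def D_def X_act[of v] X_act[of w] by (simp add: algebra_simps)
qed

lemma determinant_mult:
  assumes "g \<in> carrier (Gal \<iota>)" "h \<in> carrier (Gal \<iota>)"
  shows "determinant (g \<otimes>\<^bsub>Gal \<iota>\<^esub> h) = determinant g * determinant h"
  unfolding determinant_def[of "g \<otimes>\<^bsub>Gal \<iota>\<^esub> h"] V.act_mult[OF assms] D_act[OF assms(1)] determinant_def[of h] ..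

lemma determinant_one: "determinant \<one>\<^bsub>Gal \<iota>\<^esub> = 1"
  unfolding determinant_def V.act_one by (simp add: D_def X_basis)

lemma determinant_nonzero:
  assumes g: "g \<in> carrier (Gal \<iota>)"
  shows "determinant g \<noteq> 0"
  using determinant_mult[OF V.inv_closed[OF g] g] unfolding V.l_inv[OF g] determinant_one by auto

text \<open>Completes \<open>v\<close> to a basis of volume 1, for which Cramer's rule involves no
  division.\<close>

lemma exists_dual: assumes "v \<noteq> 0" obtains w where "D v w = 1"
proof (cases "X1 v = 0")
  case False
  then have "D v (scale (inverse (X1 v)) b2) = 1" by (simp add: D_def X_scale X_basis)
  then show ?thesis by (rule that)
next
  case True
  have X0: "X1 0 = 0" "X2 0 = 0" using X_scale[of 0 0] by simp_all
  have "X2 v \<noteq> 0" using True assms eq_coordinates_iff[of v 0] by (simp add: X0)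
  then have "D v (scale (- inverse (X2 v)) b1) = 1" unfolding D_scale by (simp add: D_def X_basis)
  then show ?thesis by (rule that)
qed

lemma card_plane: "card (UNIV :: 'v set) = CARD('p) * CARD('p)"
proof -
  have "bij_betw (\<lambda>v. (X1 v, X2 v)) UNIV (UNIV \<times> UNIV)"
  proof (rule bij_betw_imageI)
    show "inj (\<lambda>v. (X1 v, X2 v))" using eq_coordinates_iff by (auto intro!: injI)
    have "(a, b) \<in> range (\<lambda>v. (X1 v, X2 v))" for a b
      by (rule range_eqI[of _ _ "scale a b1 + scale b b2"]) (simp add: X_add X_scale X_basis)
    then show "range (\<lambda>v. (X1 v, X2 v)) = UNIV \<times> UNIV" by auto
  qed
  then have "card (UNIV :: 'v set) = card ((UNIV :: 'p mod_ring set) \<times> (UNIV :: 'p mod_ring set))" by (rule bij_betw_same_card)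
  then show ?thesis by (simp add: card_cartesian_product)
qed

text \<open>
  The number of triples of a nonzero vector, a volume form and a primitive \<open>p\<close>-th root of
  unity is prime to \<open>p\<close>, so one of them has a stabilizer of index prime to \<open>p\<close>.
\<close>

lemma exists_unipotent_subgroup:
  assumes \<zeta>: "(\<zeta> :: 'l) ^ CARD('p) = 1" "\<zeta> \<noteq> 1"
  obtains U e \<zeta>' where "subgroup U (Gal \<iota>)" "openin (krull_topology \<iota>) U"
    "finite (lcosets\<^bsub>Gal \<iota>\<^esub> U)" "\<not> CARD('p) dvd card (lcosets\<^bsub>Gal \<iota>\<^esub> U)"
    "e \<noteq> 0" "\<zeta>' ^ CARD('p) = 1" "\<zeta>' \<noteq> 1"
    "\<And>g. g \<in> U \<Longrightarrow> \<rho> g e = e \<and> determinant g = 1 \<and> g \<zeta>' = \<zeta>'"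
proof -
  let ?G = "Gal \<iota>" and ?p = "CARD('p)"
  have p: "prime ?p" by (rule prime_card)
  define R where "R = {z :: 'l. z ^ ?p = 1} - {1}"
  have R: "finite R" "card R < ?p" "card R > 0"
  proof -
    have fin: "finite {z :: 'l. z ^ ?p = 1}" and le: "card {z :: 'l. z ^ ?p = 1} \<le> ?p"
      by (rule finite_roots_of_unity, simp)+
    show "finite R" using fin by (simp add: R_def)
    have "1 \<in> {z :: 'l. z ^ ?p = 1}" by simp
    then have "card R < card {z :: 'l. z ^ ?p = 1}"
      unfolding R_def using fin by (intro card_Diff1_less)
    then show "card R < ?p" using le by simp
    have "\<zeta> \<in> R" using \<zeta> by (simp add: R_def)
    then show "card R > 0" using \<open>finite R\<close> by (auto simp: card_gt_0_iff)
  qed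
  define X where "X = (UNIV - {0 :: 'v}) \<times> ((UNIV - {0 :: 'p mod_ring}) \<times> R)"
  \<comment> \<open>The scalar \<open>s\<close> is a nonzero point of the line on which
    \<open>g\<close> acts through its determinant; fixing it therefore forces determinant 1.\<close>
  define \<Phi> where "\<Phi> g = (\<lambda>(v, s, z). (\<rho> g v, determinant g * s, g z))" for g :: "'l \<Rightarrow> 'l"
  have "finite X" unfolding X_def by (intro finite_cartesian_product finite_V R(1)) simp
  have one: "\<Phi> \<one>\<^bsub>?G\<^esub> x = x" for x
  proof (cases x)
    case (fields v s z)
    have "\<one>\<^bsub>?G\<^esub> z = z" by simp
    then show ?thesis unfolding fields \<Phi>_def case_prod_conv V.act_one determinant_one mult_1_left by (simp only:)
  qed
  have mult: "\<Phi> (g \<otimes>\<^bsub>?G\<^esub> h) x = \<Phi> g (\<Phi> h x)" if "g \<in> carrier ?G" "h \<in> carrier ?G" for g h x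
  proof (cases x)
    case (fields v s z)
    have "(g \<otimes>\<^bsub>?G\<^esub> h) z = g (h z)" by simp
    then show ?thesis
      unfolding fields \<Phi>_def case_prod_conv V.act_mult[OF that] determinant_mult[OF that] mult.assoc by (simp only:)
  qed
  have closed: "\<Phi> g x \<in> X" if g: "g \<in> carrier ?G" and x: "x \<in> X" for g x
  proof -
    obtain v s z where x': "x = (v, s, z)" "v \<noteq> 0" "s \<noteq> 0" "z ^ ?p = 1" "z \<noteq> 1"
      using x by (cases x) (auto simp: X_def R_def)
    have "\<rho> g v \<noteq> 0" using x'(2) act_inv(1)[OF g, of v] V.act_zero[OF V.inv_closed[OF g]] by auto
    moreover have "g z ^ ?p = 1" using Gal_elem_power[OF g, of z ?p] x'(4) Gal_elem_one[OF g] by simp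
    moreover have "g z \<noteq> 1"
    proof
      assume "g z = 1"
      then have "(inv\<^bsub>?G\<^esub> g) (g z) = 1" using Gal_elem_one[OF V.inv_closed[OF g]] by simp
      then show False using Gal_inv(1)[OF g] x'(5) by simp
    qed
    ultimately show ?thesis using determinant_nonzero[OF g] x'(3) by (simp add: x'(1) \<Phi>_def X_def R_def)
  qed
  \<comment> \<open>The factors p^2 - 1 and p - 1 are -1 modulo p. The set \<open>R\<close> contains
    \<open>\<zeta>\<close> and has at most p - 1 elements, so its size is prime to p as
    well.\<close>
  have "card X = (?p * ?p - 1) * ((?p - 1) * card R)"
    unfolding X_def by (simp add: card_cartesian_product card_Diff_singleton card_plane)
  moreover have "\<not> ?p dvd ?p * ?p - 1"
  proof
    assume "?p dvd ?p * ?p - 1"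
    moreover have "?p * ?p - (?p * ?p - 1) = 1" using prime_gt_0_nat[OF p] by simp
    ultimately have "?p dvd 1" by (metis dvd_diff_nat dvd_triv_left)
    then show False using p by (simp add: prime_nat_iff)
  qed
  moreover have "\<not> ?p dvd ?p - 1" using prime_gt_1_nat[OF p] by (auto dest: dvd_imp_le)
  moreover have "\<not> ?p dvd card R" using R(2,3) by (auto dest: dvd_imp_le)
  ultimately have "\<not> ?p dvd card X" using p by (simp add: prime_dvd_mult_iff)
  then obtain x where x: "x \<in> X" "\<not> ?p dvd card (orbit ?G \<Phi> x)"
    using V.orbit_not_dvd[of X \<Phi> ?p] \<open>finite X\<close> closed one mult by blast
  obtain e s z where x': "x = (e, s, z)" "e \<noteq> 0" "s \<noteq> 0" "z ^ ?p = 1" "z \<noteq> 1"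
    using x(1) by (cases x) (auto simp: X_def R_def)
  let ?U = "stabilizer ?G \<Phi> x"
  have U: "subgroup ?U ?G" by (rule V.stabilizer_subgroupI[OF one mult])
  have U_iff: "g \<in> ?U \<longleftrightarrow> g \<in> carrier ?G \<and> \<rho> g e = e \<and> determinant g = 1 \<and> g z = z" for g
    using x'(3) by (auto simp: stabilizer_def x'(1) \<Phi>_def)
  let ?r = "\<lambda>C. SOME t. t \<in> C"
  have r: "\<forall>C\<in>lcosets\<^bsub>?G\<^esub> ?U. ?r C \<in> C"
    by (rule V.lcosets_some_mem[OF U])
  note bij = V.lcosets_orbit_bij[OF one mult r]
  have "orbit ?G \<Phi> x \<subseteq> X"
  proof
    fix y assume "y \<in> orbit ?G \<Phi> x"
    then obtain g where "g \<in> carrier ?G" "y = \<Phi> g x" unfolding orbit_def by blast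
    then show "y \<in> X" using closed x(1) by simp
  qed
  then have fin: "finite (lcosets\<^bsub>?G\<^esub> ?U)" using bij_betw_finite[OF bij] \<open>finite X\<close> finite_subset by blast
  have "openin (krull_topology \<iota>) ?U"
  proof -
    have cont: "continuous_map (krull_topology \<iota>) (discrete_topology UNIV) \<rho>"
      using rep by (simp add: galois_representation_def)
    have "openin (krull_topology \<iota>) {g \<in> topspace (krull_topology \<iota>). \<rho> g \<in> {f. f e = e \<and> D (f b1) (f b2) = 1}}"
      by (rule openin_continuous_map_preimage[OF cont]) simp
    moreover have "openin (krull_topology \<iota>) {g \<in> carrier ?G. \<forall>s\<in>{z}. g s = id s}"
      by (rule krull_open_fixing) simp
    ultimately have "openin (krull_topology \<iota>)
      ({g \<in> topspace (krull_topology \<iota>). \<rho> g \<in> {f. f e = e \<and> D (f b1) (f b2) = 1}} \<inter> {g \<in> carrier ?G. \<forall>s\<in>{z}. g s = id s})"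
      by (rule openin_Int)
    also have "\<dots> = ?U" by (rule Set.set_eqI) (auto simp: U_iff determinant_def)
    finally show ?thesis .
  qed
  moreover have "\<not> ?p dvd card (lcosets\<^bsub>?G\<^esub> ?U)" using x(2) bij_betw_same_card[OF bij] by simp
  ultimately show thesis using that[OF U _ fin _ x'(2,4,5)] U_iff by blast
qed

lemma surj_sum_phi:
  assumes sc: "separable_closure \<iota>" and char: "(of_nat CARD('p) :: 'l) \<noteq> 0"
  shows "sum_phi ` carrier (sum_group UNIV (\<lambda>v. H1_stab \<iota> \<rho> v triv)) = carrier (H1 (Gal \<iota>) (krull_topology \<iota>) \<rho>)"
proof (intro equalityI subsetI)
  fix y assume "y \<in> sum_phi ` carrier (sum_group UNIV (\<lambda>v. H1_stab \<iota> \<rho> v triv))"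
  then show "y \<in> carrier (H1 (Gal \<iota>) (krull_topology \<iota>) \<rho>)" using hom_in_carrier[OF sum_phi_hom] by blast
next
  fix y assume "y \<in> carrier (H1 (Gal \<iota>) (krull_topology \<iota>) \<rho>)"
  then obtain c where c: "c \<in> carrier (Z1 (Gal \<iota>) (krull_topology \<iota>) \<rho>)"
    and y: "y = H1_class (Gal \<iota>) (krull_topology \<iota>) \<rho> c" unfolding V.carrier_H1 by blast
  have "CARD('p) > 1" using prime_card prime_gt_1_nat by blast
  then obtain \<xi> :: 'l where \<xi>: "\<xi> ^ CARD('p) = 1" "\<xi> \<noteq> 1"
    by (rule separable_closure_root_of_unity[OF sc char])
  obtain U e \<zeta> where U: "subgroup U (Gal \<iota>)" "openin (krull_topology \<iota>) U"
    "finite (lcosets\<^bsub>Gal \<iota>\<^esub> U)" and index: "\<not> CARD('p) dvd card (lcosets\<^bsub>Gal \<iota>\<^esub> U)"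
    and e: "e \<noteq> 0" and \<zeta>: "\<zeta> ^ CARD('p) = 1" "\<zeta> \<noteq> 1"
    and fixed: "\<And>g. g \<in> U \<Longrightarrow> \<rho> g e = e \<and> determinant g = 1 \<and> g \<zeta> = \<zeta>"
    by (rule exists_unipotent_subgroup[OF \<xi>]) blast
  obtain e' where e': "D e e' = 1" by (rule exists_dual[OF e])
  have index': "of_nat (card (lcosets\<^bsub>Gal \<iota>\<^esub> U)) \<noteq> (0 :: 'p mod_ring)"
    using index of_nat_0_mod_ring_dvd by blast
  let ?c = "restrict c U"
  interpret M: discrete_module "Gal \<iota>\<lparr>carrier := U\<rparr>" "subtopology (krull_topology \<iota>) U" \<rho>
    by (rule V.submodule[OF U(1)])
  have cU: "?c \<in> carrier (Z1 (Gal \<iota>\<lparr>carrier := U\<rparr>) (subtopology (krull_topology \<iota>) U) \<rho>)"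
  proof -
    have "restrict c (carrier (Gal \<iota>\<lparr>carrier := U\<rparr>)) \<in> carrier (Z1 (Gal \<iota>\<lparr>carrier := U\<rparr>) (subtopology (krull_topology \<iota>) U) \<rho>)"
    proof (rule M.Z1_restrictI)
      show "continuous_map (subtopology (krull_topology \<iota>) U) (discrete_topology UNIV) c"
        by (rule continuous_map_from_subtopology[OF V.Z1_continuous[OF c]])
      fix g h assume "g \<in> carrier (Gal \<iota>\<lparr>carrier := U\<rparr>)" "h \<in> carrier (Gal \<iota>\<lparr>carrier := U\<rparr>)"
      then have "g \<in> carrier (Gal \<iota>)" "h \<in> carrier (Gal \<iota>)" using Gal_subgroup(1)[OF U(1)] by simp_all
      then have "c (g \<otimes>\<^bsub>Gal \<iota>\<^esub> h) = c g + \<rho> g (c h)" by (rule V.Z1_mult[OF c])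
      then show "c (g \<otimes>\<^bsub>Gal \<iota>\<lparr>carrier := U\<rparr>\<^esub> h) = c g + \<rho> g (c h)" by (simp del: Gal_mult)
    qed
    then show ?thesis by simp
  qed
  obtain b where b: "b \<in> carrier (Z1 (Gal \<iota>\<lparr>carrier := U\<rparr>) (subtopology (krull_topology \<iota>) U) perm)"
    "\<And>g. g \<in> U \<Longrightarrow> realize (b g) = ?c g"
  proof -
    show thesis
    \<comment> \<open>By Cramer's rule \<open>D w e'\<close> and \<open>D e w\<close> are the
      coordinates of \<open>w\<close> in the basis \<open>e\<close>, \<open>e'\<close>. The second
      is invariant because \<open>U\<close> fixes \<open>e\<close> and has determinant 1, so the
      action in this basis is unipotent.\<close>
    proof (rule unipotent_lift[where X = "\<lambda>w. D w e'" and L = "D e" and ?e1.0 = e and ?e2.0 = e' and c = ?c and \<zeta> = \<zeta> and U = U])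
      show "w = scale (D w e') e + scale (D e w) e'" for w using plucker[of e e' w] by (simp add: e')
      show "D e (\<rho> g w) = D e w" if "g \<in> U" for g w
        using D_act[OF Gal_subgroup(1)[OF U(1) that], of e w] fixed[OF that] by simp
      show "\<rho> g e = e" "g \<zeta> = \<zeta>" if "g \<in> U" for g using fixed[OF that] by blast+
      show "D e e' = 1" "D e' e' = 0" "D e e = 0" by (simp_all add: e' D_self)
    qed (fact sc char U(1) \<zeta> D_add D_scale cU e' that)+
  qed
  have "realize (b g) = c g" if "g \<in> U" for g using b(2)[OF that] that by simp
  then obtain a m where "a \<in> carrier (Z1 (Gal \<iota>) (krull_topology \<iota>) perm)"
    "\<And>g. g \<in> carrier (Gal \<iota>) \<Longrightarrow> c g = realize (a g) + (\<rho> g m - m)"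
    using lift_from_subgroup[OF U index' c b(1)] by blast
  then show "y \<in> sum_phi ` carrier (sum_group UNIV (\<lambda>v. H1_stab \<iota> \<rho> v triv))"
    unfolding y using sum_phi_hits_liftable[OF _ c] by blast
qed

end

theorem corollary16p4:
  fixes \<iota> :: "'f::field \<Rightarrow> 'l::field"
    and scale :: "'p::prime_card mod_ring \<Rightarrow> 'v::ab_group_add \<Rightarrow> 'v"
    and \<rho> :: "('l \<Rightarrow> 'l) \<Rightarrow> 'v \<Rightarrow> 'v"
  assumes "CHAR('f) \<noteq> CARD('p)"
    and "separable_closure \<iota>"
    and "galois_representation \<iota> scale \<rho>"
    and "vector_space.dim scale UNIV = 2"
  shows "(\<lambda>x. \<Otimes>\<^bsub>H1 (Gal \<iota>) (krull_topology \<iota>) \<rho>\<^esub>v\<in>UNIV. phi \<iota> scale \<rho> v (x v))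
           \<in> epi (sum_group UNIV (\<lambda>v. H1_stab \<iota> \<rho> v (\<lambda>\<sigma> (a :: 'p mod_ring). a)))
                  (H1 (Gal \<iota>) (krull_topology \<iota>) \<rho>)"
proof -
  interpret R: mod_p_representation \<iota> scale \<rho> by (rule mod_p_representation.intro) (rule assms(3))
  interpret \<iota>: field_hom \<iota> using assms(2) by (simp add: separable_closure_def)
  have "(of_nat CARD('p) :: 'f) \<noteq> 0" by (rule field_of_nat_prime_nonzero[OF prime_card assms(1)])
  moreover have "\<iota> (of_nat n) = of_nat n" for n by (induction n) (simp_all add: \<iota>.hom_add)
  ultimately have char: "(of_nat CARD('p) :: 'l) \<noteq> 0" by (metis \<iota>.hom_0_iff)
  obtain B where B: "R.independent B" "UNIV \<subseteq> R.span B" "card B = 2"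
    using R.basis_exists[of UNIV] assms(4) by metis
  then obtain b1 b2 where b: "B = {b1, b2}" "b1 \<noteq> b2" by (auto simp: card_2_iff)
  have span: "v \<in> R.span B" for v using B(2) by blast
  interpret P: mod_p_plane \<iota> scale \<rho> b1 b2 "\<lambda>v. R.representation B v b1" "\<lambda>v. R.representation B v b2"
  proof unfold_locales
    fix v w a
    have "(\<Sum>b\<in>B. scale (R.representation B v b) b) = v"
      using b(1) by (intro R.sum_representation_eq[OF B(1) span]) auto
    then show "v = scale (R.representation B v b1) b1 + scale (R.representation B v b2) b2"
      using b by simp
  qed (use b R.representation_add[OF B(1) span span] R.representation_scale[OF B(1) span]
       R.representation_basis[OF B(1)] in auto)
  have "R.sum_phi \<in> epi (sum_group UNIV (\<lambda>v. H1_stab \<iota> \<rho> v (\<lambda>\<sigma> (a :: 'p mod_ring). a))) (H1 (Gal \<iota>) (krull_topology \<iota>) \<rho>)"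
    unfolding epi_def using R.sum_phi_hom P.surj_sum_phi[OF assms(2) char] by blast
  then show ?thesis unfolding R.sum_phi_def[abs_def] .
qed

end
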